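(* Let $X_{jk}$, $j,k\ge1$, be independent identically distributed complex random variables with $$\mathbf{E}X_{jk}=0,\qquad \mathbf{E}|X_{jk}|^2=1,\qquad \mathbf{E}|X_{jk}|^4=M<\infty.$$ Then, for every fixed integer $m\ge2$, $$\lim_{n\to\infty}\Delta_n^{(m)}=0 .$$
   Context: $I\{E\}$ denotes the indicator of an event $E$. Let $\mathbf X$ be the $n\times n$ matrix with entries $[\mathbf X]_{jk}=X_{jk}$, $1\le j,k\le n$, and let $s_1^{(m)}\ge\dots\ge s_n^{(m)}$ be the singular values of $\mathbf W:=n^{-m/2}\mathbf X^m$. The empirical distribution function of the squared singular values is $\mathcal F_n^{(m)}(x)=\frac1n\sum_{k=1}^n I\{(s_k^{(m)})^2\le x\}$, and $F_n^{(m)}(x)=\mathbf{E}\,\mathcal F_n^{(m)}(x)$. $G^{(m)}$ is the distribution function defined by its moments, the Fuss--Catalan numbers: for every integer $k\ge 0$, $$\int_{\mathbb R}x^k\,dG^{(m)}(x)=\frac{1}{mk+1}\binom{mk+k}{k}.$$ The Kolmogorov distance is $\Delta_n^{(m)}:=\sup_x|F_n^{(m)}(x)-G^{(m)}(x)|$. *)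

theory Defs
  imports "HOL-Probability.Probability" "Jordan_Normal_Form.Schur_Decomposition"
begin

text \<open>The singular values of an \<open>n \<times> n\<close> matrix \<open>A\<close> are the square roots of the \<open>n\<close> eigenvalues of
  \<open>A\<^sup>* A\<close>, listed in non-increasing order and with multiplicity. The eigenvalues are the roots of the
  characteristic polynomial; they are non-negative reals, so that \<^const>\<open>Re\<close> only changes the type.
  The list is indexed from \<open>0\<close>.\<close>

definition singular_values :: "complex mat \<Rightarrow> real list" where
  "singular_values A =
     rev (sorted_list_of_multiset
       (image_mset (\<lambda>z. sqrt (Re z)) (proots (char_poly (mat_adjoint A * A)))))"

text \<open>The library indexes matrices from \<open>0\<close>, while the variables \<open>X j k\<close> are indexed by \<open>j, k \<ge> 1\<close>.\<close>

definition entry_matrix :: "(nat \<Rightarrow> nat \<Rightarrow> 'a \<Rightarrow> complex) \<Rightarrow> nat \<Rightarrow> 'a \<Rightarrow> complex mat" where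
  "entry_matrix X n \<omega> = Matrix.mat n n (\<lambda>(j, k). X (Suc j) (Suc k) \<omega>)"

definition scaled_power :: "(nat \<Rightarrow> nat \<Rightarrow> 'a \<Rightarrow> complex) \<Rightarrow> nat \<Rightarrow> nat \<Rightarrow> 'a \<Rightarrow> complex mat" where
  "scaled_power X m n \<omega> =
     complex_of_real (real n powr (- (real m / 2))) \<cdot>\<^sub>m (entry_matrix X n \<omega> ^\<^sub>m m)"

definition empirical_cdf ::
  "(nat \<Rightarrow> nat \<Rightarrow> 'a \<Rightarrow> complex) \<Rightarrow> nat \<Rightarrow> nat \<Rightarrow> real \<Rightarrow> 'a \<Rightarrow> real" where
  "empirical_cdf X m n x \<omega> =
     1 / real n * (\<Sum>k<n. of_bool ((singular_values (scaled_power X m n \<omega>) ! k)\<^sup>2 \<le> x))"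

definition expected_cdf ::
  "'a measure \<Rightarrow> (nat \<Rightarrow> nat \<Rightarrow> 'a \<Rightarrow> complex) \<Rightarrow> nat \<Rightarrow> nat \<Rightarrow> real \<Rightarrow> real" where
  "expected_cdf P X m n x = (\<integral>\<omega>. empirical_cdf X m n x \<omega> \<partial>P)"

text \<open>The moment problem for the Fuss--Catalan numbers has exactly one solution, which is
  the probability measure selected here. Integrability is required separately because the
  Bochner integral of a non-integrable function is \<open>0\<close>.\<close>

definition fuss_catalan_measure :: "nat \<Rightarrow> real measure" where
  "fuss_catalan_measure m = (THE \<mu>. real_distribution \<mu> \<and>
     (\<forall>k::nat. integrable \<mu> (\<lambda>x. x ^ k) \<and>
        (\<integral>x. x ^ k \<partial>\<mu>) = 1 / real (m * k + 1) * real ((m * k + k) choose k)))"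

definition fuss_catalan_cdf :: "nat \<Rightarrow> real \<Rightarrow> real" where
  "fuss_catalan_cdf m = cdf (fuss_catalan_measure m)"

definition kolmogorov_distance ::
  "'a measure \<Rightarrow> (nat \<Rightarrow> nat \<Rightarrow> 'a \<Rightarrow> complex) \<Rightarrow> nat \<Rightarrow> nat \<Rightarrow> real" where
  "kolmogorov_distance P X m n = (SUP x. \<bar>expected_cdf P X m n x - fuss_catalan_cdf m x\<bar>)"

end

theory Submission
  imports Defs "HOL-Computational_Algebra.Formal_Laurent_Series"
begin

text \<open>Since the fourth moment is finite, truncating the entries at \<open>sqrt n\<close> leaves the whole matrix
  unchanged with probability tending to \<open>1\<close>. For the truncated matrix \<open>Y\<close>, the \<open>p\<close>-th moment of the
  expected empirical law is \<open>n\<^sup>-\<^sup>1\<^sup>-\<^sup>m\<^sup>p\<close> times a sum over closed walks of length \<open>2 m p\<close>; a matrix position that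
  the walk visits contributes \<open>O(1/n)\<close> to the expectation, and \<open>O(n\<^sup>-\<^sup>3\<^sup>/\<^sup>2)\<close> unless it is visited exactly twice.
  A walk has at most one vertex more than it has edges, so only walks on trees that traverse every edge
  once in each direction survive. A first-return decomposition, together with invariance under
  rotation, shows that the generating function \<open>C\<close> of their shapes satisfies \<open>C = 1 + z C\<^sup>m\<^sup>+\<^sup>1\<close>, and
  Lagrange inversion gives the Fuss--Catalan numbers.

  These numbers are the moments of a scaled product of independent Beta variables, which has compact
  support (so it is determined by its moments) and no atoms. Hence the moments determine the limit,
  and convergence of the distribution functions is uniform.\<close>

section \<open>Lagrange inversion for the Fuss--Catalan equation\<close>

text \<open>The same matrix occurs in every factor, so any two letters of the trace word may read
  the same position, and nothing is assumed about E X^2. Trees settle this: a closed walk that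
  crosses a tree edge there and back reads one position once plainly and once conjugated, so only
  E|X|^2 enters. Truncation does not recentre the entries; the fourth moment keeps the new mean so
  small that a position visited once contributes at most what is allowed for one visited three
  times. The level sqrt n balances two demands: it controls the moments of order above four, and the
  probability that one of the n^2 entries exceeds it is at most a tail of the fourth moment.
  First-return cuts of the periodic word begin at every phase; as rotation preserves the count, all
  windows of equally many whole periods count alike, and the recursion closes on one unknown series,
  with one factor \<open>C\<close> for each of the \<open>m\<close> levels of the height profile of
  the word and one more at its top.\<close>

lemma fls_residue_deriv_times_power:
  fixes y :: "real fls"
  shows "fls_residue (fls_deriv y * y ^ j) = 0"
proof -
  have "fls_deriv (y ^ Suc j) = of_nat (Suc j) * (fls_deriv y * y ^ j)"
    by (subst fls_deriv_power) (simp add: mult_ac)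
  then have "of_nat (Suc j) * fls_residue (fls_deriv y * y ^ j) = 0"
    using fls_residue_deriv[of "y ^ Suc j"] fls_residue_of_int_times(1)[of "int (Suc j)" "fls_deriv y * y ^ j"]
    by (metis of_int_of_nat_eq)
  then show ?thesis by (simp del: of_nat_Suc)
qed

text \<open>As in the previous lemma, the derivative of \<open>y\<close> times a power of
  \<open>y\<close> is itself a derivative up to a factor, and derivatives have no residue. Only the
  exponent -1 escapes: there the residue is the order of \<open>y\<close>.\<close>

lemma fls_residue_deriv_times_inverse_power:
  fixes y :: "real fls"
  assumes "y \<noteq> 0"
  shows "fls_residue (fls_deriv y * inverse y ^ (j + 2)) = 0"
proof -
  have "fls_deriv (inverse y) * inverse y ^ j = - (fls_deriv y * inverse y ^ (j + 2))"
    by (simp add: fls_inverse_deriv power_add mult_ac power2_eq_square)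
  then show ?thesis
    using fls_residue_deriv_times_power[of "inverse y" j] by simp
qed

lemma fls_nth_sum: "fls_nth (sum f A) n = (\<Sum>i\<in>A. fls_nth (f i) n)"
  by (induction A rule: infinite_finite_induct) auto

text \<open>A change of variable in a residue. The left side is the residue of Y' X^(-n); the
  equation turns X^(-1) into (1 + Y)^r / Y, and in the binomial expansion only the term with Y' / Y,
  where i = n - 1, has a residue, namely 1.\<close>

lemma lagrange_inversion_one_plus_power:
  fixes y :: "real fps"
  assumes y: "y = fps_X * (1 + y) ^ r" and n: "n \<ge> 1"
  shows "real n * fps_nth y n = real ((r * n) choose (n - 1))"
proof -
  have y0: "fps_nth y 0 = 0"
    by (subst y) simp
  have y1: "fps_nth y 1 = 1"
    using y0 by (subst y) (simp add: fps_nth_power_0)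
  have sub: "subdegree y = 1"
    using y0 y1 by (intro subdegreeI) auto
  define Y where "Y = fps_to_fls y"
  have Y0: "Y \<noteq> 0" using y1 by (auto simp: Y_def)
  have subY: "fls_subdegree Y = 1"
    by (simp add: Y_def fls_subdegree_fls_to_fps sub)
  have YX: "Y = fls_X * (1 + Y) ^ r"
    unfolding Y_def by (subst y) (simp add: fls_times_fps_to_fls fps_to_fls_power)
  have "fls_X \<noteq> (0 :: real fls)" by simp
  then have eq: "fls_X_inv ^ n = (1 + Y) ^ (r * n) * inverse Y ^ n"
    using YX Y0 
    by (metis (no_types, lifting) field_class.field_inverse fls_inverse_X mult.commute mult.left_commute
        mult_1 power_mult power_mult_distrib power_one)
  have "fls_residue (fls_deriv Y * fls_X_inv ^ n) = real n * fps_nth y n"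
    using n by (simp add: Y_def fls_X_inv_power_times_conv_shift fls_deriv_fps_to_fls nat_diff_distrib)
  moreover have "fls_residue (fls_deriv Y * fls_X_inv ^ n) = real ((r * n) choose (n - 1))"
  proof -
    have "fls_deriv Y * fls_X_inv ^ n = (\<Sum>i\<le>r * n. of_nat ((r * n) choose i) * (fls_deriv Y * (Y ^ i * inverse Y ^ n)))"
      unfolding eq by (subst add.commute) (simp add: binomial_ring sum_distrib_left sum_distrib_right mult_ac)
    then have sum: "fls_residue (fls_deriv Y * fls_X_inv ^ n)
        = (\<Sum>i\<le>r * n. real ((r * n) choose i) * fls_residue (fls_deriv Y * (Y ^ i * inverse Y ^ n)))"
      by (simp add: fls_nth_sum fls_mult_of_nat_nth)
    have res: "fls_residue (fls_deriv Y * (Y ^ i * inverse Y ^ n)) = (if i = n - 1 then 1 else 0)" for i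
    proof -
      consider "i \<ge> n" | "i = n - 1" | "i + 2 \<le> n" using n by linarith
      then show ?thesis
      proof cases
        case 1
        then have "Y ^ i * inverse Y ^ n = Y ^ (i - n)"
          using Y0 by (simp add: power_diff field_simps)
        then show ?thesis using fls_residue_deriv_times_power[of Y "i - n"] 1 n by simp
      next
        case 2
        then have "Y ^ i * inverse Y ^ n = inverse Y"
          using Y0 n by (cases n) (simp_all add: field_simps)
        then show ?thesis using fls_residue_deriv_times_inverse_eq_subdegree(1)[of Y] 2 subY by simp
      next
        case 3
        then have "Y ^ i * inverse Y ^ n = inverse Y ^ (n - i - 2 + 2)"
          using Y0 by (simp add: power_diff field_simps)
        then show ?thesis using fls_residue_deriv_times_inverse_power[OF Y0, of "n - i - 2"] 3 n by simp
      qed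
    qed
    show ?thesis
      unfolding sum res by (auto simp: if_distrib[of "(*) _"] sum.delta' not_le binomial_eq_0 cong: if_cong)
  qed
  ultimately show ?thesis by simp
qed

lemma fuss_catalan_of_fps_equation:
  fixes C :: "real fps"
  assumes C: "C = 1 + fps_X * C ^ (m + 1)"
  shows "fps_nth C k = 1 / real (m * k + 1) * real ((m * k + k) choose k)"
proof (cases "k = 0")
  case True
  then show ?thesis by (subst C) simp
next
  case False
  have "C - 1 = fps_X * (1 + (C - 1)) ^ (m + 1)" using C by (simp add: algebra_simps)
  from lagrange_inversion_one_plus_power[OF this, of k] False
  have "real k * fps_nth C k = real (((m + 1) * k) choose (k - 1))" by simp
  moreover have "real (m * k + 1) * real (((m + 1) * k) choose (k - 1)) = real k * real ((m * k + k) choose k)"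
  proof -
    obtain l where l: "k = Suc l" using False by (cases k) auto
    have "Suc l * ((m * k + k) choose Suc l) = (m * k + k - l) * ((m * k + k) choose l)"
      using Suc_times_binomial_add[of l "m * k + k - Suc l"] l by (simp add: add.commute add.left_commute)
    then have "k * ((m * k + k) choose k) = (m * k + 1) * (((m + 1) * k) choose (k - 1))"
      using l by (simp add: algebra_simps)
    then show ?thesis by (metis of_nat_mult)
  qed
  ultimately have "real k * (real (m * k + 1) * fps_nth C k) = real k * real ((m * k + k) choose k)"
    by (metis mult.left_commute)
  then have "real (m * k + 1) * fps_nth C k = real ((m * k + k) choose k)"
    using False by simp
  moreover have "real (m * k + 1) \<noteq> 0" by (simp only: of_nat_eq_0_iff)
  ultimately show ?thesis by (metis nonzero_mult_div_cancel_left times_divide_eq_left mult_1)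
qed

section \<open>Closed walks on trees\<close>

text \<open>Split at the first return to the root \<open>a\<close>: an excursion \<open>u1\<close>
  through the subtree of one child, then the rest \<open>a # u2\<close> of the walk. The return step
  carries the letter opposite to that of the outward step, so that both read the same position of
  the matrix.\<close>

inductive tree_walk :: "bool list \<Rightarrow> 'v list \<Rightarrow> bool" where
  tree_walk_Nil: "tree_walk [] [a]"
| tree_walk_Cons: "tree_walk w1 u1 \<Longrightarrow> tree_walk w2 (a # u2) \<Longrightarrow> set u1 \<inter> set (a # u2) = {} \<Longrightarrow>
    tree_walk (s # w1 @ (\<not> s) # w2) (a # u1 @ a # u2)"

lemma tree_walk_props:
  assumes "tree_walk w v"
  shows "length v = Suc (length w)" "v \<noteq> []" "hd v = last v" "even (length w)"
    "card (set v) = length w div 2 + 1"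
proof -
  have "length v = Suc (length w) \<and> v \<noteq> [] \<and> hd v = last v \<and> even (length w) \<and>
      card (set v) = length w div 2 + 1"
    using assms
  proof induction
    case (tree_walk_Cons w1 u1 w2 a u2 s)
    have "set (a # u1 @ a # u2) = set u1 \<union> set (a # u2)" by auto
    then have "card (set (a # u1 @ a # u2)) = card (set u1) + card (set (a # u2))"
      using tree_walk_Cons.hyps(3) by (metis card_Un_disjoint List.finite_set)
    with tree_walk_Cons show ?case by (auto elim!: evenE)
  qed auto
  then show "length v = Suc (length w)" "v \<noteq> []" "hd v = last v" "even (length w)"
    "card (set v) = length w div 2 + 1" by auto
qed

text \<open>The number of noncrossing perfect matchings of the positions of the word in which
  matched letters are opposite; \<open>j\<close> is the partner of the first letter, counted within
  \<open>w\<close>.\<close>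

fun tree_walk_shapes :: "bool list \<Rightarrow> nat" where
  "tree_walk_shapes [] = 1"
| "tree_walk_shapes (s # w) = (\<Sum>j | j < length w \<and> w ! j = (\<not> s).
     tree_walk_shapes (take j w) * tree_walk_shapes (drop (Suc j) w))"

lemma tree_walk_shapes_balanced:
  "tree_walk_shapes w \<noteq> 0 \<Longrightarrow> count_list w True = count_list w False"
proof (induction w rule: tree_walk_shapes.induct)
  case (2 s w)
  obtain j where j: "j < length w" "w ! j = (\<not> s)"
    and nz: "tree_walk_shapes (take j w) \<noteq> 0" "tree_walk_shapes (drop (Suc j) w) \<noteq> 0"
    using "2.prems" by (auto elim!: sum.not_neutral_contains_not_neutral)
  have "count_list (take j w) True = count_list (take j w) False"
    "count_list (drop (Suc j) w) True = count_list (drop (Suc j) w) False"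
    using "2.IH" j nz by auto
  moreover have "count_list w x = count_list (take j w) x + (if w ! j = x then 1 else 0) + count_list (drop (Suc j) w) x" for x
    using arg_cong[OF id_take_nth_drop[OF j(1)], of "\<lambda>w. count_list w x"] by (simp add: count_list_append)
  ultimately show ?case using j(2) by (cases s) auto
qed simp

lemma tree_walk_shapes_even:
  assumes "tree_walk_shapes w \<noteq> 0"
  shows "even (length w)"
proof -
  have "length w = count_list w True + count_list w False"
    by (induction w) auto
  with tree_walk_shapes_balanced[OF assms] show ?thesis by simp
qed

text \<open>The falling factorial. Truncated subtraction puts a factor 0 into it once k > n, as
  befits a count of injective labellings.\<close>

definition falling :: "nat \<Rightarrow> nat \<Rightarrow> nat" where
  "falling n k = (\<Prod>i<k. n - i)"

lemma falling_add: "falling n (k + l) = falling n k * falling (n - k) l"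
  by (induction l) (auto simp: falling_def mult.assoc)

lemma falling_pos: "k \<le> n \<Longrightarrow> falling n k > 0"
  by (auto simp: falling_def intro!: prod_pos)

definition tree_walks :: "'v set \<Rightarrow> bool list \<Rightarrow> 'v list set" where
  "tree_walks A w = {v. tree_walk w v \<and> set v \<subseteq> A}"

lemma finite_tree_walks: "finite A \<Longrightarrow> finite (tree_walks A w)"
  by (rule finite_subset[OF _ finite_lists_length_eq[of A "Suc (length w)"]])
    (auto simp: tree_walks_def tree_walk_props)

lemma tree_walks_Nil: "tree_walks A [] = (\<lambda>a. [a]) ` A"
  by (auto simp: tree_walks_def elim: tree_walk.cases intro: tree_walk_Nil)

text \<open>The second walk starts at the root, so the root is read off as \<open>hd u2\<close>;
  taking \<open>set u1\<close> away from its labels encodes that the first subtree is never visited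
  again.\<close>

lemma tree_walks_Cons:
  "tree_walks A (s # w) = (\<Union>j\<in>{j. j < length w \<and> w ! j = (\<not> s)}.
     (\<lambda>(u1, u2). hd u2 # u1 @ u2) `
       (SIGMA u1 : tree_walks A (take j w). tree_walks (A - set u1) (drop (Suc j) w)))"
  (is "?L = ?R")
proof (intro equalityI subsetI)
  fix v assume "v \<in> ?L"
  then have "tree_walk (s # w) v" "set v \<subseteq> A" by (auto simp: tree_walks_def)
  from this(1) show "v \<in> ?R"
  proof cases
    case (tree_walk_Cons w1 u1 w2 a u2)
    have len: "j < length w \<and> w ! j = (\<not> s) \<and> take j w = w1 \<and> drop (Suc j) w = w2" if "j = length w1" for j
      using tree_walk_Cons(1) that by (auto simp: nth_append)
    have "(u1, a # u2) \<in> (SIGMA u1 : tree_walks A w1. tree_walks (A - set u1) w2)"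
      using tree_walk_Cons \<open>set v \<subseteq> A\<close> by (auto simp: tree_walks_def)
    then show ?thesis
      using len[OF refl] tree_walk_Cons(2) by (intro UN_I[of "length w1"] image_eqI[of _ _ "(u1, a # u2)"]) auto
  qed
next
  fix v assume "v \<in> ?R"
  then obtain j u1 u2 where j: "j < length w" "w ! j = (\<not> s)" and v: "v = hd u2 # u1 @ u2"
    and u: "tree_walk (take j w) u1" "set u1 \<subseteq> A" "tree_walk (drop (Suc j) w) u2" "set u2 \<subseteq> A - set u1"
    by (auto simp: tree_walks_def)
  have ne: "u2 \<noteq> []" using tree_walk_props(2)[OF u(3)] .
  then obtain a u2' where u2: "u2 = a # u2'" by (cases u2) auto
  have "tree_walk (s # take j w @ (\<not> s) # drop (Suc j) w) (a # u1 @ a # u2')"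
    using u u2 by (intro tree_walk_Cons) auto
  moreover have "take j w @ (\<not> s) # drop (Suc j) w = w"
    unfolding j(2)[symmetric] by (rule id_take_nth_drop[symmetric, OF j(1)])
  ultimately have "tree_walk (s # w) v"
    using v u2 by simp
  then show "v \<in> ?L" using u v u2 by (auto simp: tree_walks_def)
qed

text \<open>A shape with L letters has L div 2 + 1 vertices, whose labels are chosen without
  repetition: those of the first excursion, then those of the rest from what remains.
  \<open>falling_add\<close> merges the two choices.\<close>

lemma card_tree_walks:
  "finite A \<Longrightarrow> card (tree_walks A w) = tree_walk_shapes w * falling (card A) (length w div 2 + 1)"
proof (induction w arbitrary: A rule: tree_walk_shapes.induct)
  case 1
  then show ?case by (simp add: tree_walks_Nil card_image inj_on_def falling_def)
next
  case (2 s w)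
  let ?J = "{j. j < length w \<and> w ! j = (\<not> s)}"
  let ?S = "\<lambda>j. SIGMA u1 : tree_walks A (take j w). tree_walks (A - set u1) (drop (Suc j) w)"
  let ?g = "\<lambda>(u1, u2). hd u2 # u1 @ u2"
  \<comment> \<open>The first return to the root recovers the decomposition.\<close>
  define F where "F x = (takeWhile (\<lambda>y. y \<noteq> hd x) (tl x), dropWhile (\<lambda>y. y \<noteq> hd x) (tl x))" for x :: "'a list"
  have F: "F (?g p) = p" if "p \<in> ?S j" for p j
  proof -
    obtain u1 u2 where p: "p = (u1, u2)" by (cases p)
    have "u2 \<noteq> []" "set u1 \<inter> set u2 = {}"
      using that tree_walk_props(2) by (auto simp: tree_walks_def p)
    then show ?thesis by (cases u2) (auto simp: F_def p takeWhile_append dropWhile_append)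
  qed
  have inj: "inj_on ?g (?S j)" for j
    using F by (rule inj_on_inverseI)
  have disj: "?g ` ?S i \<inter> ?g ` ?S j = {}" if "i \<in> ?J" "j \<in> ?J" "i \<noteq> j" for i j
  proof (rule ccontr)
    assume "?g ` ?S i \<inter> ?g ` ?S j \<noteq> {}"
    then obtain p q where pq: "p \<in> ?S i" "q \<in> ?S j" "?g p = ?g q"
      by blast
    have "p = q" using arg_cong[OF pq(3), of F] unfolding F[OF pq(1)] F[OF pq(2)] .
    then have "tree_walk (take i w) (fst p)" "tree_walk (take j w) (fst p)"
      using pq(1,2) by (auto simp: tree_walks_def)
    then have "length (fst p) = Suc i" "length (fst p) = Suc j"
      using that by (auto dest!: tree_walk_props(1))
    then show False using that by simp
  qed
  have "card (tree_walks A (s # w)) = (\<Sum>j\<in>?J. card (?g ` ?S j))"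
    unfolding tree_walks_Cons using disj "2.prems"
    by (intro card_UN_disjoint) (auto intro!: finite_imageI finite_SigmaI finite_tree_walks)
  also have "\<dots> = (\<Sum>j\<in>?J. tree_walk_shapes (take j w) * tree_walk_shapes (drop (Suc j) w) *
      falling (card A) (length (s # w) div 2 + 1))"
  proof (rule sum.cong[OF refl])
    fix j assume j: "j \<in> ?J"
    let ?V1 = "length (take j w) div 2 + 1" and ?V2 = "length (drop (Suc j) w) div 2 + 1"
    have "card (?g ` ?S j) = (\<Sum>u1\<in>tree_walks A (take j w). card (tree_walks (A - set u1) (drop (Suc j) w)))"
      using inj "2.prems" by (subst card_image) (auto intro!: card_SigmaI finite_tree_walks)
    also have "\<dots> = (\<Sum>u1\<in>tree_walks A (take j w). tree_walk_shapes (drop (Suc j) w) * falling (card A - ?V1) ?V2)"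
    proof (rule sum.cong[OF refl])
      fix u1 assume u1: "u1 \<in> tree_walks A (take j w)"
      then have "card (A - set u1) = card A - ?V1"
        using tree_walk_props(5)[of "take j w" u1] "2.prems" by (auto simp: tree_walks_def card_Diff_subset)
      then show "card (tree_walks (A - set u1) (drop (Suc j) w)) = tree_walk_shapes (drop (Suc j) w) * falling (card A - ?V1) ?V2"
        using "2.IH"(2)[of j "A - set u1"] "2.prems" j by simp
    qed
    also have "\<dots> = tree_walk_shapes (take j w) * tree_walk_shapes (drop (Suc j) w) * falling (card A) (?V1 + ?V2)"
      unfolding falling_add[of "card A" ?V1 ?V2] using "2.IH"(1)[of j A] "2.prems" j by simp
    also have "\<dots> = tree_walk_shapes (take j w) * tree_walk_shapes (drop (Suc j) w) *
      falling (card A) (length (s # w) div 2 + 1)"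
    \<comment> \<open>As division rounds down, the vertex counts of the parts add up to that of the
      whole only if both parts have even length. A part of odd length has no shapes at all.\<close>
    proof (cases "tree_walk_shapes (take j w) = 0 \<or> tree_walk_shapes (drop (Suc j) w) = 0")
      case False
      then have "even (length (take j w))" "even (length (drop (Suc j) w))"
        using tree_walk_shapes_even by blast+
      moreover have "length (s # w) = length (take j w) + length (drop (Suc j) w) + 2" using j by auto
      ultimately have "?V1 + ?V2 = length (s # w) div 2 + 1" by presburger
      then show ?thesis by simp
    qed auto
    finally show "card (?g ` ?S j) = tree_walk_shapes (take j w) * tree_walk_shapes (drop (Suc j) w) *
      falling (card A) (length (s # w) div 2 + 1)" .
  qed
  finally show ?case by (simp add: sum_distrib_right)
qed

text \<open>A closed walk ends at its root and can therefore append one more excursion into a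
  disjoint tree. The induction hands the excursion on to the last piece of the first walk.\<close>

lemma tree_walk_rotate_aux:
  assumes "tree_walk w1 u1" "tree_walk w2 u2" "set u1 \<inter> set u2 = {}"
  shows "tree_walk (w1 @ (\<not> s) # w2 @ [s]) (u1 @ u2 @ [hd u1])"
  using assms
proof (induction arbitrary: u2)
  case (tree_walk_Nil a)
  then show ?case using tree_walk_Cons[of w2 u2 "[]" a "[]" "\<not> s"] tree_walk.tree_walk_Nil[of a] by simp
next
  case (tree_walk_Cons w11 u11 w12 a u12 s')
  then have "tree_walk (w12 @ (\<not> s) # w2 @ [s]) (a # u12 @ u2 @ [a])" by auto
  from tree_walk.tree_walk_Cons[OF tree_walk_Cons.hyps(1) this, of s'] tree_walk_Cons
  show ?case by auto
qed

text \<open>Re-rooting at the first child \<open>hd (tl v)\<close>: the old root, with everything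
  after the first return, becomes the last subtree of the new root.\<close>

lemma tree_walk_rotate:
  assumes "tree_walk (s # w) v"
  shows "tree_walk (w @ [s]) (tl v @ [hd (tl v)])"
  using assms
proof cases
  case (tree_walk_Cons w1 u1 w2 a u2)
  then show ?thesis
    using tree_walk_rotate_aux[of w1 u1 w2 "a # u2" s] tree_walk_props(2)[of w1 u1] by (cases u1) auto
qed

text \<open>Shapes are compared through labelled walks: \<open>length w + 1\<close> labels make the
  falling factorial positive, so that it cancels. An inequality is enough because rotations have
  finite order.\<close>

lemma tree_walk_shapes_rotate1_le: "tree_walk_shapes w \<le> tree_walk_shapes (rotate1 w)"
proof (cases w)
  case (Cons s w')
  let ?A = "{..<length w + 1}"
  let ?f = "\<lambda>v. tl v @ [hd (tl v)]"
  have "inj_on ?f (tree_walks ?A (s # w'))"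
  proof (rule inj_onI)
    fix x y assume xy: "x \<in> tree_walks ?A (s # w')" "y \<in> tree_walks ?A (s # w')" "?f x = ?f y"
    have "tl x = tl y" using xy(3) by simp
    \<comment> \<open>Dropping the root loses nothing: a closed walk repeats it at the end.\<close>
    moreover have "z = last (tl z) # tl z" if "z \<in> tree_walks ?A (s # w')" for z
    proof -
      have "length z = Suc (Suc (length w'))" "hd z = last z"
        using that tree_walk_props(1,3)[of "s # w'" z] by (auto simp: tree_walks_def)
      then show ?thesis by (cases z) (auto split: if_splits)
    qed
    ultimately show "x = y" using xy by metis
  qed
  moreover have "?f ` tree_walks ?A (s # w') \<subseteq> tree_walks ?A (w' @ [s])"
  proof
    fix y assume "y \<in> ?f ` tree_walks ?A (s # w')"
    then obtain x where x: "tree_walk (s # w') x" "set x \<subseteq> ?A" "y = ?f x"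
      by (auto simp: tree_walks_def)
    have "length x = Suc (Suc (length w'))" using tree_walk_props(1)[OF x(1)] by simp
    then obtain a b z where "x = a # b # z" by (auto simp: length_Suc_conv)
    then show "y \<in> tree_walks ?A (w' @ [s])"
      using tree_walk_rotate[OF x(1)] x by (auto simp: tree_walks_def)
  qed
  ultimately have "card (tree_walks ?A (s # w')) \<le> card (tree_walks ?A (w' @ [s]))"
    by (intro card_inj_on_le[of ?f]) (auto intro: finite_tree_walks)
  then have "tree_walk_shapes (s # w') * falling (length w + 1) (length w div 2 + 1)
      \<le> tree_walk_shapes (w' @ [s]) * falling (length w + 1) (length w div 2 + 1)"
    using Cons by (simp add: card_tree_walks del: tree_walk_shapes.simps)
  moreover have "falling (length w + 1) (length w div 2 + 1) > 0"
    by (rule falling_pos) simp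
  ultimately show ?thesis using Cons by (simp del: tree_walk_shapes.simps)
qed simp

lemma tree_walk_shapes_rotate: "tree_walk_shapes (rotate k w) = tree_walk_shapes w"
proof -
  have le: "tree_walk_shapes w \<le> tree_walk_shapes (rotate k w)" for k and w :: "bool list"
    by (induction k) (auto intro: order_trans tree_walk_shapes_rotate1_le)
  \<comment> \<open>\<open>?l\<close> further rotations complete the \<open>k\<close> given ones to
    \<open>k * length w\<close>, a number of full turns.\<close>
  let ?l = "k * length w - k"
  show ?thesis
  proof (cases "w = []")
    case False
    then have "k \<le> k * length w" by (cases w) auto
    then have "rotate ?l (rotate k w) = w"
      by (simp add: rotate_rotate)
    then show ?thesis using le[of w k] le[of "rotate k w" ?l] by simp
  qed simp
qed

lemma tree_walk_shapes_append: "tree_walk_shapes (w1 @ w2) = tree_walk_shapes (w2 @ w1)"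
  using tree_walk_shapes_rotate[of "length w1" "w1 @ w2"] by (simp add: rotate_append)

section \<open>Closed walks that traverse each edge twice\<close>

text \<open>The letter \<open>False\<close> stands for the adjoint matrix, whose entry at
  \<open>(a, b)\<close> is the conjugate of the entry at \<open>(b, a)\<close>.\<close>

fun edge_entry :: "bool \<Rightarrow> 'v \<Rightarrow> 'v \<Rightarrow> 'v \<times> 'v" where
  "edge_entry True a b = (a, b)"
| "edge_entry False a b = (b, a)"

fun walk_steps :: "bool list \<Rightarrow> 'v list \<Rightarrow> (('v \<times> 'v) \<times> bool) list" where
  "walk_steps [] v = []"
| "walk_steps (s # w) v = (edge_entry s (hd v) (hd (tl v)), s) # walk_steps w (tl v)"

lemma length_walk_steps [simp]: "length (walk_steps w v) = length w"
  by (induction w v rule: walk_steps.induct) auto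

lemma walk_steps_append:
  "length u = Suc (length w1) \<Longrightarrow>
   walk_steps (w1 @ s # w2) (u @ v) = walk_steps w1 u @ (edge_entry s (last u) (hd v), s) # walk_steps w2 v"
proof (induction w1 u rule: walk_steps.induct)
  case (1 u)
  then show ?case by (cases u) auto
next
  case (2 s' w u)
  then show ?case by (cases u; cases "tl u") auto
qed

lemma walk_steps_subset:
  "length v = Suc (length w) \<Longrightarrow> fst ` set (walk_steps w v) \<subseteq> set v \<times> set v"
proof (induction w v rule: walk_steps.induct)
  case (2 s w v)
  then show ?case by (cases v; cases "tl v"; cases s) auto
qed simp

text \<open>Going back along an edge with the opposite letter swaps the endpoints twice, so both
  crossings read one position, once plainly and once conjugated. Hence the mean of a tree walk is a
  product of E|Z|^2, without any E Z^2.\<close>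

lemma tree_walk_steps:
  assumes "tree_walk w v"
  obtains S where "finite S" "S \<subseteq> set v \<times> set v" "2 * card S = length w"
    "mset (walk_steps w v) = image_mset (\<lambda>e. (e, True)) (mset_set S) + image_mset (\<lambda>e. (e, False)) (mset_set S)"
proof -
  have "\<exists>S. finite S \<and> S \<subseteq> set v \<times> set v \<and> 2 * card S = length w \<and>
    mset (walk_steps w v) = image_mset (\<lambda>e. (e, True)) (mset_set S) + image_mset (\<lambda>e. (e, False)) (mset_set S)"
    using assms
  proof induction
    case (tree_walk_Nil a)
    then show ?case by (intro exI[of _ "{}"]) auto
  next
    case (tree_walk_Cons w1 u1 w2 a u2 s)
    then obtain S1 S2 where S1: "finite S1" "S1 \<subseteq> set u1 \<times> set u1" "2 * card S1 = length w1"
        "mset (walk_steps w1 u1) = image_mset (\<lambda>e. (e, True)) (mset_set S1) + image_mset (\<lambda>e. (e, False)) (mset_set S1)"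
      and S2: "finite S2" "S2 \<subseteq> set (a # u2) \<times> set (a # u2)" "2 * card S2 = length w2"
        "mset (walk_steps w2 (a # u2)) = image_mset (\<lambda>e. (e, True)) (mset_set S2) + image_mset (\<lambda>e. (e, False)) (mset_set S2)"
      by blast
    define b where "b = hd u1"
    have u1: "u1 \<noteq> []" "last u1 = b" "b \<in> set u1" "length u1 = Suc (length w1)"
      using tree_walk_props[OF tree_walk_Cons.hyps(1)] by (auto simp: b_def)
    define e where "e = edge_entry s a b"
    have e': "edge_entry (\<not> s) b a = e" by (cases s) (auto simp: e_def)
    have ab: "a \<notin> set u1" "b \<notin> set (a # u2)" using tree_walk_Cons.hyps(3) u1(3) by auto
    have eS: "e \<notin> S1" "e \<notin> S2" "e \<in> set (a # u1 @ a # u2) \<times> set (a # u1 @ a # u2)"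
      using S1(2) S2(2) ab u1(3) by (cases s; fastforce simp: e_def)+
    have disj: "S1 \<inter> S2 = {}" using S1(2) S2(2) tree_walk_Cons.hyps(3) by fastforce
    let ?S = "insert e (S1 \<union> S2)"
    have "walk_steps (s # w1 @ (\<not> s) # w2) (a # u1 @ a # u2)
        = (e, s) # walk_steps w1 u1 @ (e, \<not> s) # walk_steps w2 (a # u2)"
      using walk_steps_append[of u1 w1 "\<not> s" w2 "a # u2"] u1 e' by (simp add: e_def b_def)
    moreover have "mset_set ?S = {#e#} + mset_set S1 + mset_set S2"
      using S1 S2 eS disj by (simp add: mset_set_Union)
    ultimately have "mset (walk_steps (s # w1 @ (\<not> s) # w2) (a # u1 @ a # u2)) =
        image_mset (\<lambda>e. (e, True)) (mset_set ?S) + image_mset (\<lambda>e. (e, False)) (mset_set ?S)"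
      using S1(4) S2(4) by (cases s) (simp_all add: ac_simps)
    moreover have "card ?S = 1 + card S1 + card S2"
      using S1 S2 eS disj by (simp add: card_Un_disjoint)
    moreover have "?S \<subseteq> set (a # u1 @ a # u2) \<times> set (a # u1 @ a # u2)"
      using S1(2) S2(2) eS(3) by fastforce
    ultimately show ?case using S1 S2 by (intro exI[of _ ?S]) simp
  qed
  then show ?thesis using that by blast
qed

section \<open>Undirected edges of a walk and the bound on its number of vertices\<close>

fun walk_edges :: "'v list \<Rightarrow> 'v set set" where
  "walk_edges (a # b # v) = insert {a, b} (walk_edges (b # v))"
| "walk_edges v = {}"

lemma finite_walk_edges [simp]: "finite (walk_edges v)"
  by (induction v rule: walk_edges.induct) auto

lemma walk_edges_subset: "walk_edges v \<subseteq> Pow (set v) - {{}}"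
  by (induction v rule: walk_edges.induct) auto

lemma walk_edges_Cons: "v \<noteq> [] \<Longrightarrow> walk_edges (a # v) = insert {a, hd v} (walk_edges v)"
  by (cases v) auto

lemma walk_edges_append:
  "u \<noteq> [] \<Longrightarrow> v \<noteq> [] \<Longrightarrow> walk_edges (u @ v) = walk_edges u \<union> insert {last u, hd v} (walk_edges v)"
  by (induction u rule: walk_edges.induct) (auto simp: walk_edges_Cons)

lemma walk_edges_rev: "walk_edges (rev v) = walk_edges v"
  by (induction v rule: walk_edges.induct)
    (auto simp: walk_edges_append last_rev insert_commute simp del: append_assoc)

lemma walk_edges_steps:
  "length v = Suc (length w) \<Longrightarrow> (\<lambda>(a, b). {a, b}) ` fst ` set (walk_steps w v) = walk_edges v"
proof (induction w v rule: walk_steps.induct)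
  case (1 v)
  then show ?case by (cases v; cases "tl v") auto
next
  case (2 s w v)
  then show ?case by (cases v; cases "tl v"; cases s) (auto simp: insert_commute)
qed

text \<open>The invariant of a connected exploration: each new vertex comes with a new edge.\<close>

definition sparse_graph :: "'v set \<Rightarrow> 'v set set \<Rightarrow> bool" where
  "sparse_graph V F \<longleftrightarrow> finite V \<and> F \<subseteq> Pow V \<and> card V \<le> card F + 1"

lemma sparse_graph_extend:
  assumes "sparse_graph V F" "v \<noteq> []" "hd v \<in> V"
  shows "sparse_graph (V \<union> set v) (F \<union> walk_edges v)"
  using assms
proof (induction v arbitrary: V F rule: walk_edges.induct)
  case (1 a b v)
  have fin: "finite F" using 1(2) by (auto simp: sparse_graph_def intro: finite_subset)
  have "sparse_graph (insert b V) (insert {a, b} F)"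
  proof (cases "b \<in> V")
    case True
    have "card F \<le> card (insert {a, b} F)" using fin by (intro card_mono) auto
    then show ?thesis using 1(2,4) True by (auto simp: sparse_graph_def insert_absorb)
  next
    case False
    then have "{a, b} \<notin> F" using 1(2) by (auto simp: sparse_graph_def)
    then show ?thesis using 1(2,4) False fin by (auto simp: sparse_graph_def)
  qed
  from "1.IH"[OF this] 1(4) show ?case by (simp add: insert_absorb)
qed (auto simp: insert_absorb)

lemma sparse_graph_walk: "v \<noteq> [] \<Longrightarrow> sparse_graph (set v) (walk_edges v)"
  using sparse_graph_extend[of "{hd v}" "{}" v] by (simp add: sparse_graph_def insert_absorb)

text \<open>Both walks form one connected exploration: from a shared vertex \<open>x\<close>, the
  second walk is explored forward along \<open>q\<close> and backward along
  \<open>p\<close>.\<close>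

lemma sparse_graph_union:
  assumes "u \<noteq> []" "set u \<inter> set v \<noteq> {}"
  shows "sparse_graph (set u \<union> set v) (walk_edges u \<union> walk_edges v)"
proof -
  obtain x p q where x: "x \<in> set u" and v: "v = p @ x # q"
    using assms(2) by (meson disjoint_iff in_set_conv_decomp)
  have "sparse_graph (set u \<union> set (x # q)) (walk_edges u \<union> walk_edges (x # q))"
    using sparse_graph_extend[OF sparse_graph_walk[OF assms(1)], of "x # q"] x by simp
  from sparse_graph_extend[OF this, of "x # rev p"]
  have "sparse_graph (set u \<union> set (x # q) \<union> set (x # rev p)) (walk_edges u \<union> walk_edges (x # q) \<union> walk_edges (x # rev p))"
    by simp
  moreover have "walk_edges v = walk_edges (x # q) \<union> walk_edges (x # rev p)"
  proof (cases "p = []")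
    case False
    have "walk_edges (x # rev p) = walk_edges (p @ [x])"
      using walk_edges_rev[of "p @ [x]"] by simp
    then show ?thesis using False v by (auto simp: walk_edges_append)
  qed (use v in auto)
  moreover have "set u \<union> set v = set u \<union> set (x # q) \<union> set (x # rev p)" using v by auto
  ultimately show ?thesis by (simp add: Un_assoc)
qed

lemma card_vertices_le:
  assumes "length v = Suc (length w)"
  shows "card (set v) \<le> card (fst ` set (walk_steps w v)) + 1"
proof -
  have "card (set v) \<le> card (walk_edges v) + 1"
    using sparse_graph_walk[of v] assms by (cases v) (auto simp: sparse_graph_def)
  also have "card (walk_edges v) \<le> card (fst ` set (walk_steps w v))"
    unfolding walk_edges_steps[OF assms, symmetric] by (rule card_image_le) auto
  finally show ?thesis by simp
qed

text \<open>The first position read, \<open>e\<close>, is read exactly once more; cut the walk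
  there. Having the largest possible number of vertices forces the two parts to be disjoint, so
  \<open>e\<close> is a bridge and its second crossing goes back over it. The parts are then closed
  and extremal again, and induction applies.\<close>

theorem tree_walk_of_double_edges:
  assumes "length v = Suc (length w)" "hd v = last v"
    and "card (set v) = card (fst ` set (walk_steps w v)) + 1"
    and "\<And>e. e \<in> fst ` set (walk_steps w v) \<Longrightarrow> count_list (map fst (walk_steps w v)) e = 2"
  shows "tree_walk w v"
  using assms
proof (induction "length w" arbitrary: w v rule: less_induct)
  case less
  let ?U = "\<lambda>(a, b). {a, b}"
  show ?case
  proof (cases w)
    case Nil
    then obtain a where "v = [a]" using less.prems(1) by (auto simp: length_Suc_conv)
    then show ?thesis using Nil by (auto intro: tree_walk_Nil)
  next
    case (Cons s w')
    then obtain a v' where v: "v = a # v'" and len': "length v' = Suc (length w')"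
      using less.prems(1) by (cases v) auto
    have lastv': "last v' = a" using less.prems(2) v len' by (cases v') auto
    define b where "b = hd v'"
    define e where "e = edge_entry s a b"
    have steps: "walk_steps w v = (e, s) # walk_steps w' v'"
      using Cons v by (simp add: e_def b_def)
    have "count_list (map fst (walk_steps w' v')) e = 1"
      using less.prems(4)[of e] steps by simp
    then have "e \<in> fst ` set (walk_steps w' v')"
      by (metis count_list_0_iff image_set zero_neq_one)
    then obtain i where i: "i < length w'" "fst (walk_steps w' v' ! i) = e"
      by (auto simp: in_set_conv_nth)
    define w1 where "w1 = take i w'"
    define w2 where "w2 = drop (Suc i) w'"
    define s' where "s' = w' ! i"
    define u1 where "u1 = take (Suc i) v'"
    define u2 where "u2 = drop (Suc i) v'"
    have w': "w' = w1 @ s' # w2" unfolding w1_def w2_def s'_def using i(1) by (rule id_take_nth_drop)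
    have v': "v' = u1 @ u2" by (simp add: u1_def u2_def)
    have len: "length u1 = Suc (length w1)" "length u2 = Suc (length w2)" "length w1 = i"
      using i(1) len' by (auto simp: u1_def u2_def w1_def w2_def)
    have ne: "u1 \<noteq> []" "u2 \<noteq> []" using len by auto
    have "walk_steps w' v' = walk_steps w1 u1 @ (edge_entry s' (last u1) (hd u2), s') # walk_steps w2 u2"
      unfolding w' v' by (rule walk_steps_append[OF len(1)])
    moreover from this have es': "edge_entry s' (last u1) (hd u2) = e"
      using i(2) len(3) by (simp add: nth_append)
    ultimately have steps': "walk_steps w' v' = walk_steps w1 u1 @ (e, s') # walk_steps w2 u2" by simp
    let ?P = "fst ` set (walk_steps w v)" and ?P1 = "fst ` set (walk_steps w1 u1)" and ?P2 = "fst ` set (walk_steps w2 u2)"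
    have P: "?P = insert e (?P1 \<union> ?P2)" using steps steps' by auto
    have cnt: "count_list (map fst (walk_steps w v)) x =
      (if x = e then 2 else 0) + count_list (map fst (walk_steps w1 u1)) x + count_list (map fst (walk_steps w2 u2)) x" for x
      using steps steps' by (simp add: count_list_append)
    have "count_list (map fst (walk_steps w1 u1)) e = 0" "count_list (map fst (walk_steps w2 u2)) e = 0"
      using cnt[of e] less.prems(4)[of e] P by auto
    then have eP: "e \<notin> ?P1" "e \<notin> ?P2" by (auto simp: count_list_0_iff)
    have finP: "finite ?P" by simp
    \<comment> \<open>Vertices are at most edges plus one, and edges are at most positions. Equality
      of the outer terms forces equality throughout, so no two of the positions lie on the same
      undirected edge.\<close>
    have cardU: "card (?U ` ?P) = card ?P"
    proof -
      have "card (set v) \<le> card (walk_edges v) + 1"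
        using sparse_graph_walk[of v] v by (auto simp: sparse_graph_def)
      then show ?thesis
        using less.prems(3) walk_edges_steps[OF less.prems(1)] card_image_le[OF finP, of ?U] by simp
    qed
    then have inj: "inj_on ?U ?P" using finP by (rule eq_card_imp_inj_on[rotated])
    have E1: "?U ` ?P1 = walk_edges u1" and E2: "?U ` ?P2 = walk_edges u2"
      using walk_edges_steps len by blast+
    have eU: "?U e \<notin> walk_edges u1 \<union> walk_edges u2"
    proof
      assume "?U e \<in> walk_edges u1 \<union> walk_edges u2"
      then obtain e' where e': "e' \<in> ?P1 \<union> ?P2" "?U e = ?U e'"
        unfolding E1[symmetric] E2[symmetric] by blast
      have "e = e'" by (rule inj_onD[OF inj e'(2)]) (use e'(1) P in blast)+
      then show False using eP e'(1) by blast
    qed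
    have cardF: "card ?P = card (walk_edges u1 \<union> walk_edges u2) + 1"
    proof -
      have "?U ` ?P = insert (?U e) (walk_edges u1 \<union> walk_edges u2)"
        unfolding P E1[symmetric] E2[symmetric] by (simp add: image_Un)
      then show ?thesis using cardU eU by simp
    qed
    have a_u2: "a \<in> set u2" using lastv' v' ne by (metis last_appendR last_in_set)
    have b_u1: "b \<in> set u1" using v' ne by (auto simp: b_def)
    have setv: "set v = set u1 \<union> set u2" using v v' a_u2 by auto
    \<comment> \<open>If the parts met, they would be connected without \<open>e\<close> and still
      contain all vertices, with one edge too few for that.\<close>
    have disj: "set u1 \<inter> set u2 = {}"
    proof (rule ccontr)
      assume "set u1 \<inter> set u2 \<noteq> {}"
      from sparse_graph_union[OF ne(1) this] have "card (set v) \<le> card (walk_edges u1 \<union> walk_edges u2) + 1"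
        unfolding setv by (auto simp: sparse_graph_def)
      then show False using cardF less.prems(3) by simp
    qed
    have "last u1 \<in> set u1" "hd u2 \<in> set u2" using ne by auto
    \<comment> \<open>\<open>e\<close> joins two disjoint parts, which fixes its endpoint in each:
      the second crossing runs from \<open>b\<close> to \<open>a\<close>, and reading the position
      \<open>e\<close> in that direction takes the opposite letter.\<close>
    then have "last u1 = b \<and> hd u2 = a \<and> s' = (\<not> s)"
      using es' a_u2 b_u1 disj unfolding e_def by (cases s; cases s') auto
    then have u12: "last u1 = b" "hd u2 = a" "s' = (\<not> s)" by auto
    have disjE: "walk_edges u1 \<inter> walk_edges u2 = {}"
    proof (rule ccontr)
      assume "walk_edges u1 \<inter> walk_edges u2 \<noteq> {}"
      then obtain X where "X \<in> walk_edges u1" "X \<in> walk_edges u2" by blast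
      then have "X \<noteq> {}" "X \<subseteq> set u1" "X \<subseteq> set u2"
        using walk_edges_subset[of u1] walk_edges_subset[of u2] by blast+
      then show False using disj by blast
    qed
    have sub: "?P1 \<subseteq> ?P" "?P2 \<subseteq> ?P" unfolding P by blast+
    have inj1: "inj_on ?U ?P1" "inj_on ?U ?P2"
      by (rule inj_on_subset[OF inj sub(1)], rule inj_on_subset[OF inj sub(2)])
    have c: "card (walk_edges u1) = card ?P1" "card (walk_edges u2) = card ?P2"
      unfolding E1[symmetric] E2[symmetric] using inj1 by (auto intro: card_image)
    have le: "card (set u1) \<le> card ?P1 + 1" "card (set u2) \<le> card ?P2 + 1"
      using card_vertices_le len by blast+
    \<comment> \<open>The two bounds in \<open>le\<close> add up to an equality, so each of them is
      attained.\<close>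
    have "card (set u1) + card (set u2) = card ?P1 + card ?P2 + 2"
      using less.prems(3) cardF c setv disj disjE by (simp add: card_Un_disjoint)
    then have V: "card (set u1) = card ?P1 + 1" "card (set u2) = card ?P2 + 1" using le by auto
    have disjP: "?P1 \<inter> ?P2 = {}" using disjE unfolding E1[symmetric] E2[symmetric] by blast
    have cnt1: "count_list (map fst (walk_steps w1 u1)) x = 2" if "x \<in> ?P1" for x
    proof -
      have x: "x \<in> ?P" "x \<noteq> e" "x \<notin> ?P2" using that P eP disjP by blast+
      have "count_list (map fst (walk_steps w2 u2)) x = 0"
        using x(3) by (simp add: count_list_0_iff)
      then show ?thesis using cnt[of x] less.prems(4)[OF x(1)] unfolding if_not_P[OF x(2)] by linarith
    qed
    have cnt2: "count_list (map fst (walk_steps w2 u2)) x = 2" if "x \<in> ?P2" for x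
    proof -
      have x: "x \<in> ?P" "x \<noteq> e" "x \<notin> ?P1" using that P eP disjP by blast+
      have "count_list (map fst (walk_steps w1 u1)) x = 0"
        using x(3) by (simp add: count_list_0_iff)
      then show ?thesis using cnt[of x] less.prems(4)[OF x(1)] unfolding if_not_P[OF x(2)] by linarith
    qed
    have last2: "last u2 = a" using lastv' v' ne by simp
    have hd1: "hd u1 = b" using v' ne by (simp add: b_def)
    have "tree_walk w1 u1"
      using less.hyps[of w1 u1] Cons w' len V(1) cnt1 hd1 u12 by auto
    moreover have "tree_walk w2 u2"
      using less.hyps[of w2 u2] Cons w' len V(2) cnt2 last2 u12 by auto
    moreover obtain u2' where u2': "u2 = a # u2'" using u12(2) ne by (cases u2) auto
    ultimately have "tree_walk (s # w1 @ (\<not> s) # w2) (a # u1 @ a # u2')"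
      using disj by (intro tree_walk_Cons) auto
    then show ?thesis using Cons w' v v' u2' u12 by simp
  qed
qed

section \<open>Tree walks along the periodic word\<close>

text \<open>Letters depend on the absolute position, with period \<open>2 * m\<close>, so that a
  subword obtained by cutting remembers its phase.\<close>

definition block_letter :: "nat \<Rightarrow> nat \<Rightarrow> bool" where
  "block_letter m i \<longleftrightarrow> i mod (2 * m) < m"

definition block_word :: "nat \<Rightarrow> nat \<Rightarrow> nat \<Rightarrow> bool list" where
  "block_word m a b = map (block_letter m) [a..<b]"

text \<open>The tent profile with peaks of height \<open>m\<close> that a walk draws when
  \<open>True\<close> is a step up and \<open>False\<close> a step down.\<close>

definition block_height :: "nat \<Rightarrow> nat \<Rightarrow> int" where
  "block_height m i = (if i mod (2 * m) \<le> m then int (i mod (2 * m)) else int (2 * m) - int (i mod (2 * m)))"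

definition block_shapes :: "nat \<Rightarrow> nat \<Rightarrow> nat" where
  "block_shapes m q = tree_walk_shapes (block_word m 0 (2 * m * q))"

lemma block_letter_add: "block_letter m (i + 2 * m * q) = block_letter m i"
  by (simp add: block_letter_def)

lemma block_height_Suc:
  assumes "m \<ge> 1"
  shows "block_height m (Suc i) = block_height m i + (if block_letter m i then 1 else - 1)"
proof -
  have "i mod (2 * m) < 2 * m" using assms by simp
  then show ?thesis using assms
    by (auto simp: block_height_def block_letter_def mod_Suc)
qed

lemma block_word_height:
  assumes "m \<ge> 1" "a \<le> b"
  shows "int (count_list (block_word m a b) True) - int (count_list (block_word m a b) False)
    = block_height m b - block_height m a"
  using assms(2)
proof (induction b rule: dec_induct)
  case base
  then show ?case by (simp add: block_word_def)
next
  case (step b)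
  have "block_word m a (Suc b) = block_word m a b @ [block_letter m b]"
    using step.hyps by (simp add: block_word_def)
  then show ?case using step.IH block_height_Suc[OF assms(1), of b]
    by (auto simp: count_list_append)
qed

lemma block_word_Cons: "a < b \<Longrightarrow> block_word m a b = block_letter m a # block_word m (Suc a) b"
  by (simp add: block_word_def upt_conv_Cons)

text \<open>Shifting a window of whole periods by one position removes a letter in front and appends
  the same letter at the end, which is a rotation.\<close>

lemma tree_walk_shapes_block_period:
  "tree_walk_shapes (block_word m a (a + 2 * m * q)) = block_shapes m q"
proof (induction a)
  case (Suc a)
  show ?case
  proof (cases "2 * m * q = 0")
    case False
    have "block_word m (Suc a) (Suc a + 2 * m * q)
        = block_word m (Suc a) (a + 2 * m * q) @ [block_letter m a]"
      using False block_letter_add[of m a q] by (auto simp: block_word_def)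
    then have "tree_walk_shapes (block_word m (Suc a) (Suc a + 2 * m * q))
        = tree_walk_shapes ([block_letter m a] @ block_word m (Suc a) (a + 2 * m * q))"
      using tree_walk_shapes_append by metis
    also have "[block_letter m a] @ block_word m (Suc a) (a + 2 * m * q) = block_word m a (a + 2 * m * q)"
      using False block_word_Cons[of a "a + 2 * m * q" m] by simp
    finally show ?thesis using Suc by simp
  qed (auto simp: block_shapes_def block_word_def)
qed (simp add: block_shapes_def)

lemma tree_walk_shapes_block_rec:
  assumes "a < b"
  shows "tree_walk_shapes (block_word m a b) = (\<Sum>i | a < i \<and> i < b \<and> block_letter m i \<noteq> block_letter m a.
    tree_walk_shapes (block_word m (Suc a) i) * tree_walk_shapes (block_word m (Suc i) b))"
  unfolding block_word_Cons[OF assms] tree_walk_shapes.simps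
proof (rule sum.reindex_bij_witness[of _ "\<lambda>i. i - Suc a" "\<lambda>j. j + Suc a"])
  fix j assume "j \<in> {j. j < length (block_word m (Suc a) b) \<and> block_word m (Suc a) b ! j = (\<not> block_letter m a)}"
  then have j: "j < b - Suc a" "block_letter m (Suc a + j) = (\<not> block_letter m a)"
    by (auto simp: block_word_def)
  then show "j + Suc a \<in> {i. a < i \<and> i < b \<and> block_letter m i \<noteq> block_letter m a}"
    by (auto simp: add.commute)
  have "take j (block_word m (Suc a) b) = block_word m (Suc a) (j + Suc a)"
    "drop (Suc j) (block_word m (Suc a) b) = block_word m (Suc (j + Suc a)) b"
    using j(1) by (auto simp: block_word_def take_map drop_map take_upt drop_upt add_ac)
  then show "tree_walk_shapes (block_word m (Suc a) (j + Suc a)) * tree_walk_shapes (block_word m (Suc (j + Suc a)) b)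
      = tree_walk_shapes (take j (block_word m (Suc a) b)) * tree_walk_shapes (drop (Suc j) (block_word m (Suc a) b))"
    by simp
qed (auto simp: block_word_def)

text \<open>The word between two matched letters is balanced, so matched letters lie on the same level.\<close>

lemma tree_walk_shapes_block_level:
  assumes "j < m" "q \<ge> 1"
  shows "tree_walk_shapes (block_word m j (2 * m * q - j))
    = (\<Sum>r=1..q. tree_walk_shapes (block_word m (Suc j) (2 * m * r - Suc j)) * block_shapes m (q - r))"
proof -
  have m: "m \<ge> 1" using assms by simp
  have mq: "2 * m \<le> 2 * m * q" using assms by simp
  let ?t = "\<lambda>i. tree_walk_shapes (block_word m (Suc j) i) * tree_walk_shapes (block_word m (Suc i) (2 * m * q - j))"
  let ?I = "{i. j < i \<and> i < 2 * m * q - j \<and> block_letter m i \<noteq> block_letter m j}"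
  \<comment> \<open>The letter at \<open>j\<close> rises from height j to j + 1, so its partner
    falls from j + 1 to j. Such falls sit at the residue \<open>2 * m - Suc j\<close>, one in each
    period.\<close>
  let ?g = "\<lambda>r. 2 * m * r - Suc j"
  have g: "?g r mod (2 * m) = 2 * m - Suc j" "j < ?g r" if r: "r \<ge> 1" for r
  proof -
    obtain t where t: "r = Suc t" using r by (cases r) auto
    have eq: "?g r = (2 * m - Suc j) + 2 * m * t" using assms(1) by (simp add: t)
    show "?g r mod (2 * m) = 2 * m - Suc j"
      unfolding eq mod_mult_self2 using assms(1) by simp
    show "j < ?g r" unfolding eq using assms(1) by linarith
  qed
  have letter_j: "block_letter m j" using assms(1) by (simp add: block_letter_def)
  have "tree_walk_shapes (block_word m j (2 * m * q - j)) = sum ?t ?I"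
    using assms(1) mq by (intro tree_walk_shapes_block_rec) linarith
  also have "\<dots> = sum ?t (?g ` {1..q})"
  proof (rule sum.mono_neutral_right)
    show "?g ` {1..q} \<subseteq> ?I"
    proof
      fix i assume "i \<in> ?g ` {1..q}"
      then obtain r where r: "r \<in> {1..q}" "i = ?g r" by blast
      have "2 * m * r \<le> 2 * m * q" using r(1) by simp
      moreover have "j < ?g r" using g(2) r(1) by simp
      ultimately have "i < 2 * m * q - j" using r(2) by linarith
      then show "i \<in> ?I" using g[of r] r letter_j assms(1) by (auto simp: block_letter_def)
    qed
    show "\<forall>i\<in>?I - ?g ` {1..q}. ?t i = 0"
    proof
      fix i assume i: "i \<in> ?I - ?g ` {1..q}"
      have "tree_walk_shapes (block_word m (Suc j) i) = 0"
      proof (rule ccontr)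
        assume "tree_walk_shapes (block_word m (Suc j) i) \<noteq> 0"
        then have "block_height m i = block_height m (Suc j)"
          using tree_walk_shapes_balanced block_word_height[OF m, of "Suc j" i] i by fastforce
        moreover have "i mod (2 * m) \<ge> m" "i mod (2 * m) < 2 * m"
          using i letter_j m by (auto simp: block_letter_def)
        moreover have "Suc j mod (2 * m) = Suc j" using assms(1) by simp
        ultimately have md: "i mod (2 * m) = 2 * m - Suc j"
          using assms(1) by (auto simp: block_height_def split: if_splits)
        define r where "r = Suc (i div (2 * m))"
        have "i = 2 * m * (i div (2 * m)) + (2 * m - Suc j)"
          using mult_div_mod_eq[of "2 * m" i] md by simp
        then have ir: "i = ?g r" using assms(1) by (simp add: r_def)
        have "i < 2 * m * q - j" using i by blast
        then have "i < 2 * m * q" using diff_le_self by (rule less_le_trans)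
        then have "i < q * (2 * m)" by (simp add: mult_ac)
        then have "i div (2 * m) < q" by (rule less_mult_imp_div_less)
        then have "r \<le> q" by (simp add: r_def)
        moreover have "1 \<le> r" by (simp add: r_def)
        ultimately have "i \<in> ?g ` {1..q}" using ir by (intro image_eqI[of _ _ r]) simp_all
        then show False using i by blast
      qed
      then show "?t i = 0" by simp
    qed
  qed simp
  also have "\<dots> = (\<Sum>r=1..q. ?t (?g r))"
  proof (subst sum.reindex)
    show "inj_on ?g {1..q}"
    proof (rule inj_onI)
      fix x y assume xy: "x \<in> {1..q}" "y \<in> {1..q}" "?g x = ?g y"
      have "Suc j \<le> 2 * m * z" if "z \<in> {1..q}" for z
        using g(2)[of z] that by auto
      then have "2 * m * x = 2 * m * y" using xy by (metis eq_diff_iff)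
      then show "x = y" using m by simp
    qed
  qed simp
  also have "\<dots> = (\<Sum>r=1..q. tree_walk_shapes (block_word m (Suc j) (2 * m * r - Suc j)) * block_shapes m (q - r))"
  proof (rule sum.cong[OF refl])
    fix r assume r: "r \<in> {1..q}"
    have "2 * m * q = 2 * m * r + 2 * m * (q - r)"
      using r by (simp flip: distrib_left)
    \<comment> \<open>What follows the partner is a window of q - r whole periods, at another
      phase.\<close>
    then have "2 * m * q - j = Suc (?g r) + 2 * m * (q - r)"
      using g(2)[of r] r by auto
    then show "?t (?g r) = tree_walk_shapes (block_word m (Suc j) (2 * m * r - Suc j)) * block_shapes m (q - r)"
      by (simp only: tree_walk_shapes_block_period)
  qed
  finally show ?thesis .
qed

text \<open>\<open>N j\<close> collects the windows from position j to position 2 m q - j, which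
  begin and end at height j. Matching their first letter raises j by one and splits off a window of
  whole periods, a factor \<open>C\<close>. At the peak j = m the window itself consists of q - 1
  whole periods, which gives \<open>fps_X * C\<close>; hence
  \<open>N 0 = fps_X * C ^ (m + 1)\<close>.\<close>

theorem block_shapes_eq_fuss_catalan:
  assumes m: "m \<ge> 1"
  shows "real (block_shapes m q) = 1 / real (m * q + 1) * real ((m * q + q) choose q)"
proof -
  define C where "C = Abs_fps (\<lambda>q. real (block_shapes m q))"
  \<comment> \<open>For q = 0 truncated subtraction would leave the empty word with its one shape,
    hence the explicit 0.\<close>
  define N where "N j = Abs_fps (\<lambda>q. if q = 0 then 0 else
    real (tree_walk_shapes (block_word m j (2 * m * q - j))))" for j
  have N_step: "N j = N (Suc j) * C" if "j < m" for j
  proof (rule fps_ext)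
    fix q
    show "fps_nth (N j) q = fps_nth (N (Suc j) * C) q"
    proof (cases "q = 0")
      case False
      have "fps_nth (N (Suc j) * C) q = (\<Sum>r=0..q. fps_nth (N (Suc j)) r * real (block_shapes m (q - r)))"
        by (simp add: fps_mult_nth C_def)
      also have "\<dots> = (\<Sum>r=1..q. fps_nth (N (Suc j)) r * real (block_shapes m (q - r)))"
        by (rule sum.mono_neutral_right) (auto simp: N_def)
      also have "\<dots> = real (\<Sum>r=1..q. tree_walk_shapes (block_word m (Suc j) (2 * m * r - Suc j)) * block_shapes m (q - r))"
        by (simp add: N_def)
      finally show ?thesis
        using tree_walk_shapes_block_level[OF that, of q] False by (simp add: N_def)
    qed (simp add: N_def)
  qed
  have N_m: "N m = fps_X * C"
  proof (rule fps_ext)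
    fix q
    show "fps_nth (N m) q = fps_nth (fps_X * C) q"
    proof (cases q)
      case (Suc r)
      then have "2 * m * q - m = m + 2 * m * r" by simp
      then show ?thesis using Suc tree_walk_shapes_block_period[of m m r] by (simp add: N_def C_def)
    qed (simp add: N_def)
  qed
  have "d \<le> m \<Longrightarrow> N (m - d) = fps_X * C ^ (d + 1)" for d
  proof (induction d)
    case 0
    then show ?case using N_m by simp
  next
    case (Suc d)
    then have "N (m - Suc d) = N (m - d) * C"
      using N_step[of "m - Suc d"] by (simp add: Suc_diff_Suc)
    then show ?case using Suc by (simp add: mult_ac)
  qed
  from this[of m] have "N 0 = fps_X * C ^ (m + 1)" by simp
  moreover have "C = 1 + N 0"
    by (rule fps_ext) (simp add: C_def N_def block_shapes_def block_word_def)
  ultimately have "C = 1 + fps_X * C ^ (m + 1)" by simp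
  from fuss_catalan_of_fps_equation[OF this, of q] show ?thesis by (simp add: C_def)
qed

text \<open>The trace word begins with the adjoint block and is therefore the window of phase
  \<open>m\<close>.\<close>

lemma block_word_conv_replicate:
  "block_word m m (m + 2 * m * p) = concat (replicate p (replicate m False @ replicate m True))"
proof (induction p)
  case (Suc p)
  have u: "block_word m m (m + 2 * m) = replicate m False @ replicate m True"
  proof -
    have "[m..<m + 2 * m] = [m..<m + m] @ [m + m..<m + m + m]"
      using upt_add_eq_append[of m "m + m" m] by (simp add: mult_2 add.assoc)
    moreover have "map (block_letter m) [m..<m + m] = replicate m False"
      by (auto simp: block_letter_def intro!: replicate_eqI)
    moreover have "block_letter m i" if "i \<in> set [m + m..<m + m + m]" for i
    proof -
      have "i mod (2 * m) = i - 2 * m" using that by (subst mod_if) (auto simp: mod_if)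
      then show ?thesis using that by (auto simp: block_letter_def)
    qed
    then have "map (block_letter m) [m + m..<m + m + m] = replicate m True"
      by (intro replicate_eqI) auto
    ultimately show ?thesis by (simp add: block_word_def)
  qed
  have "block_word m m (m + 2 * m * Suc p) = block_word m m (m + 2 * m) @ block_word m (m + 2 * m) (m + 2 * m + 2 * m * p)"
    using upt_add_eq_append[of m "m + 2 * m" "2 * m * p"] by (simp add: block_word_def add_ac)
  also have "block_word m (m + 2 * m) (m + 2 * m + 2 * m * p) = block_word m m (m + 2 * m * p)"
  proof -
    have "block_letter m (3 * m + i) = block_letter m (m + i)" for i
    proof -
      have "3 * m + i = (m + i) + 2 * m * 1" by simp
      then show ?thesis by (simp only: block_letter_add)
    qed
    then show ?thesis
      unfolding block_word_def by (intro nth_equalityI) auto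
  qed
  finally show ?case using Suc u by simp
qed (simp add: block_word_def)

lemma tree_walk_shapes_power_word:
  "m \<ge> 1 \<Longrightarrow> real (tree_walk_shapes (concat (replicate p (replicate m False @ replicate m True))))
    = 1 / real (m * p + 1) * real ((m * p + p) choose p)"
  unfolding block_word_conv_replicate[symmetric] tree_walk_shapes_block_period
  by (rule block_shapes_eq_fuss_catalan)

section \<open>The Fuss--Catalan distribution\<close>

text \<open>Bounded support will make the moments determine the law, and absence of atoms will make
  its distribution function continuous. Both pass to independent products and to scalings.\<close>

definition continuous_moment_law :: "real \<Rightarrow> (nat \<Rightarrow> real) \<Rightarrow> real measure \<Rightarrow> bool" where
  "continuous_moment_law R c N \<longleftrightarrow> real_distribution N \<and> (AE x in N. x \<in> {0..R}) \<and>
     (\<forall>x. emeasure N {x} = 0) \<and> (\<forall>k. (\<integral>x. x ^ k \<partial>N) = c k)"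

lemma (in real_distribution) integrable_power_of_AE_bounded:
  assumes "AE x in M. x \<in> {0..R}"
  shows "integrable M (\<lambda>x. x ^ k)"
proof (rule integrable_const_bound[where B = "R ^ k"])
  show "AE x in M. norm (x ^ k) \<le> R ^ k"
    using assms by eventually_elim (auto simp: power_abs intro: power_mono)
qed measurable

lemma Beta_add_of_nat:
  assumes "a > (0::real)" "b > 0"
  shows "Beta (a + real k) b = Beta a b * (pochhammer a k / pochhammer (a + b) k)"
proof -
  have "pochhammer a k = Gamma (a + real k) / Gamma a"
       "pochhammer (a + b) k = Gamma (a + b + real k) / Gamma (a + b)"
    using assms by (auto intro!: pochhammer_Gamma elim!: nonpos_Ints_cases)
  moreover have "Gamma a > 0" "Gamma (a + b) > 0" "Gamma (a + b + real k) > 0"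
    using assms by (auto intro!: Gamma_real_pos)
  ultimately show ?thesis by (simp add: Beta_def add_ac field_simps)
qed

text \<open>This is the Beta law with parameters \<open>a\<close> and \<open>b\<close>; its k-th
  moment is \<open>Beta (a + real k) b / Beta a b\<close>.\<close>

lemma beta_law_exists:
  assumes a: "a > (0::real)" and b: "b > 0"
  shows "\<exists>N. continuous_moment_law 1 (\<lambda>k. pochhammer a k / pochhammer (a + b) k) N"
proof -
  define f where "f t = indicator {0..1} t * (t powr (a - 1) * (1 - t) powr (b - 1)) / Beta a b" for t :: real
  have B: "Beta a b > 0" using a b by (auto simp: Beta_def intro!: divide_pos_pos mult_pos_pos Gamma_real_pos)
  have [measurable]: "f \<in> borel_measurable borel" unfolding f_def by measurable
  have f0: "f t \<ge> 0" for t using B by (auto simp: f_def)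
  have g0: "0 \<le> t ^ k * f t" for t k
  proof (cases "t \<in> {0..1}")
    case True
    then show ?thesis using f0[of t] by (intro mult_nonneg_nonneg zero_le_power) auto
  qed (simp add: f_def)
  have c0: "0 \<le> pochhammer a k / pochhammer (a + b) k" for k
    using a b by (intro divide_nonneg_nonneg less_imp_le[OF pochhammer_pos]) auto
  have mom: "(\<integral>\<^sup>+t. ennreal (t ^ k * f t) \<partial>lborel) = ennreal (pochhammer a k / pochhammer (a + b) k)" for k
  proof (rule nn_integral_has_integral_lborel)
    show "0 \<le> t ^ k * f t" for t by (rule g0)
    have eq: "t ^ k * (t powr (a - 1) * (1 - t) powr (b - 1)) = t powr (a + real k - 1) * (1 - t) powr (b - 1)"
      if "t \<in> {0..1} - {0}" for t
      using that by (simp add: powr_add[symmetric] powr_realpow[symmetric] algebra_simps)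
    have "((\<lambda>t. t powr (a + real k - 1) * (1 - t) powr (b - 1)) has_integral Beta (a + real k) b) {0..1}"
      using a b by (intro has_integral_Beta_real) auto
    then have "((\<lambda>t. t ^ k * (t powr (a - 1) * (1 - t) powr (b - 1))) has_integral Beta (a + real k) b) {0..1}"
      by (rule has_integral_spike[of "{0}", rotated 2]) (use eq in auto)
    then have "((\<lambda>t. t ^ k * (t powr (a - 1) * (1 - t) powr (b - 1)) / Beta a b) has_integral Beta (a + real k) b / Beta a b) {0..1}"
      by (rule has_integral_divide)
    then have "((\<lambda>t. if t \<in> {0..1} then t ^ k * (t powr (a - 1) * (1 - t) powr (b - 1)) / Beta a b else 0)
        has_integral Beta (a + real k) b / Beta a b) UNIV"
      by (rule iffD2[OF has_integral_restrict_UNIV])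
    also have "(\<lambda>t. if t \<in> {0..1} then t ^ k * (t powr (a - 1) * (1 - t) powr (b - 1)) / Beta a b else 0)
        = (\<lambda>t. t ^ k * f t)"
      by (auto simp: f_def indicator_def)
    finally show "((\<lambda>t. t ^ k * f t) has_integral pochhammer a k / pochhammer (a + b) k) UNIV"
      using B a b by (simp add: Beta_add_of_nat)
  qed measurable
  define N where "N = density lborel f"
  have N: "real_distribution N"
    unfolding N_def real_distribution_def real_distribution_axioms_def
    using mom[of 0] by (auto intro!: prob_spaceI simp: emeasure_density)
  have AE: "AE x in N. x \<in> {0..1}"
    unfolding N_def by (subst AE_density) (auto simp: f_def indicator_def)
  have null: "emeasure N {x} = 0" for x
  proof -
    have "AE t in lborel. ennreal (f t) * indicator {x} t = 0"
      using AE_lborel_singleton[of x] by eventually_elim auto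
    then show ?thesis by (simp add: N_def emeasure_density nn_integral_0_iff_AE)
  qed
  have "(\<integral>x. x ^ k \<partial>N) = pochhammer a k / pochhammer (a + b) k" for k
  proof -
    have "(\<integral>x. x ^ k \<partial>N) = (\<integral>x. f x * x ^ k \<partial>lborel)"
      unfolding N_def using f0 by (subst integral_density) auto
    also have "\<dots> = pochhammer a k / pochhammer (a + b) k"
      using mom[of k] g0 c0[of k] by (subst integral_eq_nn_integral) (auto simp: mult.commute)
    finally show ?thesis .
  qed
  then show ?thesis using N AE null unfolding continuous_moment_law_def by blast
qed

lemma continuous_moment_law_mult:
  assumes M: "continuous_moment_law 1 c M" and N: "continuous_moment_law 1 d N"
  shows "continuous_moment_law 1 (\<lambda>k. c k * d k) (distr (M \<Otimes>\<^sub>M N) borel (\<lambda>(x, y). x * y))"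
proof -
  interpret M: real_distribution M using M by (simp add: continuous_moment_law_def)
  interpret N: real_distribution N using N by (simp add: continuous_moment_law_def)
  interpret P: pair_prob_space M N ..
  let ?D = "distr (M \<Otimes>\<^sub>M N) borel (\<lambda>(x, y). x * y :: real)"
  have [measurable_cong]: "sets M = sets borel" "sets N = sets borel" by auto
  have aeM: "AE x in M. x \<in> {0..1}" and aeN: "AE x in N. x \<in> {0..1}"
    using M N by (auto simp: continuous_moment_law_def)
  have ae: "AE z in M \<Otimes>\<^sub>M N. fst z \<in> {0..1} \<and> snd z \<in> {0..1}"
  proof (rule P.AE_pair_measure)
    show "AE x in M. AE y in N. fst (x, y) \<in> {0..1} \<and> snd (x, y) \<in> {0..1}"
      using aeM
    proof eventually_elim
      case (elim x)
      show ?case using aeN by eventually_elim (use elim in simp)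
    qed
  qed measurable
  have D: "real_distribution ?D"
    by (intro P.real_distribution_distr) measurable
  have AE: "AE x in ?D. x \<in> {0..1}"
  proof (subst AE_distr_iff)
    show "AE z in M \<Otimes>\<^sub>M N. (case z of (x, y) \<Rightarrow> x * y) \<in> {0..1}"
      using ae by eventually_elim (auto intro: mult_le_one)
  qed measurable
  have null: "emeasure ?D {x} = 0" for x
  proof -
    \<comment> \<open>For nonzero u the fibre of the product over \<open>x\<close> is the single
      point x / u, a null set of \<open>N\<close>. The value u = 0, whose fibre may be the whole
      line, is excluded because \<open>M\<close> has no atom there.\<close>
    have "AE u in M. u \<noteq> 0"
      using M by (intro AE_I[of _ _ "{0}"]) (auto simp: continuous_moment_law_def)
    then have "AE u in M. emeasure N (Pair u -` ((\<lambda>(x, y). x * y) -` {x} \<inter> space (M \<Otimes>\<^sub>M N))) = 0"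
    proof eventually_elim
      case (elim u)
      have "emeasure N (Pair u -` ((\<lambda>(x, y). x * y) -` {x} \<inter> space (M \<Otimes>\<^sub>M N))) \<le> emeasure N {x / u}"
        using elim by (intro emeasure_mono) (auto simp: field_simps)
      then show ?case using N by (simp add: continuous_moment_law_def)
    qed
    then show ?thesis
      by (subst emeasure_distr, measurable, subst N.emeasure_pair_measure_alt, measurable)
        (simp add: nn_integral_0_iff_AE)
  qed
  have "(\<integral>x. x ^ k \<partial>?D) = c k * d k" for k
  proof -
    have "integrable (M \<Otimes>\<^sub>M N) (\<lambda>z. (fst z * snd z) ^ k)"
    proof (rule P.integrable_const_bound[where B = 1])
      show "AE z in M \<Otimes>\<^sub>M N. norm ((fst z * snd z) ^ k) \<le> 1"
        using ae by eventually_elim (auto intro!: power_le_one mult_le_one simp: abs_mult power_abs)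
    qed measurable
    then have int: "integrable (M \<Otimes>\<^sub>M N) (\<lambda>(x, y). (x * y) ^ k)" by (simp add: case_prod_unfold)
    have "(\<integral>x. x ^ k \<partial>?D) = (\<integral>z. (case z of (x, y) \<Rightarrow> (x * y) ^ k) \<partial>(M \<Otimes>\<^sub>M N))"
      by (subst integral_distr) (auto simp: case_prod_unfold)
    also have "\<dots> = (\<integral>x. (\<integral>y. (x * y) ^ k \<partial>N) \<partial>M)"
      using P.integral_fst'[OF int] by simp
    also have "\<dots> = c k * d k"
      using M N by (simp add: power_mult_distrib continuous_moment_law_def)
    finally show ?thesis .
  qed
  then show ?thesis using D AE null unfolding continuous_moment_law_def by blast
qed

lemma continuous_moment_law_scale:
  assumes M: "continuous_moment_law 1 c M" and K: "K > 0"
  shows "continuous_moment_law K (\<lambda>k. K ^ k * c k) (distr M borel (\<lambda>x. K * x))"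
proof -
  interpret M: real_distribution M using M by (simp add: continuous_moment_law_def)
  have "AE x in M. x \<in> {0..1}" using M by (simp add: continuous_moment_law_def)
  then have "AE x in distr M borel (\<lambda>x. K * x). x \<in> {0..K}"
    using K by (subst AE_distr_iff) (auto elim!: eventually_mono)
  moreover have "emeasure (distr M borel (\<lambda>x. K * x)) {x} = 0" for x
  proof -
    have "(\<lambda>x. K * x) -` {x} \<inter> space M = {x / K}" using K by (auto simp: field_simps)
    then show ?thesis using M by (simp add: emeasure_distr continuous_moment_law_def)
  qed
  moreover have "(\<integral>x. x ^ k \<partial>distr M borel (\<lambda>x. K * x)) = K ^ k * c k" for k
    using M by (subst integral_distr) (auto simp: power_mult_distrib continuous_moment_law_def)
  moreover have "real_distribution (distr M borel (\<lambda>x. K * x))"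
    by (intro M.real_distribution_distr) measurable
  ultimately show ?thesis unfolding continuous_moment_law_def by blast
qed

text \<open>\<open>b j\<close> is the sum of the two Beta parameters, so the second one is
  \<open>b j - a j\<close>.\<close>

lemma beta_product_law_exists:
  fixes a b :: "nat \<Rightarrow> real"
  assumes "\<And>j. j \<le> n \<Longrightarrow> 0 < a j \<and> a j < b j"
  shows "\<exists>N. continuous_moment_law 1 (\<lambda>k. \<Prod>j\<le>n. pochhammer (a j) k / pochhammer (b j) k) N"
  using assms
proof (induction n)
  case 0
  then show ?case using beta_law_exists[of "a 0" "b 0 - a 0"] by simp
next
  case (Suc n)
  from Suc.IH[OF Suc.prems] obtain N where
    "continuous_moment_law 1 (\<lambda>k. \<Prod>j\<le>n. pochhammer (a j) k / pochhammer (b j) k) N" by auto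
  moreover obtain N' where
    "continuous_moment_law 1 (\<lambda>k. pochhammer (a (Suc n)) k / pochhammer (b (Suc n)) k) N'"
    using beta_law_exists[of "a (Suc n)" "b (Suc n) - a (Suc n)"] Suc.prems[of "Suc n"] by auto
  ultimately show ?case using continuous_moment_law_mult by (simp only: prod.atMost_Suc) blast
qed

lemma fact_add: "fact (n + l) = fact n * (\<Prod>j<l. real (n + j + 1))"
  by (induction l) (auto simp: algebra_simps)

text \<open>Compare ratios of consecutive terms. The ratio of two Fuss--Catalan numbers is m + 1
  times the product over j < m of (m + 1) k + j + 1 divided by m k + j + 2. Taking m + 1 and m out
  of these factors leaves the Pochhammer ratios, whence the Beta parameters; the powers taken out,
  with the leading m + 1, form the constant (m + 1)^(m + 1) / m^m, which will bound the
  support.\<close>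

lemma fuss_catalan_beta_product:
  fixes m k :: nat
  assumes m: "m \<ge> 1"
  shows "(real (m + 1) ^ (m + 1) / real m ^ m) ^ k *
      (\<Prod>j<m. pochhammer (real (j + 1) / real (m + 1)) k / pochhammer (real (j + 2) / real m) k)
    = 1 / real (m * k + 1) * real ((m * k + k) choose k)"
proof -
  define FC where "FC k = fact ((m + 1) * k) / (fact k * fact (m * k + 1) :: real)" for k
  have "real ((m * k + k) choose k) = fact (m * k + k) / (fact k * fact (m * k))"
    by (subst binomial_fact) auto
  then have FC: "1 / real (m * k + 1) * real ((m * k + k) choose k) = FC k"
    by (simp add: FC_def add.commute)
  have "(real (m + 1) ^ (m + 1) / real m ^ m) ^ k *
      (\<Prod>j<m. pochhammer (real (j + 1) / real (m + 1)) k / pochhammer (real (j + 2) / real m) k) = FC k"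
  proof (induction k)
    case 0
    then show ?case by (simp add: FC_def)
  next
    case (Suc k)
    let ?p = "\<Prod>j<m. real ((m + 1) * k + j + 1)" and ?q = "\<Prod>j<m. real (m * k + 1 + j + 1)"
    have q: "?q > 0" by (intro prod_pos) (simp add: add_pos_nonneg)
    have "fact ((m + 1) * Suc k) = (fact ((m + 1) * k) * ?p * real ((m + 1) * (k + 1)) :: real)"
      using fact_add[of "(m + 1) * k" "Suc m"] by (simp add: algebra_simps)
    moreover have "fact (m * Suc k + 1) = (fact (m * k + 1) * ?q :: real)"
      using fact_add[of "m * k + 1" m] by (simp add: algebra_simps)
    ultimately have step: "FC (Suc k) = FC k * (real (m + 1) * ?p / ?q)"
      using q unfolding FC_def by (simp add: divide_simps del: of_nat_add of_nat_mult) (simp add: algebra_simps)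
    have "(\<Prod>j<m. (real (j + 1) / real (m + 1) + real k) / (real (j + 2) / real m + real k))
        = (\<Prod>j<m. (real m / real (m + 1)) * (real ((m + 1) * k + j + 1) / real (m * k + 1 + j + 1)))"
    proof (rule prod.cong[OF refl])
      fix j
      have 1: "real (j + 1) / real (m + 1) + real k = real ((m + 1) * k + j + 1) / real (m + 1)"
        by (simp add: field_simps)
      have 2: "real (j + 2) / real m + real k = real (m * k + 1 + j + 1) / real m"
        using m by (simp add: field_simps)
      show "(real (j + 1) / real (m + 1) + real k) / (real (j + 2) / real m + real k)
        = (real m / real (m + 1)) * (real ((m + 1) * k + j + 1) / real (m * k + 1 + j + 1))"
        unfolding 1 2 by simp
    qed
    also have "\<dots> = (real m / real (m + 1)) ^ m * (?p / ?q)"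
      by (simp add: prod.distrib prod_dividef power_divide)
    finally have ratio: "(real (m + 1) ^ (m + 1) / real m ^ m) *
        (\<Prod>j<m. (real (j + 1) / real (m + 1) + real k) / (real (j + 2) / real m + real k)) = real (m + 1) * ?p / ?q"
      using m by (simp add: power_divide)
    have "(\<Prod>j<m. pochhammer (real (j + 1) / real (m + 1)) (Suc k) / pochhammer (real (j + 2) / real m) (Suc k))
        = (\<Prod>j<m. pochhammer (real (j + 1) / real (m + 1)) k / pochhammer (real (j + 2) / real m) k) *
          (\<Prod>j<m. (real (j + 1) / real (m + 1) + real k) / (real (j + 2) / real m + real k))"
      unfolding prod.distrib[symmetric] by (simp add: pochhammer_Suc)
    then show ?case
      unfolding step Suc.IH[symmetric] ratio[symmetric] by (simp only: power_Suc mult_ac)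
  qed
  with FC show ?thesis by simp
qed

theorem fuss_catalan_law_exists:
  fixes m :: nat
  assumes "m \<ge> 1"
  shows "\<exists>N R. continuous_moment_law R (\<lambda>k. 1 / real (m * k + 1) * real ((m * k + k) choose k)) N"
proof -
  let ?a = "\<lambda>j. real (j + 1) / real (m + 1)" and ?b = "\<lambda>j. real (j + 2) / real m"
  have "0 < ?a j \<and> ?a j < ?b j" for j
    using assms by (auto simp: divide_simps) (simp add: algebra_simps)
  then obtain N where "continuous_moment_law 1 (\<lambda>k. \<Prod>j\<le>m-1. pochhammer (?a j) k / pochhammer (?b j) k) N"
    using beta_product_law_exists[of "m - 1" ?a ?b] by blast
  moreover have "{..m-1} = {..<m}" using assms by auto
  ultimately have "continuous_moment_law 1 (\<lambda>k. \<Prod>j<m. pochhammer (?a j) k / pochhammer (?b j) k) N" by simp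
  from continuous_moment_law_scale[OF this, of "real (m + 1) ^ (m + 1) / real m ^ m"] assms
  show ?thesis unfolding fuss_catalan_beta_product[OF assms] by auto
qed

section \<open>The method of moments\<close>

text \<open>A Taylor polynomial of a characteristic function involves only moments, and its error at
  order N is at most 2 |t|^N / N! times the N-th absolute moment. For the limit this moment is at
  most |R|^N, and for large n the N-th moment of \<open>M n\<close> is close to it, so the factorial
  wins.\<close>

lemma char_tendsto_of_moments:
  fixes M :: "nat \<Rightarrow> real measure" and M' :: "real measure"
  assumes M: "\<And>n. real_distribution (M n)" and int: "\<And>n k. integrable (M n) (\<lambda>x. x ^ k)"
    and M': "real_distribution M'" and bdd: "AE x in M'. x \<in> {0..R}"
    and mom: "\<And>k. (\<lambda>n. (\<integral>x. x ^ k \<partial>M n)) \<longlonglongrightarrow> (\<integral>x. x ^ k \<partial>M')"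
  shows "(\<lambda>n. char (M n) t) \<longlonglongrightarrow> char M' t"
proof (rule tendstoI)
  fix e :: real assume e: "e > 0"
  interpret M': real_distribution M' by fact
  have int': "integrable M' (\<lambda>x. x ^ k)" for k
  proof (rule M'.integrable_const_bound[where B = "\<bar>R\<bar> ^ k"])
    show "AE x in M'. norm (x ^ k) \<le> \<bar>R\<bar> ^ k"
      using bdd by eventually_elim (auto simp: power_abs intro: power_mono)
  qed measurable
  let ?c = "\<lambda>k. (\<i> * t) ^ k / fact k"
  \<comment> \<open>The 1 added to |R|^N is the slack with which the N-th moment of
    \<open>M n\<close>, known only to converge, is bounded for large n.\<close>
  let ?b = "\<lambda>N. 2 * \<bar>t\<bar> ^ N / fact N * (\<bar>R\<bar> ^ N + 1)"
  have exp0: "(\<lambda>N. x ^ N / fact N) \<longlonglongrightarrow> 0" for x :: real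
    using summable_LIMSEQ_zero[OF summable_exp[of x]] by (simp add: divide_inverse mult.commute)
  have "(\<lambda>N. 2 * ((\<bar>t\<bar> * \<bar>R\<bar>) ^ N / fact N) + 2 * (\<bar>t\<bar> ^ N / fact N)) \<longlonglongrightarrow> 2 * 0 + 2 * 0"
    by (intro tendsto_intros exp0)
  moreover have "?b N = 2 * ((\<bar>t\<bar> * \<bar>R\<bar>) ^ N / fact N) + 2 * (\<bar>t\<bar> ^ N / fact N)" for N
    by (simp add: algebra_simps power_mult_distrib add_divide_distrib)
  ultimately have "?b \<longlonglongrightarrow> 0" by simp
  then have "eventually (\<lambda>N. ?b N < e / 3) sequentially"
    using e by (intro order_tendstoD) auto
  then obtain N0 where N0: "\<And>N. N \<ge> N0 \<Longrightarrow> ?b N < e / 3"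
    by (auto simp: eventually_sequentially)
  \<comment> \<open>An even N makes the absolute moment in the error term an ordinary
    moment.\<close>
  define N where "N = 2 * N0"
  have bN: "?b N < e / 3" and even: "even N" using N0[of N] by (auto simp: N_def)
  have abs_eq: "\<bar>x\<bar> ^ N = x ^ N" for x :: real using even by (simp add: power_even_abs)
  have momR: "(\<integral>x. x ^ N \<partial>M') \<le> \<bar>R\<bar> ^ N"
  proof -
    have "(\<integral>x. x ^ N \<partial>M') \<le> (\<integral>x. \<bar>R\<bar> ^ N \<partial>M')"
    proof (rule integral_mono_AE)
      show "AE x in M'. x ^ N \<le> \<bar>R\<bar> ^ N"
        using bdd by eventually_elim (auto intro: power_mono)
    qed (use int' in auto)
    then show ?thesis using M'.prob_space by simp
  qed
  have approx: "cmod (char L t - (\<Sum>k\<le>N. ?c k * of_real (\<integral>x. x ^ k \<partial>L))) < e / 3"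
    if "real_distribution L" "\<And>k. integrable L (\<lambda>x. x ^ k)" "(\<integral>x. x ^ N \<partial>L) \<le> \<bar>R\<bar> ^ N + 1" for L
  proof -
    have "cmod (char L t - (\<Sum>k\<le>N. ?c k * of_real (\<integral>x. x ^ k \<partial>L))) \<le> (2*\<bar>t\<bar>^N / fact N) * (\<integral>x. \<bar>x\<bar>^N \<partial>L)"
      using real_distribution.char_approx1[OF that(1), of N t] that(2) by simp
    also have "\<dots> \<le> ?b N"
      using that(3)
      by (intro mult_left_mono divide_nonneg_nonneg mult_nonneg_nonneg zero_le_power) (auto simp: abs_eq)
    finally show ?thesis using bN by simp
  qed
  have "(\<lambda>n. \<Sum>k\<le>N. ?c k * of_real (\<integral>x. x ^ k \<partial>M n)) \<longlonglongrightarrow> (\<Sum>k\<le>N. ?c k * of_real (\<integral>x. x ^ k \<partial>M'))"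
    by (intro tendsto_intros mom)
  then have "eventually (\<lambda>n. dist (\<Sum>k\<le>N. ?c k * of_real (\<integral>x. x ^ k \<partial>M n)) (\<Sum>k\<le>N. ?c k * of_real (\<integral>x. x ^ k \<partial>M')) < e / 3) sequentially"
    using e by (intro tendstoD) auto
  moreover have "eventually (\<lambda>n. (\<integral>x. x ^ N \<partial>M n) < \<bar>R\<bar> ^ N + 1) sequentially"
    using momR by (intro order_tendstoD(2)[OF mom[of N]]) auto
  ultimately show "eventually (\<lambda>n. dist (char (M n) t) (char M' t) < e) sequentially"
  proof eventually_elim
    case (elim n)
    let ?S = "\<lambda>L. \<Sum>k\<le>N. ?c k * complex_of_real (\<integral>x. x ^ k \<partial>L)"
    have "dist (char (M n) t) (?S (M n)) < e / 3"
      using approx[of "M n"] M int elim by (simp add: dist_norm)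
    moreover have "dist (char M' t) (?S M') < e / 3"
      using approx[of M'] M' int' momR by (simp add: dist_norm)
    ultimately show ?case
      using elim(1) dist_triangle[of "char (M n) t" "char M' t" "?S (M n)"]
        dist_triangle[of "?S (M n)" "char M' t" "?S M'"] by (simp add: dist_commute)
  qed
qed

text \<open>The convergence of characteristic functions, applied to a constant sequence, turns into
  equality.\<close>

lemma real_distribution_eq_of_moments:
  assumes "real_distribution M" "\<And>k. integrable M (\<lambda>x. x ^ k)"
    and "real_distribution M'" "AE x in M'. x \<in> {0..R}"
    and "\<And>k::nat. (\<integral>x. x ^ k \<partial>M) = (\<integral>x. x ^ k \<partial>M')"
  shows "M = M'"
proof (rule Levy_uniqueness)
  have "(\<lambda>n::nat. char M t) \<longlonglongrightarrow> char M' t" for t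
    using char_tendsto_of_moments[of "\<lambda>_. M" M' R t] assms by simp
  then show "char M = char M'" by (auto simp: LIMSEQ_const_iff)
qed fact+

lemma cdf_interpolation_points:
  assumes M: "real_distribution M" and cont: "\<And>x. isCont (cdf M) x" and y: "0 < y" "y < 1"
  shows "\<exists>x. cdf M x = y"
proof -
  interpret real_distribution M by fact
  obtain a where a: "cdf M a < y"
    using order_tendstoD(2)[OF cdf_lim_at_bot y(1)] by (auto simp: eventually_at_bot_linorder)
  obtain b where b: "cdf M b > y"
    using order_tendstoD(1)[OF cdf_lim_at_top_prob y(2)] by (auto simp: eventually_at_top_linorder)
  have "a \<le> b" using a b cdf_nondecreasing[of b a] by (cases "a \<le> b") auto
  then show ?thesis using IVT[of "cdf M" a y b] a b cont by force
qed

text \<open>As in Polya's theorem, the values at finitely many quantiles of the limit control the whole function.\<close>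

lemma cdf_tendsto_uniformly:
  fixes F :: "nat \<Rightarrow> real \<Rightarrow> real"
  assumes M: "real_distribution M" and cont: "\<And>x. isCont (cdf M) x"
    and F: "\<And>n. mono (F n)" "\<And>n x. F n x \<in> {0..1}"
    and lim: "\<And>x. (\<lambda>n. F n x) \<longlonglongrightarrow> cdf M x"
  shows "(\<lambda>n. SUP x. \<bar>F n x - cdf M x\<bar>) \<longlonglongrightarrow> 0"
proof (rule tendstoI)
  fix e :: real assume e: "e > 0"
  interpret real_distribution M by fact
  let ?G = "cdf M"
  have G01: "0 \<le> ?G x" "?G x \<le> 1" for x by (auto simp: cdf_nonneg cdf_bounded_prob)
  obtain N :: nat where N: "N > 0" "3 / real N < e"
    using reals_Archimedean2[of "3 / e"] e by (metis divide_less_eq gr0I mult.commute not_less_iff_gr_or_eq of_nat_0 divide_pos_pos zero_less_numeral of_nat_0_less_iff less_trans pos_divide_less_eq)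
  have "\<exists>q. \<forall>i\<in>{1..<N}. ?G (q i) = real i / real N"
  proof (intro bchoice ballI)
    fix i assume "i \<in> {1..<N}"
    then show "\<exists>x. ?G x = real i / real N"
      by (intro cdf_interpolation_points[OF M cont]) (auto simp: divide_simps)
  qed
  then obtain q where q: "\<And>i. i \<in> {1..<N} \<Longrightarrow> ?G (q i) = real i / real N" by blast
  have "eventually (\<lambda>n. \<forall>i\<in>{1..<N}. dist (F n (q i)) (?G (q i)) < 1 / real N) sequentially"
    using N by (intro eventually_ball_finite ballI tendstoD lim) auto
  then show "eventually (\<lambda>n. dist (SUP x. \<bar>F n x - ?G x\<bar>) 0 < e) sequentially"
  proof eventually_elim
    case (elim n)
    have F01: "0 \<le> F n x" "F n x \<le> 1" for x using F(2)[of n x] by auto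
    have bound: "\<bar>F n x - ?G x\<bar> \<le> 3 / real N" for x
    proof -
      \<comment> \<open>The quantiles i - 1 and i + 2 have values of \<open>?G\<close> strictly
        below and above \<open>?G x\<close>; strictness is what places them on either side of
        \<open>x\<close> although \<open>?G\<close> may have flat stretches. At most two grid steps
        and the error 1 / N at the quantile make 3 / N. Near the ends, where the quantile is
        missing, the range \<open>{0..1}\<close> of \<open>F n\<close> is enough.\<close>
      define i where "i = nat \<lfloor>real N * ?G x\<rfloor>"
      have i: "real i \<le> real N * ?G x" "real N * ?G x < real i + 1"
        using G01[of x] by (simp_all add: i_def)
      have near: "F n (q j) \<le> (real j + 1) / real N" "F n (q j) \<ge> (real j - 1) / real N" if "j \<in> {1..<N}" for j
        using elim that q[OF that] by (auto simp: dist_real_def abs_less_iff add_divide_distrib diff_divide_distrib dest!: bspec)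
      have lower: "F n x \<ge> ?G x - 3 / real N"
      proof (cases "i \<ge> 2 \<and> i - 1 < N")
        case True
        then have j: "i - 1 \<in> {1..<N}" by auto
        have "?G (q (i - 1)) < ?G x"
          unfolding q[OF j] using i True N by (simp add: divide_simps of_nat_diff mult.commute)
        then have "q (i - 1) \<le> x" using cdf_nondecreasing[of x "q (i - 1)"] by linarith
        then have "F n (q (i - 1)) \<le> F n x" using F(1) by (auto dest: monoD)
        moreover have "(real N * ?G x - 3) / real N \<le> (real (i - 1) - 1) / real N"
          using i True by (intro divide_right_mono) (auto simp: of_nat_diff)
        then have "?G x - 3 / real N \<le> (real (i - 1) - 1) / real N"
          using N by (simp add: diff_divide_distrib)
        ultimately show ?thesis using near(2)[OF j] by linarith
      next
        case False
        have "real i \<le> real N" using i(1) G01(2)[of x] N by (meson mult_left_le of_nat_0_le_iff order_trans)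
        then have "i < 2" using False N by auto
        then have "real N * ?G x < 3" using i(2) by linarith
        then have "?G x \<le> 3 / real N" using N by (simp add: field_simps)
        then show ?thesis using F01(1)[of x] by linarith
      qed
      have upper: "F n x \<le> ?G x + 3 / real N"
      proof (cases "i + 2 < N")
        case True
        then have j: "i + 2 \<in> {1..<N}" by auto
        have "?G x < ?G (q (i + 2))"
          unfolding q[OF j] using i N by (simp add: divide_simps mult.commute)
        then have "x \<le> q (i + 2)" using cdf_nondecreasing[of "q (i + 2)" x] by linarith
        then have "F n x \<le> F n (q (i + 2))" using F(1) by (auto dest: monoD)
        moreover have "(real (i + 2) + 1) / real N \<le> (real N * ?G x + 3) / real N"
          using i by (intro divide_right_mono) auto
        then have "(real (i + 2) + 1) / real N \<le> ?G x + 3 / real N"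
          using N by (simp add: add_divide_distrib)
        ultimately show ?thesis using near(1)[OF j] by linarith
      next
        case False
        then have "real N \<le> real i + 3" by linarith
        then have "1 \<le> ?G x + 3 / real N" using i(1) N by (simp add: field_simps)
        then show ?thesis using F01(2)[of x] by linarith
      qed
      show ?thesis using lower upper by (auto simp: abs_le_iff)
    qed
    have "(SUP x. \<bar>F n x - ?G x\<bar>) \<le> 3 / real N"
      by (rule cSUP_least) (auto intro: bound)
    moreover have "\<bar>F n 0 - ?G 0\<bar> \<le> (SUP x. \<bar>F n x - ?G x\<bar>)"
      by (rule cSUP_upper) (auto intro!: bdd_aboveI2 bound)
    then have "0 \<le> (SUP x. \<bar>F n x - ?G x\<bar>)" by linarith
    ultimately show ?case using N(2) by simp
  qed
qed

section \<open>Singular values and traces\<close>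

definition mat_trace :: "'a :: comm_monoid_add mat \<Rightarrow> 'a" where
  "mat_trace A = (\<Sum>i<dim_row A. A $$ (i, i))"

lemma index_mult_mat_sum:
  assumes "A \<in> carrier_mat n k" "B \<in> carrier_mat k m" "i < n" "j < m"
  shows "(A * B) $$ (i, j) = (\<Sum>l<k. A $$ (i, l) * B $$ (l, j))"
  using assms by (auto simp: scalar_prod_def lessThan_atLeast0 intro!: sum.cong)

lemma index_mult_mat_vec_sum:
  assumes "A \<in> carrier_mat n k" "v \<in> carrier_vec k" "i < n"
  shows "vec_index (A *\<^sub>v v) i = (\<Sum>l<k. A $$ (i, l) * vec_index v l)"
  using assms by (auto simp: scalar_prod_def lessThan_atLeast0 intro!: sum.cong)

lemma mat_trace_mult_comm:
  fixes A B :: "'a :: comm_ring_1 mat"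
  assumes A: "A \<in> carrier_mat n k" and B: "B \<in> carrier_mat k n"
  shows "mat_trace (A * B) = mat_trace (B * A)"
proof -
  have "mat_trace (A * B) = (\<Sum>i<n. \<Sum>l<k. A $$ (i, l) * B $$ (l, i))"
    using A by (auto simp: mat_trace_def index_mult_mat_sum[OF A B] simp del: index_mult_mat(1) intro!: sum.cong)
  also have "\<dots> = (\<Sum>l<k. \<Sum>i<n. B $$ (l, i) * A $$ (i, l))"
    by (subst sum.swap) (simp add: mult.commute)
  also have "\<dots> = mat_trace (B * A)"
    using B by (auto simp: mat_trace_def index_mult_mat_sum[OF B A] simp del: index_mult_mat(1) intro!: sum.cong)
  finally show ?thesis .
qed

lemma upper_triangular_pow:
  fixes B :: "'a :: comm_ring_1 mat"
  assumes B: "B \<in> carrier_mat n n" and ut: "upper_triangular B"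
  shows "upper_triangular (B ^\<^sub>m k) \<and> (\<forall>i<n. (B ^\<^sub>m k) $$ (i, i) = (B $$ (i, i)) ^ k)"
proof (induction k)
  case 0
  then show ?case using B by auto
next
  case (Suc k)
  have Bk: "B ^\<^sub>m k \<in> carrier_mat n n" using B by auto
  have z1: "B $$ (l, j) = 0" if "j < l" "l < n" for l j
    using upper_triangularD[OF ut, of j l] that B by auto
  have z2: "(B ^\<^sub>m k) $$ (l, j) = 0" if "j < l" "l < n" for l j
    using upper_triangularD[of "B ^\<^sub>m k" j l] Suc that Bk by auto
  have e: "(B ^\<^sub>m Suc k) $$ (i, j) = (\<Sum>l<n. (B ^\<^sub>m k) $$ (i, l) * B $$ (l, j))" if "i < n" "j < n" for i j
    unfolding pow_mat.simps by (rule index_mult_mat_sum[OF Bk B that])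
  have "(B ^\<^sub>m Suc k) $$ (i, j) = 0" if "j < i" "i < n" for i j
  proof -
    have "(B ^\<^sub>m k) $$ (i, l) * B $$ (l, j) = 0" if "l < n" for l
      using z1[of j l] z2[of l i] \<open>j < i\<close> \<open>i < n\<close> that by (cases "l < i") auto
    then show ?thesis using e[of i j] that by (auto intro!: sum.neutral)
  qed
  moreover have "(B ^\<^sub>m Suc k) $$ (i, i) = (B $$ (i, i)) ^ Suc k" if "i < n" for i
  proof -
    have "(B ^\<^sub>m Suc k) $$ (i, i) = (\<Sum>l\<in>{i}. (B ^\<^sub>m k) $$ (i, l) * B $$ (l, i))"
      unfolding e[OF that that]
    proof (rule sum.mono_neutral_right)
      show "\<forall>l\<in>{..<n} - {i}. (B ^\<^sub>m k) $$ (i, l) * B $$ (l, i) = 0"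
      proof
        fix l assume "l \<in> {..<n} - {i}"
        then show "(B ^\<^sub>m k) $$ (i, l) * B $$ (l, i) = 0"
          using z1[of i l] z2[of l i] that by (cases "l < i") auto
      qed
    qed (use that in auto)
    then show ?thesis using Suc that by (simp add: mult.commute)
  qed
  ultimately show ?case using B by (auto intro!: upper_triangularI simp del: pow_mat.simps)
qed

text \<open>Schur triangulation: the trace is invariant under similarity, and the powers of a
  triangular matrix carry the powers of the eigenvalues on the diagonal.\<close>

lemma mat_trace_pow_eq_sum_proots:
  fixes A :: "complex mat"
  assumes A: "A \<in> carrier_mat n n"
  shows "mat_trace (A ^\<^sub>m k) = (\<Sum>z\<in>#proots (char_poly A). z ^ k)"
proof -
  obtain es where es: "char_poly A = (\<Prod>e\<leftarrow>es. [:- e, 1:])"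
    using char_poly_factorized[OF A] by auto
  obtain B P Q where BPQ: "schur_decomposition A es = (B, P, Q)" by (cases "schur_decomposition A es")
  have wit: "similar_mat_wit A B P Q" and ut: "upper_triangular B" and diag: "diag_mat B = es"
    using schur_decomposition[OF A es BPQ] by auto
  have c: "B \<in> carrier_mat n n" "P \<in> carrier_mat n n" "Q \<in> carrier_mat n n" "Q * P = 1\<^sub>m n"
    using wit A unfolding similar_mat_wit_def by (auto simp: Let_def)
  have Bk: "B ^\<^sub>m k \<in> carrier_mat n n" using c by auto
  have "proots (\<Prod>e\<leftarrow>es. [:- e, 1:]) = mset es"
  proof (induction es)
    case (Cons e es)
    have "(\<Prod>e\<leftarrow>es. [:- e, 1:]) \<noteq> 0" by (auto simp: prod_list_zero_iff)
    then show ?case using Cons by (simp add: proots_mult del: mult_pCons_left)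
  qed simp
  then have roots: "proots (char_poly A) = mset es" using es by simp
  have "mat_trace (A ^\<^sub>m k) = mat_trace (P * B ^\<^sub>m k * Q)"
    using similar_mat_wit_pow_id[OF wit] by simp
  also have "\<dots> = mat_trace (Q * (P * B ^\<^sub>m k))"
    using c Bk by (intro mat_trace_mult_comm) auto
  also have "Q * (P * B ^\<^sub>m k) = B ^\<^sub>m k"
    by (simp add: assoc_mult_mat[OF c(3,2) Bk, symmetric] c(4) left_mult_one_mat[OF Bk])
  also have "mat_trace (B ^\<^sub>m k) = (\<Sum>i<n. (B $$ (i, i)) ^ k)"
    using upper_triangular_pow[OF c(1) ut, of k] Bk by (auto simp: mat_trace_def intro!: sum.cong)
  also have "\<dots> = (\<Sum>z\<leftarrow>es. z ^ k)"
    unfolding diag[symmetric] diag_mat_def using c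
    by (simp add: sum_list_sum_nth lessThan_atLeast0 comp_def)
  also have "\<dots> = (\<Sum>z\<in>#proots (char_poly A). z ^ k)"
    unfolding roots by (simp add: sum_mset_sum_list[symmetric] flip: mset_map)
  finally show ?thesis .
qed

section \<open>The spectrum of the adjoint of a matrix times the matrix\<close>

lemma mat_adjoint_carrier: "A \<in> carrier_mat n n \<Longrightarrow> mat_adjoint A \<in> carrier_mat n n"
  unfolding mat_adjoint_def by auto

lemma index_mat_adjoint:
  fixes A :: "complex mat"
  assumes "A \<in> carrier_mat n n" "i < n" "j < n"
  shows "mat_adjoint A $$ (i, j) = cnj (A $$ (j, i))"
  using assms unfolding mat_adjoint_def by (auto simp: mat_of_rows_index)

text \<open>Pairing the eigenvalue equation with an eigenvector v gives z |v|^2 = |A v|^2;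
  \<open>sv\<close> and \<open>sw\<close> are these squared norms.\<close>

lemma proots_adjoint_mult_nonneg:
  fixes A :: "complex mat"
  assumes A: "A \<in> carrier_mat n n" and z: "z \<in># proots (char_poly (mat_adjoint A * A))"
  shows "Re z \<ge> 0" "z = of_real (Re z)"
proof -
  let ?B = "mat_adjoint A * A"
  have A': "mat_adjoint A \<in> carrier_mat n n" by (rule mat_adjoint_carrier[OF A])
  then have B: "?B \<in> carrier_mat n n" using A by auto
  have "char_poly ?B \<noteq> 0" using degree_monic_char_poly[OF B] by auto
  then have "poly (char_poly ?B) z = 0" using z by simp
  then have "eigenvalue ?B z" using eigenvalue_root_char_poly[OF B] by simp
  then obtain v where "eigenvector ?B v z" by (auto simp: eigenvalue_def)
  then have v: "v \<in> carrier_vec n" "v \<noteq> 0\<^sub>v n" "?B *\<^sub>v v = z \<cdot>\<^sub>v v"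
    using B by (auto simp: eigenvector_def)
  define w where "w = A *\<^sub>v v"
  have w: "w \<in> carrier_vec n" using A v by (simp add: w_def)
  have "z \<cdot>\<^sub>v v = mat_adjoint A *\<^sub>v w"
    using v(3) assoc_mult_mat_vec[OF A' A v(1)] by (simp add: w_def)
  then have zv: "z * vec_index v i = (\<Sum>k<n. cnj (A $$ (k, i)) * vec_index w k)" if "i < n" for i
    using that v(1) w index_mult_mat_vec_sum[OF A' w that] index_mat_adjoint[OF A that]
    by (metis (no_types, lifting) carrier_vecD index_smult_vec(1) lessThan_iff sum.cong)
  have wk: "vec_index w k = (\<Sum>i<n. A $$ (k, i) * vec_index v i)" if "k < n" for k
    unfolding w_def by (rule index_mult_mat_vec_sum[OF A v(1) that])
  define sv where "sv = (\<Sum>i<n. (cmod (vec_index v i))\<^sup>2)"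
  define sw where "sw = (\<Sum>i<n. (cmod (vec_index w i))\<^sup>2)"
  have nsq: "(complex_of_real (cmod a))\<^sup>2 = a * cnj a" for a
    using complex_norm_square[of a] by simp
  have "z * of_real sv = (\<Sum>i<n. cnj (vec_index v i) * (z * vec_index v i))"
    by (simp add: sv_def sum_distrib_left nsq mult_ac)
  also have "\<dots> = (\<Sum>i<n. \<Sum>k<n. cnj (vec_index v i) * (cnj (A $$ (k, i)) * vec_index w k))"
    by (simp add: zv sum_distrib_left)
  also have "\<dots> = (\<Sum>k<n. cnj (\<Sum>i<n. A $$ (k, i) * vec_index v i) * vec_index w k)"
    by (subst sum.swap) (simp add: sum_distrib_left sum_distrib_right mult_ac)
  also have "\<dots> = (\<Sum>k<n. cnj (vec_index w k) * vec_index w k)"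
    by (rule sum.cong) (simp_all only: wk lessThan_iff)
  also have "\<dots> = of_real sw"
    by (simp add: sw_def nsq mult.commute)
  finally have eq: "z * of_real sv = of_real sw" .
  obtain i where i: "i < n" "vec_index v i \<noteq> 0"
    using v(1,2) by (metis carrier_vecD dim_vec eq_vecI index_zero_vec(1,2))
  have "sv > 0" unfolding sv_def using i by (intro sum_pos2[of _ i]) auto
  moreover have "sw \<ge> 0" unfolding sw_def by (intro sum_nonneg) auto
  ultimately have "z = of_real (sw / sv)" "sw / sv \<ge> 0"
    using eq by (auto simp: field_simps)
  then show "Re z \<ge> 0" "z = of_real (Re z)" by auto
qed

lemma singular_values_props:
  fixes A :: "complex mat"
  assumes A: "A \<in> carrier_mat n n"
  shows "length (singular_values A) = n"
    and "\<And>i j. i \<le> j \<Longrightarrow> j < n \<Longrightarrow> singular_values A ! j \<le> singular_values A ! i"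
    and "\<And>i. i < n \<Longrightarrow> singular_values A ! i \<ge> 0"
    and "\<And>p. (\<Sum>i<n. ((singular_values A ! i)\<^sup>2) ^ p) = Re (mat_trace ((mat_adjoint A * A) ^\<^sub>m p))"
proof -
  let ?B = "mat_adjoint A * A"
  let ?R = "proots (char_poly ?B)"
  have B: "?B \<in> carrier_mat n n" using A mat_adjoint_carrier[OF A] by auto
  have mset: "mset (singular_values A) = image_mset (\<lambda>z. sqrt (Re z)) ?R"
    by (simp add: singular_values_def)
  have sorted: "sorted (rev (singular_values A))"
    by (simp add: singular_values_def)
  have "size (mset (singular_values A)) = degree (char_poly ?B)"
    unfolding mset by (simp add: size_proots_complex)
  then show len: "length (singular_values A) = n"
    using degree_monic_char_poly[OF B] by simp
  show "singular_values A ! j \<le> singular_values A ! i" if "i \<le> j" "j < n" for i j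
    using sorted_rev_nth_mono[OF sorted] that len by auto
  have nonneg: "x \<ge> 0" if "x \<in> set (singular_values A)" for x
  proof -
    have "x \<in># image_mset (\<lambda>z. sqrt (Re z)) ?R" using that unfolding mset[symmetric] by simp
    then show ?thesis using proots_adjoint_mult_nonneg(1)[OF A] by auto
  qed
  show "singular_values A ! i \<ge> 0" if "i < n" for i
    using nonneg that len by auto
  fix p
  have "(\<Sum>i<n. ((singular_values A ! i)\<^sup>2) ^ p) = (\<Sum>x\<leftarrow>singular_values A. (x\<^sup>2) ^ p)"
    by (simp add: sum_list_sum_nth lessThan_atLeast0 len)
  also have "\<dots> = (\<Sum>x\<in>#mset (singular_values A). (x\<^sup>2) ^ p)"
    by (metis mset_map sum_mset_sum_list)
  also have "\<dots> = (\<Sum>z\<in>#?R. Re (z ^ p))"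
  proof -
    have "(sqrt (Re z))\<^sup>2 ^ p = Re (z ^ p)" if "z \<in># ?R" for z
      using proots_adjoint_mult_nonneg[OF A that]
      by (metis Re_complex_of_real of_real_power real_sqrt_pow2)
    then show ?thesis unfolding mset by (simp add: multiset.map_comp comp_def cong: image_mset_cong)
  qed
  also have "\<dots> = Re (\<Sum>z\<in>#?R. z ^ p)"
  proof -
    have "(\<Sum>z\<in>#R. Re (z ^ p)) = Re (\<Sum>z\<in>#R. z ^ p)" for R :: "complex multiset"
      by (induction R) auto
    then show ?thesis .
  qed
  also have "\<dots> = Re (mat_trace (?B ^\<^sub>m p))"
    by (simp add: mat_trace_pow_eq_sum_proots[OF B])
  finally show "(\<Sum>i<n. ((singular_values A ! i)\<^sup>2) ^ p) = Re (mat_trace (?B ^\<^sub>m p))" .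
qed

text \<open>The p-norms of the entries from \<open>k\<close> on tend to the maximum norm, which is
  \<open>l k\<close>. This writes an ordered value as a limit of functions of power sums, for the
  sake of measurability.\<close>

lemma root_power_sum_tendsto_max:
  fixes l :: "nat \<Rightarrow> real"
  assumes k: "k < n" and nn: "\<And>i. i < n \<Longrightarrow> l i \<ge> 0" and dec: "\<And>i. k \<le> i \<Longrightarrow> i < n \<Longrightarrow> l i \<le> l k"
  shows "(\<lambda>p. root p (\<Sum>i=k..<n. l i ^ p)) \<longlonglongrightarrow> l k"
proof (rule tendsto_sandwich)
  show "\<forall>\<^sub>F p in sequentially. l k \<le> root p (\<Sum>i=k..<n. l i ^ p)"
    using eventually_gt_at_top[of 0]
  proof eventually_elim
    case (elim p)
    have "l k ^ p \<le> (\<Sum>i=k..<n. l i ^ p)"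
      using k nn by (intro member_le_sum) auto
    then have "root p (l k ^ p) \<le> root p (\<Sum>i=k..<n. l i ^ p)"
      using elim by (intro real_root_le_mono) auto
    then show ?case using elim nn k by (simp add: real_root_power_cancel)
  qed
  show "\<forall>\<^sub>F p in sequentially. root p (\<Sum>i=k..<n. l i ^ p) \<le> root p (real n) * l k"
    using eventually_gt_at_top[of 0]
  proof eventually_elim
    case (elim p)
    have "(\<Sum>i=k..<n. l i ^ p) \<le> (\<Sum>i=k..<n. l k ^ p)"
      using nn dec by (intro sum_mono power_mono) auto
    also have "\<dots> \<le> real n * l k ^ p"
      using nn[OF k] k by (simp add: mult_right_mono)
    finally have "root p (\<Sum>i=k..<n. l i ^ p) \<le> root p (real n * l k ^ p)"
      using elim by (intro real_root_le_mono) auto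
    then show ?case using elim nn k by (simp add: real_root_mult real_root_power_cancel)
  qed
  have "(\<lambda>p. root p (real n) * l k) \<longlonglongrightarrow> 1 * l k"
    using k by (intro tendsto_intros LIMSEQ_root_const) auto
  then show "(\<lambda>p. root p (real n) * l k) \<longlonglongrightarrow> l k" by simp
qed simp

section \<open>Measurability of the singular values\<close>

definition measurable_entries :: "'a measure \<Rightarrow> nat \<Rightarrow> ('a \<Rightarrow> complex mat) \<Rightarrow> bool" where
  "measurable_entries M n f \<longleftrightarrow> (\<forall>\<omega>. f \<omega> \<in> carrier_mat n n) \<and>
     (\<forall>i<n. \<forall>j<n. (\<lambda>\<omega>. f \<omega> $$ (i, j)) \<in> borel_measurable M)"

lemma measurable_entries_mult:
  assumes "measurable_entries M n f" "measurable_entries M n g"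
  shows "measurable_entries M n (\<lambda>\<omega>. f \<omega> * g \<omega>)"
proof -
  have c: "f \<omega> \<in> carrier_mat n n" "g \<omega> \<in> carrier_mat n n" for \<omega>
    using assms by (auto simp: measurable_entries_def)
  have "(\<lambda>\<omega>. (f \<omega> * g \<omega>) $$ (i, j)) \<in> borel_measurable M" if "i < n" "j < n" for i j
    unfolding index_mult_mat_sum[OF c that]
    using assms that by (intro borel_measurable_sum borel_measurable_times) (auto simp: measurable_entries_def)
  then show ?thesis using c mult_carrier_mat[OF c] unfolding measurable_entries_def by blast
qed

lemma borel_measurable_cnj:
  "f \<in> borel_measurable M \<Longrightarrow> (\<lambda>x. cnj (f x)) \<in> borel_measurable M"
  by (rule measurable_compose[OF _ borel_measurable_continuous_onI]) (auto intro!: continuous_intros)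

lemma measurable_entries_adjoint:
  assumes "measurable_entries M n f"
  shows "measurable_entries M n (\<lambda>\<omega>. mat_adjoint (f \<omega>))"
proof -
  have c: "f \<omega> \<in> carrier_mat n n" for \<omega>
    using assms by (auto simp: measurable_entries_def)
  have "(\<lambda>\<omega>. mat_adjoint (f \<omega>) $$ (i, j)) \<in> borel_measurable M" if "i < n" "j < n" for i j
    unfolding index_mat_adjoint[OF c that]
    using assms that by (auto simp: measurable_entries_def intro: borel_measurable_cnj)
  then show ?thesis using mat_adjoint_carrier[OF c] unfolding measurable_entries_def by blast
qed

lemma measurable_entries_pow:
  assumes "measurable_entries M n f"
  shows "measurable_entries M n (\<lambda>\<omega>. f \<omega> ^\<^sub>m k)"
proof (induction k)
  case 0
  have "dim_row (f \<omega>) = n" for \<omega> using assms by (auto simp: measurable_entries_def)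
  then show ?case by (auto simp: measurable_entries_def)
next
  case (Suc k)
  show ?case unfolding pow_mat.simps by (rule measurable_entries_mult[OF Suc assms])
qed

lemma measurable_entries_smult:
  assumes "measurable_entries M n f"
  shows "measurable_entries M n (\<lambda>\<omega>. c \<cdot>\<^sub>m f \<omega>)"
  unfolding measurable_entries_def
proof (intro conjI allI impI)
  have c: "f \<omega> \<in> carrier_mat n n" for \<omega> using assms by (auto simp: measurable_entries_def)
  then show "c \<cdot>\<^sub>m f \<omega> \<in> carrier_mat n n" for \<omega> by auto
  fix i j assume ij: "i < n" "j < n"
  have "(\<lambda>\<omega>. (c \<cdot>\<^sub>m f \<omega>) $$ (i, j)) = (\<lambda>\<omega>. c * f \<omega> $$ (i, j))"
  proof
    fix \<omega> show "(c \<cdot>\<^sub>m f \<omega>) $$ (i, j) = c * f \<omega> $$ (i, j)"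
      using c[of \<omega>] ij by auto
  qed
  then show "(\<lambda>\<omega>. (c \<cdot>\<^sub>m f \<omega>) $$ (i, j)) \<in> borel_measurable M"
    using assms ij by (auto simp: measurable_entries_def intro!: borel_measurable_times)
qed

lemma measurable_mat_trace:
  assumes "measurable_entries M n f"
  shows "(\<lambda>\<omega>. mat_trace (f \<omega>)) \<in> borel_measurable M"
proof -
  have "dim_row (f \<omega>) = n" for \<omega> using assms by (auto simp: measurable_entries_def)
  then show ?thesis unfolding mat_trace_def
    using assms by (auto simp: measurable_entries_def intro!: borel_measurable_sum)
qed

text \<open>The power sums of all squared singular values are real parts of traces, hence polynomial
  in the entries and their conjugates. Subtracting the powers of the first k values, measurable by
  induction, leaves power sums whose p-th roots tend to the next value.\<close>

lemma measurable_singular_values: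
  assumes f: "measurable_entries M n f" and k: "k < n"
  shows "(\<lambda>\<omega>. (singular_values (f \<omega>) ! k)\<^sup>2) \<in> borel_measurable M"
  using k
proof (induction k rule: less_induct)
  case (less k)
  let ?s = "\<lambda>\<omega> i. (singular_values (f \<omega>) ! i)\<^sup>2"
  have c: "f \<omega> \<in> carrier_mat n n" for \<omega> using f by (auto simp: measurable_entries_def)
  have tr: "(\<lambda>\<omega>. \<Sum>i<n. ?s \<omega> i ^ p) \<in> borel_measurable M" for p
    unfolding singular_values_props(4)[OF c]
    using measurable_mat_trace[OF measurable_entries_pow[OF measurable_entries_mult[OF measurable_entries_adjoint[OF f] f]]]
    by measurable
  have split: "(\<Sum>i=k..<n. ?s \<omega> i ^ p) = (\<Sum>i<n. ?s \<omega> i ^ p) - (\<Sum>i<k. ?s \<omega> i ^ p)" for \<omega> p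
    using less.prems sum.atLeastLessThan_concat[of 0 k n "\<lambda>i. ?s \<omega> i ^ p"] by (simp add: lessThan_atLeast0)
  show ?case
  proof (rule borel_measurable_LIMSEQ_real)
    show "(\<lambda>p. root p (\<Sum>i=k..<n. ?s \<omega> i ^ p)) \<longlonglongrightarrow> ?s \<omega> k" for \<omega>
      using singular_values_props(2,3)[OF c[of \<omega>]] less.prems
      by (intro root_power_sum_tendsto_max) (auto intro!: power_mono)
    show "(\<lambda>\<omega>. root p (\<Sum>i=k..<n. ?s \<omega> i ^ p)) \<in> borel_measurable M" for p
    proof -
      have "(\<lambda>\<omega>. \<Sum>i<k. ?s \<omega> i ^ p) \<in> borel_measurable M"
      proof (rule borel_measurable_sum)
        fix i assume "i \<in> {..<k}"
        then show "(\<lambda>\<omega>. ?s \<omega> i ^ p) \<in> borel_measurable M"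
          using less.prems by (intro borel_measurable_power[OF less.IH]) auto
      qed
      then show ?thesis
        unfolding split by (intro measurable_compose[OF _ borel_measurable_root] borel_measurable_diff tr)
    qed
  qed
qed

section \<open>Moments of walks in a random matrix\<close>

definition entry_product :: "('v \<times> 'v \<Rightarrow> complex) \<Rightarrow> bool list \<Rightarrow> 'v list \<Rightarrow> complex" where
  "entry_product x w v = prod_list (map (\<lambda>(e, s). if s then x e else cnj (x e)) (walk_steps w v))"

lemma prod_list_entry_powers:
  assumes "finite S" "fst ` set xs \<subseteq> S"
  shows "prod_list (map (\<lambda>(e, s). if s then x e else cnj (x e)) xs)
    = (\<Prod>e\<in>S. x e ^ count_list xs (e, True) * cnj (x e) ^ count_list xs (e, False))"
  using assms(2)
proof (induction xs)
  case (Cons a xs)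
  obtain e s where a: "a = (e, s)" by (cases a)
  have e: "e \<in> S" using Cons.prems a by simp
  let ?f = "\<lambda>xs e'. x e' ^ count_list xs (e', True) * cnj (x e') ^ count_list xs (e', False)"
  have "(\<Prod>e'\<in>S. ?f (a # xs) e') = (\<Prod>e'\<in>S. (if e' = e then (if s then x e else cnj (x e)) else 1) * ?f xs e')"
    by (intro prod.cong) (auto simp: a)
  also have "\<dots> = (if s then x e else cnj (x e)) * (\<Prod>e'\<in>S. ?f xs e')"
    using assms(1) e by (simp add: prod.distrib)
  finally show ?case using Cons a by simp
qed simp

lemma count_list_map_fst:
  "count_list (map fst xs) e = count_list xs (e, True) + count_list xs (e, False)"
proof (induction xs)
  case (Cons a xs)
  then show ?case by (cases a; cases "snd a") auto
qed simp

lemma (in prob_space) indep_vars_reindex_inj: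
  assumes X: "indep_vars (\<lambda>_. N) X I" and f: "inj_on f J" "f ` J \<subseteq> I"
  shows "indep_vars (\<lambda>_. N) (\<lambda>j. X (f j)) J"
proof -
  let ?F = "\<lambda>i. {X i -` A \<inter> space M | A. A \<in> sets N}"
  have rv: "random_variable N (X i)" if "i \<in> I" for i using X that by (auto simp: indep_vars_def2)
  have F: "indep_sets ?F I" using X by (auto simp: indep_vars_def2)
  have "indep_sets (\<lambda>j. ?F (f j)) J"
  proof (rule indep_setsI)
    show "?F (f i) \<subseteq> events" if "i \<in> J" for i
      using rv[of "f i"] f(2) that by (auto simp: measurable_sets)
    fix A J' assume J': "J' \<noteq> {}" "J' \<subseteq> J" "finite J'" and A: "\<forall>j\<in>J'. A j \<in> ?F (f j)"
    have inj: "inj_on f J'" using f(1) J'(2) by (rule inj_on_subset)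
    define B where "B = (\<lambda>i. A (inv_into J' f i))"
    have B: "B (f j) = A j" if "j \<in> J'" for j using inj that by (simp add: B_def)
    have "prob (\<Inter>i\<in>f ` J'. B i) = (\<Prod>i\<in>f ` J'. prob (B i))"
      using F J' f(2) A B by (intro indep_setsD[OF F]) auto
    then show "prob (\<Inter>j\<in>J'. A j) = (\<Prod>j\<in>J'. prob (A j))"
      using B by (simp add: prod.reindex[OF inj])
  qed
  then show ?thesis using rv f(2) by (auto simp: indep_vars_def2)
qed

text \<open>What truncation at sqrt n leaves of the assumptions: the mean is no longer 0 but of
  order n^(-3/2), and the common second moment \<open>s\<close> is at most 1 instead of 1. One
  constant \<open>K\<close> serves for the mean and the fourth moment.\<close>

locale bounded_entries = prob_space P for P :: "'a measure" +
  fixes n :: nat and Z :: "nat \<times> nat \<Rightarrow> 'a \<Rightarrow> complex" and K s :: real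
  assumes n: "n \<ge> 1" and K: "K \<ge> 1"
    and indep: "indep_vars (\<lambda>_. borel) Z ({..<n} \<times> {..<n})"
    and bounded: "\<And>e \<omega>. cmod (Z e \<omega>) \<le> sqrt (real n)"
    and mean: "\<And>e. e \<in> {..<n} \<times> {..<n} \<Longrightarrow> cmod (expectation (Z e)) \<le> K / (real n * sqrt (real n))"
    and second: "\<And>e. e \<in> {..<n} \<times> {..<n} \<Longrightarrow> expectation (\<lambda>\<omega>. (cmod (Z e \<omega>))\<^sup>2) = s"
    and s_le: "s \<le> 1"
    and fourth: "\<And>e. e \<in> {..<n} \<times> {..<n} \<Longrightarrow> expectation (\<lambda>\<omega>. (cmod (Z e \<omega>)) ^ 4) \<le> K"
begin

abbreviation "r \<equiv> sqrt (real n)"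

lemma r_ge: "r \<ge> 1"
  using n by (intro real_sqrt_ge_one) simp

lemma r_sq: "r * r = real n"
  by simp

lemma Z_measurable: "e \<in> {..<n} \<times> {..<n} \<Longrightarrow> Z e \<in> borel_measurable P"
  using indep by (auto simp: indep_vars_def)

lemma mixed_measurable:
  assumes "e \<in> {..<n} \<times> {..<n}"
  shows "(\<lambda>\<omega>. Z e \<omega> ^ p * cnj (Z e \<omega>) ^ q) \<in> borel_measurable P"
  using Z_measurable[OF assms] by (intro borel_measurable_times borel_measurable_power borel_measurable_cnj) auto

lemma mixed_integrable:
  assumes "e \<in> {..<n} \<times> {..<n}"
  shows "integrable P (\<lambda>\<omega>. Z e \<omega> ^ p * cnj (Z e \<omega>) ^ q)"
proof (rule integrable_const_bound[where B = "r ^ (p + q)"])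
  show "AE \<omega> in P. norm (Z e \<omega> ^ p * cnj (Z e \<omega>) ^ q) \<le> r ^ (p + q)"
    using bounded by (intro AE_I2) (simp add: norm_mult norm_power power_add[symmetric] power_mono)
qed (rule mixed_measurable[OF assms])

lemma norm_integrable:
  assumes "e \<in> {..<n} \<times> {..<n}"
  shows "integrable P (\<lambda>\<omega>. cmod (Z e \<omega>) ^ k)"
  using integrable_norm[OF mixed_integrable[OF assms, of k 0]] by (simp add: norm_power)

text \<open>With the factor r^k set aside, a position costs 1 / n, and a further 1 / r unless it is
  visited exactly twice. Order three is interpolated between two and four; higher orders follow from
  order four by pulling out the bound r of the entries.\<close>

lemma absolute_moment_le:
  assumes e: "e \<in> {..<n} \<times> {..<n}" and k: "k \<ge> 2"
  shows "expectation (\<lambda>\<omega>. cmod (Z e \<omega>) ^ k) \<le> K * r ^ k / real n * (if k = 2 then 1 else 1 / r)"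
proof -
  have rp: "r > 0" using r_ge by linarith
  consider "k = 2" | "k = 3" | "k \<ge> 4" using k by linarith
  then show ?thesis
  proof cases
    case 1
    then show ?thesis using second[OF e] s_le K n by (simp add: power2_eq_square)
  next
    case 2
    have "expectation (\<lambda>\<omega>. cmod (Z e \<omega>) ^ 3) \<le> expectation (\<lambda>\<omega>. (cmod (Z e \<omega>) ^ 2 + cmod (Z e \<omega>) ^ 4) / 2)"
    proof (rule integral_mono)
      show "cmod (Z e \<omega>) ^ 3 \<le> (cmod (Z e \<omega>) ^ 2 + cmod (Z e \<omega>) ^ 4) / 2" for \<omega>
      proof -
        have "0 \<le> (cmod (Z e \<omega>) * (cmod (Z e \<omega>) - 1))\<^sup>2" by simp
        then show ?thesis by (simp add: power2_eq_square power3_eq_cube power4_eq_xxxx algebra_simps)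
      qed
    qed (use norm_integrable[OF e] in auto)
    also have "\<dots> = (s + expectation (\<lambda>\<omega>. cmod (Z e \<omega>) ^ 4)) / 2"
      using norm_integrable[OF e] second[OF e] by simp
    also have "\<dots> \<le> (K + K) / 2"
      using s_le K by (intro divide_right_mono add_mono fourth[OF e]) auto
    also have "(K + K) / 2 = K" by simp
    also have "K = K * r ^ k / real n * (1 / r)"
    proof -
      have "K = K * t ^ 3 / N * (1 / t)" if "t > 0" "t * t = N" for t N :: real
        unfolding that(2)[symmetric] using that(1) by (simp add: power3_eq_cube)
      from this[OF rp r_sq] show ?thesis using 2 by simp
    qed
    finally show ?thesis using 2 by simp
  next
    case 3
    have "expectation (\<lambda>\<omega>. cmod (Z e \<omega>) ^ k) \<le> expectation (\<lambda>\<omega>. r ^ (k - 4) * cmod (Z e \<omega>) ^ 4)"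
    proof (rule integral_mono)
      show "cmod (Z e \<omega>) ^ k \<le> r ^ (k - 4) * cmod (Z e \<omega>) ^ 4" for \<omega>
      proof -
        have "cmod (Z e \<omega>) ^ k = cmod (Z e \<omega>) ^ (k - 4) * cmod (Z e \<omega>) ^ 4"
          using 3 by (simp flip: power_add)
        also have "\<dots> \<le> r ^ (k - 4) * cmod (Z e \<omega>) ^ 4"
          using bounded by (intro mult_right_mono power_mono) auto
        finally show ?thesis .
      qed
    qed (use norm_integrable[OF e] in auto)
    also have "\<dots> \<le> r ^ (k - 4) * K"
      using norm_integrable[OF e] fourth[OF e] by (simp add: mult_left_mono)
    \<comment> \<open>One factor r is given away so that all orders from three on share a
      bound.\<close>
    also have "\<dots> \<le> r ^ (k - 3) * K"
      using r_ge K by (intro mult_right_mono power_increasing) auto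
    also have "\<dots> = K * r ^ k / real n * (1 / r)"
    proof -
      have "t ^ (k - 3) * K = K * t ^ k / N * (1 / t)" if "t > 0" "t * t = N" for t N :: real
      proof -
        have "t ^ k = t ^ (k - 3) * t ^ 3" using 3 by (simp flip: power_add)
        then show ?thesis unfolding that(2)[symmetric] using that(1) by (simp add: power3_eq_cube)
      qed
      from this[OF rp r_sq] show ?thesis .
    qed
    finally show ?thesis using 3 by simp
  qed
qed

lemma mixed_moment_le:
  assumes e: "e \<in> {..<n} \<times> {..<n}" and pq: "p + q \<ge> 1"
  shows "cmod (expectation (\<lambda>\<omega>. Z e \<omega> ^ p * cnj (Z e \<omega>) ^ q))
    \<le> K * r ^ (p + q) / real n * (if p + q = 2 then 1 else 1 / r)"
proof (cases "p + q = 1")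
  case True
  have rp: "r > 0" using r_ge by linarith
  have "cmod (expectation (\<lambda>\<omega>. Z e \<omega> ^ p * cnj (Z e \<omega>) ^ q)) = cmod (expectation (Z e))"
  proof (cases "p = 1")
    case False
    then have "p = 0" "q = 1" using True by auto
    then show ?thesis by (simp add: complex_mod_cnj)
  qed (use True in auto)
  also have "\<dots> \<le> K / (real n * r)" by (rule mean[OF e])
  \<comment> \<open>The small mean leaves a whole factor r to spare here.\<close>
  also have "\<dots> \<le> K * r / (real n * r)"
    using K r_ge n rp by (intro divide_right_mono) (auto simp: mult_le_cancel_left1)
  finally show ?thesis using True by simp
next
  case False
  have "cmod (expectation (\<lambda>\<omega>. Z e \<omega> ^ p * cnj (Z e \<omega>) ^ q)) \<le> expectation (\<lambda>\<omega>. cmod (Z e \<omega> ^ p * cnj (Z e \<omega>) ^ q))"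
    by (rule integral_norm_bound)
  also have "\<dots> = expectation (\<lambda>\<omega>. cmod (Z e \<omega>) ^ (p + q))"
    by (simp add: norm_mult norm_power power_add)
  also have "\<dots> \<le> K * r ^ (p + q) / real n * (if p + q = 2 then 1 else 1 / r)"
    using False pq by (intro absolute_moment_le e) auto
  finally show ?thesis .
qed

definition walk_mean :: "bool list \<Rightarrow> nat list \<Rightarrow> complex" where
  "walk_mean w v = expectation (\<lambda>\<omega>. entry_product (\<lambda>e. Z e \<omega>) w v)"

lemma walk_steps_grid:
  assumes "length v = Suc (length w)" "set v \<subseteq> {..<n}"
  shows "fst ` set (walk_steps w v) \<subseteq> {..<n} \<times> {..<n}"
  by (rule subset_trans[OF walk_steps_subset[OF assms(1)] Sigma_mono[OF assms(2)]]) (rule assms(2))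

lemma
  assumes v: "length v = Suc (length w)" "set v \<subseteq> {..<n}"
  shows walk_mean_eq_prod: "walk_mean w v = (\<Prod>e\<in>fst ` set (walk_steps w v).
      expectation (\<lambda>\<omega>. Z e \<omega> ^ count_list (walk_steps w v) (e, True) * cnj (Z e \<omega>) ^ count_list (walk_steps w v) (e, False)))"
    and entry_product_integrable: "integrable P (\<lambda>\<omega>. entry_product (\<lambda>e. Z e \<omega>) w v)"
proof -
  let ?xs = "walk_steps w v"
  let ?Y = "\<lambda>e z. z ^ count_list ?xs (e, True) * cnj z ^ count_list ?xs (e, False)"
  have grid: "fst ` set ?xs \<subseteq> {..<n} \<times> {..<n}" by (rule walk_steps_grid[OF v])
  have eq: "entry_product (\<lambda>e. Z e \<omega>) w v = (\<Prod>e\<in>fst ` set ?xs. ?Y e (Z e \<omega>))" for \<omega>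
    unfolding entry_product_def by (rule prod_list_entry_powers) auto
  have Y: "?Y e \<in> borel_measurable borel" for e
    by (intro borel_measurable_times borel_measurable_power borel_measurable_cnj) auto
  have ind: "indep_vars (\<lambda>_. borel) (\<lambda>e \<omega>. ?Y e (Z e \<omega>)) (fst ` set ?xs)"
    using indep_vars_compose2[OF indep_vars_subset[OF indep grid], where Y = ?Y and N = "\<lambda>_. borel"] Y by blast
  have int: "integrable P (\<lambda>\<omega>. ?Y e (Z e \<omega>))" if "e \<in> fst ` set ?xs" for e
    using grid that by (intro mixed_integrable) blast
  show "walk_mean w v = (\<Prod>e\<in>fst ` set ?xs. expectation (\<lambda>\<omega>. ?Y e (Z e \<omega>)))"
    unfolding walk_mean_def eq by (rule indep_vars_lebesgue_integral[OF _ ind int]) auto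
  show "integrable P (\<lambda>\<omega>. entry_product (\<lambda>e. Z e \<omega>) w v)"
    unfolding eq by (rule indep_vars_integrable[OF _ ind int]) auto
qed

end

definition closed_walks :: "nat \<Rightarrow> nat \<Rightarrow> nat list set" where
  "closed_walks n L = {v. length v = Suc L \<and> set v \<subseteq> {..<n} \<and> hd v = last v}"

lemma finite_closed_walks: "finite (closed_walks n L)"
  by (rule finite_subset[OF _ finite_lists_length_eq[of "{..<n}" "Suc L"]]) (auto simp: closed_walks_def)

text \<open>Such a list is encoded by the sorted list of its \<open>k\<close> vertices and, for each
  place, the index of its vertex in that list.\<close>

lemma card_walks_with_vertices:
  "card {v. length v = L \<and> set v \<subseteq> {..<n} \<and> card (set v) = k} \<le> n ^ k * k ^ L"
proof -
  let ?X = "{xs. set xs \<subseteq> {..<n} \<and> length xs = k} \<times> {is. set is \<subseteq> {..<k} \<and> length is = L}"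
  have fin: "finite ?X" by (intro finite_cartesian_product finite_lists_length_eq) auto
  have "{v. length v = L \<and> set v \<subseteq> {..<n} \<and> card (set v) = k} \<subseteq> (\<lambda>(xs, is). map (nth xs) is) ` ?X"
  proof
    fix v assume "v \<in> {v. length v = L \<and> set v \<subseteq> {..<n} \<and> card (set v) = k}"
    then have v: "length v = L" "set v \<subseteq> {..<n}" "card (set v) = k" by auto
    let ?xs = "sorted_list_of_set (set v)"
    have xs: "set ?xs = set v" "length ?xs = k" using v(3) by auto
    have "\<forall>x\<in>set v. \<exists>i<k. ?xs ! i = x" using xs by (metis in_set_conv_nth)
    then obtain g where g: "\<And>x. x \<in> set v \<Longrightarrow> g x < k \<and> ?xs ! g x = x" by metis
    have "v = map (nth ?xs) (map g v)" using g by (auto simp: map_idI)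
    moreover have "(?xs, map g v) \<in> ?X" using v xs g by auto
    ultimately show "v \<in> (\<lambda>(xs, is). map (nth xs) is) ` ?X" by (intro image_eqI[of _ _ "(?xs, map g v)"]) auto
  qed
  then have "card {v. length v = L \<and> set v \<subseteq> {..<n} \<and> card (set v) = k} \<le> card ?X"
    using fin by (rule surj_card_le[rotated])
  then show ?thesis by (simp add: card_cartesian_product card_lists_length_eq)
qed

context bounded_entries begin

lemma walk_mean_le:
  assumes v: "length v = Suc (length w)" "set v \<subseteq> {..<n}"
  defines "Q \<equiv> fst ` set (walk_steps w v)"
  shows "cmod (walk_mean w v) \<le> K ^ length w * r ^ length w / real n ^ card Q *
    (\<Prod>e\<in>Q. if count_list (map fst (walk_steps w v)) e = 2 then 1 else 1 / r)"
proof -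
  let ?c = "\<lambda>e. count_list (map fst (walk_steps w v)) e"
  have rp: "r > 0" using r_ge by linarith
  have finQ: "finite Q" by (simp add: Q_def)
  have grid: "Q \<subseteq> {..<n} \<times> {..<n}" unfolding Q_def by (rule walk_steps_grid[OF v])
  have "cmod (walk_mean w v) = (\<Prod>e\<in>Q. cmod (expectation (\<lambda>\<omega>. Z e \<omega> ^ count_list (walk_steps w v) (e, True) * cnj (Z e \<omega>) ^ count_list (walk_steps w v) (e, False))))"
    unfolding walk_mean_eq_prod[OF v] Q_def by (rule prod_norm[symmetric])
  also have "\<dots> \<le> (\<Prod>e\<in>Q. K * r ^ ?c e / real n * (if ?c e = 2 then 1 else 1 / r))"
  proof (rule prod_mono)
    fix e assume e: "e \<in> Q"
    have "?c e \<noteq> 0" using e by (auto simp: count_list_0_iff Q_def)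
    then show "0 \<le> cmod (expectation (\<lambda>\<omega>. Z e \<omega> ^ count_list (walk_steps w v) (e, True) * cnj (Z e \<omega>) ^ count_list (walk_steps w v) (e, False))) \<and>
      cmod (expectation (\<lambda>\<omega>. Z e \<omega> ^ count_list (walk_steps w v) (e, True) * cnj (Z e \<omega>) ^ count_list (walk_steps w v) (e, False)))
      \<le> K * r ^ ?c e / real n * (if ?c e = 2 then 1 else 1 / r)"
      using mixed_moment_le[of e "count_list (walk_steps w v) (e, True)" "count_list (walk_steps w v) (e, False)"] grid e
      unfolding count_list_map_fst by auto
  qed
  also have "\<dots> = K ^ card Q * r ^ (\<Sum>e\<in>Q. ?c e) / real n ^ card Q * (\<Prod>e\<in>Q. if ?c e = 2 then 1 else 1 / r)"
    by (simp add: prod.distrib prod_dividef power_sum)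
  also have "(\<Sum>e\<in>Q. ?c e) = length w"
    using sum_count_set[of "map fst (walk_steps w v)" Q] finQ by (simp add: Q_def)
  also have "K ^ card Q * r ^ length w / real n ^ card Q * (\<Prod>e\<in>Q. if ?c e = 2 then 1 else 1 / r)
      \<le> K ^ length w * r ^ length w / real n ^ card Q * (\<Prod>e\<in>Q. if ?c e = 2 then 1 else 1 / r)"
  proof -
    \<comment> \<open>\<open>K >= 1\<close> allows a constant that depends on the length of the word
      only.\<close>
    have "card Q \<le> length w"
      using card_length[of "map fst (walk_steps w v)"] by (simp add: Q_def)
    then have "K ^ card Q \<le> K ^ length w" using K by (intro power_increasing) auto
    then show ?thesis using rp
      by (intro mult_right_mono divide_right_mono prod_nonneg) auto
  qed
  finally show ?thesis .
qed

text \<open>With L letters and V vertices, tree walks have order r^(L + 2) / n^V, and any other walk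
  loses at least a factor r. Either V is less than the number of positions plus one, which loses a
  factor n, or equality holds and, by \<open>tree_walk_of_double_edges\<close>, some position is not
  visited exactly twice, which costs 1 / r.\<close>

lemma walk_mean_le_of_not_tree_walk:
  assumes v: "length v = Suc (length w)" "set v \<subseteq> {..<n}" "hd v = last v" and nt: "\<not> tree_walk w v"
  shows "cmod (walk_mean w v) \<le> K ^ length w * r ^ Suc (length w) / real n ^ card (set v)"
proof -
  define Q where "Q = fst ` set (walk_steps w v)"
  let ?c = "\<lambda>e. count_list (map fst (walk_steps w v)) e"
  let ?g = "\<lambda>e. if ?c e = 2 then 1 else 1 / r"
  have rp: "r > 0" "1 / r \<le> 1" using r_ge by auto
  have finQ: "finite Q" by (simp add: Q_def)
  have g: "0 \<le> ?g e" "?g e \<le> 1" for e using rp by auto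
  have le: "cmod (walk_mean w v) \<le> K ^ length w * r ^ length w / real n ^ card Q * prod ?g Q"
    using walk_mean_le[OF v(1,2)] by (simp add: Q_def)
  have A: "0 \<le> K ^ length w * r ^ length w / real n ^ card Q" using K rp by simp
  have V: "card (set v) \<le> card Q + 1" using card_vertices_le[OF v(1)] by (simp add: Q_def)
  show ?thesis
  proof (cases "card (set v) = card Q + 1")
    case False
    then have "card (set v) \<le> card Q" using V by simp
    have "cmod (walk_mean w v) \<le> K ^ length w * r ^ length w / real n ^ card Q"
      using le mult_left_mono[OF prod_le_1[of Q ?g] A] g by fastforce
    also have "\<dots> \<le> K ^ length w * r ^ Suc (length w) / real n ^ card (set v)"
    proof (rule frac_le)
      show "K ^ length w * r ^ length w \<le> K ^ length w * r ^ Suc (length w)"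
        using K r_ge by (intro mult_left_mono power_increasing) auto
      show "real n ^ card (set v) \<le> real n ^ card Q"
        using n \<open>card (set v) \<le> card Q\<close> by (intro power_increasing) auto
    qed (use K n rp in auto)
    finally show ?thesis .
  next
    case True
    then obtain e where e: "e \<in> Q" "?c e \<noteq> 2"
      using tree_walk_of_double_edges[OF v(1,3)] nt by (auto simp: Q_def)
    have "prod ?g Q = ?g e * prod ?g (Q - {e})" using finQ e(1) by (rule prod.remove)
    also have "\<dots> \<le> 1 / r * 1"
      using e(2) rp(1) g by (intro mult_mono prod_le_1 prod_nonneg) auto
    finally have "K ^ length w * r ^ length w / real n ^ card Q * prod ?g Q \<le> K ^ length w * r ^ length w / real n ^ card Q * (1 / r)"
      using A by (intro mult_left_mono) auto
    also have "\<dots> = K ^ length w * r ^ Suc (length w) / real n ^ card (set v)"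
    proof -
      have "K ^ length w * t ^ length w / N ^ card Q * (1 / t) = K ^ length w * t ^ Suc (length w) / N ^ (card Q + 1)"
        if "t > 0" "t * t = N" for t N :: real
        unfolding that(2)[symmetric] using that(1) by (simp add: field_simps)
      from this[OF rp(1) r_sq] show ?thesis unfolding True .
    qed
    finally show ?thesis using le by linarith
  qed
qed

lemma walk_mean_of_tree_walk:
  assumes t: "tree_walk w v" and v: "set v \<subseteq> {..<n}"
  shows "walk_mean w v = of_real (s ^ (length w div 2))"
proof -
  let ?xs = "walk_steps w v"
  obtain S where S: "finite S" "S \<subseteq> set v \<times> set v" "2 * card S = length w"
    "mset ?xs = image_mset (\<lambda>e. (e, True)) (mset_set S) + image_mset (\<lambda>e. (e, False)) (mset_set S)"
    using tree_walk_steps[OF t] .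
  have "set_mset (mset ?xs) = (\<lambda>e. (e, True)) ` S \<union> (\<lambda>e. (e, False)) ` S"
    unfolding S(4) using S(1) by simp
  then have Q: "fst ` set ?xs = S" by (simp add: image_Un image_image)
  have "count (image_mset (\<lambda>e. (e, b)) (mset_set S)) (e, c) = (if b = c \<and> e \<in> S then 1 else 0)"
    for e and b c :: bool
    using S(1) by (induction S rule: finite_induct) auto
  then have cnt: "count_list ?xs (e, b) = 1" if "e \<in> S" for e b
    using that arg_cong[OF S(4), of "\<lambda>M. count M (e, b)"] by (cases b) (simp_all add: count_mset)
  have len: "length v = Suc (length w)" by (rule tree_walk_props(1)[OF t])
  have "walk_mean w v = (\<Prod>e\<in>S. expectation (\<lambda>\<omega>. Z e \<omega> * cnj (Z e \<omega>)))"
    unfolding walk_mean_eq_prod[OF len v] Q using cnt by (intro prod.cong) auto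
  also have "\<dots> = (\<Prod>e\<in>S. of_real s)"
  proof (rule prod.cong[OF refl])
    fix e assume "e \<in> S"
    then have e: "e \<in> {..<n} \<times> {..<n}" using S(2) v by blast
    have "expectation (\<lambda>\<omega>. Z e \<omega> * cnj (Z e \<omega>)) = expectation (\<lambda>\<omega>. complex_of_real ((cmod (Z e \<omega>))\<^sup>2))"
      by (simp only: complex_norm_square)
    also have "\<dots> = of_real s" by (simp only: integral_complex_of_real second[OF e])
    finally show "expectation (\<lambda>\<omega>. Z e \<omega> * cnj (Z e \<omega>)) = of_real s" .
  qed
  also have "\<dots> = of_real (s ^ (length w div 2))" using S(3) by (simp flip: S(3))
  finally show ?thesis .
qed

text \<open>The walks that are not tree walks are grouped by their number k of vertices: at most n^k
  (L + 1)^(L + 1) of them, each with a mean carrying n^(-k), so that all classes have the same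
  bound. The last factor L + 1 in \<open>D\<close> counts the classes.\<close>

lemma sum_walk_mean_approx:
  defines "D \<equiv> \<lambda>L. real (L + 1) ^ (L + 2) * K ^ L"
  shows "cmod ((\<Sum>v\<in>closed_walks n (length w). walk_mean w v)
      - of_real (real (tree_walk_shapes w * falling n (length w div 2 + 1)) * s ^ (length w div 2)))
    \<le> D (length w) * r ^ Suc (length w)"
proof -
  let ?L = "length w"
  let ?T = "tree_walks {..<n} w"
  let ?B = "closed_walks n ?L - ?T"
  have T: "?T \<subseteq> closed_walks n ?L"
    using tree_walk_props by (auto simp: tree_walks_def closed_walks_def)
  have "(\<Sum>v\<in>?T. walk_mean w v) = (\<Sum>v\<in>?T. of_real (s ^ (?L div 2)))"
    by (rule sum.cong) (auto simp: tree_walks_def walk_mean_of_tree_walk)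
  also have "\<dots> = of_real (real (tree_walk_shapes w * falling n (?L div 2 + 1)) * s ^ (?L div 2))"
    by (simp add: card_tree_walks)
  finally have "(\<Sum>v\<in>closed_walks n ?L. walk_mean w v)
      - of_real (real (tree_walk_shapes w * falling n (?L div 2 + 1)) * s ^ (?L div 2)) = (\<Sum>v\<in>?B. walk_mean w v)"
    using sum.subset_diff[OF T finite_closed_walks, of "walk_mean w"] by simp
  moreover have "cmod (\<Sum>v\<in>?B. walk_mean w v) \<le> D ?L * r ^ Suc ?L"
  proof -
    let ?h = "\<lambda>v. K ^ ?L * r ^ Suc ?L / real n ^ card (set v)"
    have finB: "finite ?B" using finite_closed_walks by auto
    have h0: "K ^ ?L * r ^ Suc ?L \<ge> 0" using K r_ge by simp
    have "cmod (\<Sum>v\<in>?B. walk_mean w v) \<le> (\<Sum>v\<in>?B. ?h v)"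
    proof (rule sum_norm_le)
      fix v assume "v \<in> ?B"
      then show "cmod (walk_mean w v) \<le> ?h v"
        by (intro walk_mean_le_of_not_tree_walk) (auto simp: closed_walks_def tree_walks_def)
    qed
    also have "\<dots> = (\<Sum>k\<in>{1..?L+1}. \<Sum>v\<in>{v\<in>?B. card (set v) = k}. ?h v)"
    proof (rule sum.group[symmetric])
      show "(\<lambda>v. card (set v)) ` ?B \<subseteq> {1..?L+1}"
      proof
        fix k assume "k \<in> (\<lambda>v. card (set v)) ` ?B"
        then obtain v :: "nat list" where "length v = Suc ?L" "k = card (set v)"
          by (auto simp: closed_walks_def)
        then show "k \<in> {1..?L+1}" using card_length[of v] by (cases v) (auto simp: Suc_le_eq card_gt_0_iff)
      qed
    qed (use finB in auto)
    also have "\<dots> \<le> (\<Sum>k\<in>{1..?L+1}. real (?L + 1) ^ (?L + 1) * (K ^ ?L * r ^ Suc ?L))"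
    proof (rule sum_mono)
      fix k assume k: "k \<in> {1..?L+1}"
      let ?W = "{v. length v = Suc ?L \<and> set v \<subseteq> {..<n} \<and> card (set v) = k}"
      have "card {v\<in>?B. card (set v) = k} \<le> card ?W"
        by (intro card_mono finite_subset[OF _ finite_lists_length_eq[of "{..<n}" "Suc ?L"]])
          (auto simp: closed_walks_def)
      also have "\<dots> \<le> n ^ k * k ^ Suc ?L" by (rule card_walks_with_vertices)
      also have "\<dots> \<le> n ^ k * (?L + 1) ^ Suc ?L"
        using k by (intro mult_left_mono power_mono) auto
      finally have "real (card {v\<in>?B. card (set v) = k}) \<le> real (n ^ k * (?L + 1) ^ Suc ?L)"
        by (simp only: of_nat_le_iff)
      then have c: "real (card {v\<in>?B. card (set v) = k}) \<le> real n ^ k * real (?L + 1) ^ (?L + 1)"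
        by (simp only: of_nat_mult of_nat_power Suc_eq_plus1)
      have "(\<Sum>v\<in>{v\<in>?B. card (set v) = k}. ?h v) = real (card {v\<in>?B. card (set v) = k}) * (K ^ ?L * r ^ Suc ?L / real n ^ k)"
        by simp
      also have "\<dots> \<le> (real n ^ k * real (?L + 1) ^ (?L + 1)) * (K ^ ?L * r ^ Suc ?L / real n ^ k)"
        using c h0 by (intro mult_right_mono) auto
      also have "\<dots> = real (?L + 1) ^ (?L + 1) * (K ^ ?L * r ^ Suc ?L)" using n by simp
      finally show "(\<Sum>v\<in>{v\<in>?B. card (set v) = k}. ?h v) \<le> real (?L + 1) ^ (?L + 1) * (K ^ ?L * r ^ Suc ?L)" .
    qed
    also have "\<dots> = D ?L * r ^ Suc ?L" by (simp add: D_def algebra_simps)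
    finally show ?thesis .
  qed
  ultimately show ?thesis by simp
qed

end

section \<open>Trace expansion\<close>

fun mat_word :: "complex mat \<Rightarrow> bool list \<Rightarrow> complex mat" where
  "mat_word X [] = 1\<^sub>m (dim_row X)"
| "mat_word X (s # w) = (if s then X else mat_adjoint X) * mat_word X w"

lemma mat_word_carrier: "X \<in> carrier_mat n n \<Longrightarrow> mat_word X w \<in> carrier_mat n n"
  by (induction w) (auto intro: mult_carrier_mat mat_adjoint_carrier)

definition walks_between :: "nat \<Rightarrow> nat \<Rightarrow> nat \<Rightarrow> nat \<Rightarrow> nat list set" where
  "walks_between n L i j = {v. length v = Suc L \<and> set v \<subseteq> {..<n} \<and> hd v = i \<and> last v = j}"

lemma finite_walks_between: "finite (walks_between n L i j)"
  by (rule finite_subset[OF _ finite_lists_length_eq[of "{..<n}" "Suc L"]]) (auto simp: walks_between_def)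

lemma walks_between_Suc:
  assumes "i < n"
  shows "walks_between n (Suc L) i j = (\<Union>l<n. Cons i ` walks_between n L l j)"
proof (intro equalityI subsetI)
  fix v assume v: "v \<in> walks_between n (Suc L) i j"
  then obtain l u where eq: "v = i # l # u" by (auto simp: walks_between_def length_Suc_conv)
  then have "l < n" "l # u \<in> walks_between n L l j"
    using v by (auto simp: walks_between_def)
  then show "v \<in> (\<Union>l<n. Cons i ` walks_between n L l j)"
    using eq by blast
next
  fix v assume "v \<in> (\<Union>l<n. Cons i ` walks_between n L l j)"
  then obtain l u where "v = i # u" "u \<in> walks_between n L l j" by blast
  then show "v \<in> walks_between n (Suc L) i j"
    using assms by (cases u) (auto simp: walks_between_def)
qed

lemma mat_word_entry:
  assumes X: "X \<in> carrier_mat n n" and "i < n" "j < n"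
  shows "mat_word X w $$ (i, j) = (\<Sum>v\<in>walks_between n (length w) i j. entry_product (\<lambda>e. X $$ e) w v)"
  using assms(2)
proof (induction w arbitrary: i)
  case Nil
  have "walks_between n 0 i j = (if i = j then {[i]} else {})"
    using Nil by (auto simp: walks_between_def length_Suc_conv)
  then show ?case using X Nil assms(3) by (auto simp: entry_product_def)
next
  case (Cons s w)
  let ?S = "if s then X else mat_adjoint X"
  have S: "?S \<in> carrier_mat n n" using X mat_adjoint_carrier[OF X] by simp
  have "mat_word X (s # w) $$ (i, j) = (\<Sum>l<n. ?S $$ (i, l) * mat_word X w $$ (l, j))"
    unfolding mat_word.simps by (rule index_mult_mat_sum[OF S mat_word_carrier[OF X] Cons.prems assms(3)])
  also have "\<dots> = (\<Sum>l<n. \<Sum>v\<in>walks_between n (length w) l j. entry_product (\<lambda>e. X $$ e) (s # w) (i # v))"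
  proof (rule sum.cong[OF refl])
    fix l assume l: "l \<in> {..<n}"
    have "?S $$ (i, l) * entry_product (\<lambda>e. X $$ e) w v = entry_product (\<lambda>e. X $$ e) (s # w) (i # v)"
      if "v \<in> walks_between n (length w) l j" for v
      using that l Cons.prems index_mat_adjoint[OF X, of i l]
      by (cases s) (auto simp: entry_product_def walks_between_def)
    then show "?S $$ (i, l) * mat_word X w $$ (l, j) =
        (\<Sum>v\<in>walks_between n (length w) l j. entry_product (\<lambda>e. X $$ e) (s # w) (i # v))"
      using Cons.IH[of l] l by (simp add: sum_distrib_left)
  qed
  also have "\<dots> = (\<Sum>l<n. \<Sum>v\<in>Cons i ` walks_between n (length w) l j. entry_product (\<lambda>e. X $$ e) (s # w) v)"
    by (rule sum.cong[OF refl]) (simp add: sum.reindex)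
  also have "\<dots> = (\<Sum>v\<in>walks_between n (length (s # w)) i j. entry_product (\<lambda>e. X $$ e) (s # w) v)"
    unfolding list.size(4) add_Suc_right add_0_right walks_between_Suc[OF Cons.prems]
    by (rule sum.UNION_disjoint[symmetric]) (simp_all add: finite_walks_between, auto simp: walks_between_def)
  finally show ?case .
qed

lemma mat_trace_mat_word:
  assumes X: "X \<in> carrier_mat n n"
  shows "mat_trace (mat_word X w) = (\<Sum>v\<in>closed_walks n (length w). entry_product (\<lambda>e. X $$ e) w v)"
proof -
  have "mat_trace (mat_word X w) = (\<Sum>i<n. \<Sum>v\<in>walks_between n (length w) i i. entry_product (\<lambda>e. X $$ e) w v)"
    using mat_word_carrier[OF X, of w] by (auto simp: mat_trace_def mat_word_entry[OF X])
  also have "\<dots> = (\<Sum>v\<in>(\<Union>i<n. walks_between n (length w) i i). entry_product (\<lambda>e. X $$ e) w v)"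
    by (rule sum.UNION_disjoint[symmetric]) (simp_all add: finite_walks_between, auto simp: walks_between_def)
  also have "(\<Union>i<n. walks_between n (length w) i i) = closed_walks n (length w)"
  proof (intro equalityI subsetI)
    fix v assume v: "v \<in> closed_walks n (length w)"
    then have "hd v < n" by (cases v) (auto simp: closed_walks_def)
    then show "v \<in> (\<Union>i<n. walks_between n (length w) i i)"
      using v by (auto simp: closed_walks_def walks_between_def)
  qed (auto simp: closed_walks_def walks_between_def)
  finally show ?thesis .
qed

lemma mat_word_append:
  assumes X: "X \<in> carrier_mat n n"
  shows "mat_word X (w1 @ w2) = mat_word X w1 * mat_word X w2"
proof (induction w1)
  case Nil
  then show ?case using X left_mult_one_mat[OF mat_word_carrier[OF X, of w2]] by simp
next
  case (Cons s w1)
  have S: "(if s then X else mat_adjoint X) \<in> carrier_mat n n"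
    using X mat_adjoint_carrier[OF X] by simp
  show ?case
    using Cons assoc_mult_mat[OF S mat_word_carrier[OF X, of w1] mat_word_carrier[OF X, of w2]] by simp
qed

lemma mat_word_concat_replicate:
  assumes X: "X \<in> carrier_mat n n"
  shows "mat_word X (concat (replicate p w)) = mat_word X w ^\<^sub>m p"
proof (induction p)
  case 0
  then show ?case using X mat_word_carrier[OF X, of w] by simp
next
  case (Suc p)
  have "concat (replicate (Suc p) w) = concat (replicate p w) @ w"
    by (simp flip: replicate_append_same)
  then show ?case using Suc by (simp add: mat_word_append[OF X])
qed

lemma mat_word_True: "X \<in> carrier_mat n n \<Longrightarrow> mat_word X (replicate m True) = X ^\<^sub>m m"
  using mat_word_concat_replicate[of X n m "[True]"] right_mult_one_mat[of X n n]
  by (simp add: concat_replicate_single)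

lemma mat_adjoint_mult:
  fixes A B :: "complex mat"
  assumes A: "A \<in> carrier_mat n n" and B: "B \<in> carrier_mat n n"
  shows "mat_adjoint (A * B) = mat_adjoint B * mat_adjoint A"
proof (rule eq_matI)
  have AB: "A * B \<in> carrier_mat n n" using A B by auto
  have BA: "mat_adjoint B * mat_adjoint A \<in> carrier_mat n n"
    using mat_adjoint_carrier[OF A] mat_adjoint_carrier[OF B] by auto
  show "dim_row (mat_adjoint (A * B)) = dim_row (mat_adjoint B * mat_adjoint A)"
    "dim_col (mat_adjoint (A * B)) = dim_col (mat_adjoint B * mat_adjoint A)"
    using mat_adjoint_carrier[OF AB] BA by (auto simp del: index_mult_mat)
  fix i j assume "i < dim_row (mat_adjoint B * mat_adjoint A)" "j < dim_col (mat_adjoint B * mat_adjoint A)"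
  then have ij: "i < n" "j < n" using BA by (auto simp del: index_mult_mat)
  have "mat_adjoint (A * B) $$ (i, j) = cnj (\<Sum>l<n. A $$ (j, l) * B $$ (l, i))"
    unfolding index_mat_adjoint[OF AB ij] index_mult_mat_sum[OF A B ij(2,1)] ..
  also have "\<dots> = (\<Sum>l<n. mat_adjoint B $$ (i, l) * mat_adjoint A $$ (l, j))"
    using ij by (simp add: index_mat_adjoint[OF A] index_mat_adjoint[OF B] mult.commute)
  also have "\<dots> = (mat_adjoint B * mat_adjoint A) $$ (i, j)"
    using index_mult_mat_sum[OF mat_adjoint_carrier[OF B] mat_adjoint_carrier[OF A] ij] by simp
  finally show "mat_adjoint (A * B) $$ (i, j) = (mat_adjoint B * mat_adjoint A) $$ (i, j)" .
qed

lemma mat_word_False: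
  assumes X: "X \<in> carrier_mat n n"
  shows "mat_word X (replicate m False) = mat_adjoint (X ^\<^sub>m m)"
proof (induction m)
  case 0
  have "mat_adjoint (1\<^sub>m n) = (1\<^sub>m n :: complex mat)"
  proof (rule eq_matI)
    fix i j assume "i < dim_row (1\<^sub>m n :: complex mat)" "j < dim_col (1\<^sub>m n :: complex mat)"
    then show "mat_adjoint (1\<^sub>m n) $$ (i, j) = (1\<^sub>m n :: complex mat) $$ (i, j)"
      by (subst index_mat_adjoint[of _ n]) auto
  qed (use mat_adjoint_carrier[of "1\<^sub>m n" n] in auto)
  then show ?case using X by simp
next
  case (Suc m)
  have "X ^\<^sub>m m \<in> carrier_mat n n" using X by auto
  from mat_adjoint_mult[OF this X] show ?case using Suc by simp
qed

lemma mat_adjoint_smult: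
  fixes A :: "complex mat"
  assumes A: "A \<in> carrier_mat n n"
  shows "mat_adjoint (c \<cdot>\<^sub>m A) = cnj c \<cdot>\<^sub>m mat_adjoint A"
proof (rule eq_matI)
  have cA: "c \<cdot>\<^sub>m A \<in> carrier_mat n n" using A by auto
  show "dim_row (mat_adjoint (c \<cdot>\<^sub>m A)) = dim_row (cnj c \<cdot>\<^sub>m mat_adjoint A)"
    "dim_col (mat_adjoint (c \<cdot>\<^sub>m A)) = dim_col (cnj c \<cdot>\<^sub>m mat_adjoint A)"
    using mat_adjoint_carrier[OF cA] mat_adjoint_carrier[OF A] by auto
  fix i j assume "i < dim_row (cnj c \<cdot>\<^sub>m mat_adjoint A)" "j < dim_col (cnj c \<cdot>\<^sub>m mat_adjoint A)"
  then have ij: "i < n" "j < n" using mat_adjoint_carrier[OF A] by auto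
  then show "mat_adjoint (c \<cdot>\<^sub>m A) $$ (i, j) = (cnj c \<cdot>\<^sub>m mat_adjoint A) $$ (i, j)"
    using A mat_adjoint_carrier[OF A] by (simp add: index_mat_adjoint[OF A] index_mat_adjoint[OF cA])
qed

lemma smult_pow_mat:
  fixes A :: "complex mat"
  assumes A: "A \<in> carrier_mat n n"
  shows "(c \<cdot>\<^sub>m A) ^\<^sub>m p = c ^ p \<cdot>\<^sub>m A ^\<^sub>m p"
proof (induction p)
  case (Suc p)
  have Ap: "A ^\<^sub>m p \<in> carrier_mat n n" using A by auto
  have "(c \<cdot>\<^sub>m A) ^\<^sub>m Suc p = (c ^ p \<cdot>\<^sub>m A ^\<^sub>m p) * (c \<cdot>\<^sub>m A)" using Suc by simp
  also have "\<dots> = c ^ p \<cdot>\<^sub>m (c \<cdot>\<^sub>m (A ^\<^sub>m p * A))"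
    using mult_smult_assoc_mat[OF Ap, of "c \<cdot>\<^sub>m A" n "c ^ p"] mult_smult_distrib[OF Ap A, of c] A by simp
  also have "\<dots> = c ^ Suc p \<cdot>\<^sub>m A ^\<^sub>m Suc p"
    by (rule eq_matI) (auto simp: mult_ac simp del: index_mult_mat(1))
  finally show ?case .
qed (use A in auto)

lemma mat_trace_smult:
  fixes A :: "complex mat"
  assumes "A \<in> carrier_mat n n"
  shows "mat_trace (c \<cdot>\<^sub>m A) = c * mat_trace A"
  using assms by (auto simp: mat_trace_def sum_distrib_left)

definition moment_word :: "nat \<Rightarrow> nat \<Rightarrow> bool list" where
  "moment_word m p = concat (replicate p (replicate m False @ replicate m True))"

lemma length_moment_word: "length (moment_word m p) = 2 * (m * p)"
  by (induction p) (auto simp: moment_word_def algebra_simps)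

lemma mat_trace_scaled_pow:
  fixes c :: real and m p :: nat
  assumes X: "X \<in> carrier_mat n n"
  defines "A \<equiv> complex_of_real c \<cdot>\<^sub>m (X ^\<^sub>m m)"
  shows "mat_trace ((mat_adjoint A * A) ^\<^sub>m p)
    = complex_of_real ((c * c) ^ p) * (\<Sum>v\<in>closed_walks n (2 * (m * p)). entry_product (\<lambda>e. X $$ e) (moment_word m p) v)"
proof -
  let ?W = "mat_word X (replicate m False @ replicate m True)"
  have Xm: "X ^\<^sub>m m \<in> carrier_mat n n" using X by auto
  have aXm: "mat_adjoint (X ^\<^sub>m m) \<in> carrier_mat n n" by (rule mat_adjoint_carrier[OF Xm])
  have W: "?W \<in> carrier_mat n n" by (rule mat_word_carrier[OF X])
  have "mat_adjoint A * A = (complex_of_real c \<cdot>\<^sub>m mat_adjoint (X ^\<^sub>m m)) * (complex_of_real c \<cdot>\<^sub>m X ^\<^sub>m m)"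
    unfolding A_def mat_adjoint_smult[OF Xm] by simp
  also have "\<dots> = complex_of_real c \<cdot>\<^sub>m (complex_of_real c \<cdot>\<^sub>m (mat_adjoint (X ^\<^sub>m m) * X ^\<^sub>m m))"
    using mult_smult_assoc_mat[OF aXm, of "complex_of_real c \<cdot>\<^sub>m X ^\<^sub>m m" n] mult_smult_distrib[OF aXm Xm] Xm
    by simp
  also have "mat_adjoint (X ^\<^sub>m m) * X ^\<^sub>m m = ?W"
    by (simp add: mat_word_append[OF X] mat_word_True[OF X] mat_word_False[OF X])
  also have "complex_of_real c \<cdot>\<^sub>m (complex_of_real c \<cdot>\<^sub>m ?W) = complex_of_real (c * c) \<cdot>\<^sub>m ?W"
    by (rule eq_matI) auto
  finally have "mat_trace ((mat_adjoint A * A) ^\<^sub>m p) = complex_of_real ((c * c) ^ p) * mat_trace (?W ^\<^sub>m p)"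
    using W by (simp add: smult_pow_mat[OF W] mat_trace_smult[of _ n])
  also have "?W ^\<^sub>m p = mat_word X (moment_word m p)"
    unfolding moment_word_def by (rule mat_word_concat_replicate[OF X, symmetric])
  finally show ?thesis
    by (simp only: mat_trace_mat_word[OF X] length_moment_word)
qed

section \<open>The expected empirical law\<close>

text \<open>The law of \<open>h k\<close> for an index k drawn uniformly and independently of
  \<open>P\<close>, that is, the mean of the random empirical law. Being a probability measure on
  the line, it is open to the method of moments.\<close>

definition empirical_law :: "'a measure \<Rightarrow> nat \<Rightarrow> (nat \<Rightarrow> 'a \<Rightarrow> real) \<Rightarrow> real measure" where
  "empirical_law P n h = distr (P \<Otimes>\<^sub>M measure_pmf (pmf_of_set {..<n})) borel (\<lambda>z. h (snd z) (fst z))"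

locale empirical_family = prob_space P for P :: "'a measure" +
  fixes n :: nat and h :: "nat \<Rightarrow> 'a \<Rightarrow> real"
  assumes n: "n \<ge> 1" and h: "\<And>k. h k \<in> borel_measurable P"
begin

abbreviation "Q \<equiv> P \<Otimes>\<^sub>M measure_pmf (pmf_of_set {..<n})"

lemma snd_measurable: "snd \<in> Q \<rightarrow>\<^sub>M count_space UNIV"
proof -
  have "measurable Q (measure_pmf (pmf_of_set {..<n})) = measurable Q (count_space UNIV)"
    by (rule measurable_cong_sets) simp_all
  then show ?thesis using measurable_snd by blast
qed

lemma h_pair_measurable: "(\<lambda>z. h (snd z) (fst z)) \<in> borel_measurable Q"
proof (rule measurable_compose_countable[where f = "\<lambda>k z. h k (fst z)" and g = snd])
  show "(\<lambda>z. h k (fst z)) \<in> borel_measurable Q" for k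
    using h by measurable
qed (rule snd_measurable)

lemma prob_space_Q: "prob_space Q"
proof -
  interpret pair_prob_space P "measure_pmf (pmf_of_set {..<n})" ..
  show ?thesis by unfold_locales
qed

lemma real_distribution_empirical_law: "real_distribution (empirical_law P n h)"
  unfolding empirical_law_def
  by (rule prob_space.real_distribution_distr[OF prob_space_Q h_pair_measurable])

lemma integral_empirical_law:
  fixes \<phi> :: "real \<Rightarrow> real"
  assumes \<phi>: "\<phi> \<in> borel_measurable borel" and bdd: "\<And>k \<omega>. k < n \<Longrightarrow> \<bar>\<phi> (h k \<omega>)\<bar> \<le> B"
  shows "integrable (empirical_law P n h) \<phi>"
    and "(\<integral>x. \<phi> x \<partial>empirical_law P n h) = (\<integral>\<omega>. (\<Sum>k<n. \<phi> (h k \<omega>)) / real n \<partial>P)"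
proof -
  interpret pair_prob_space P "measure_pmf (pmf_of_set {..<n})" ..
  have ne: "{..<n} \<noteq> {}" "finite {..<n}" using n by (auto simp: lessThan_empty_iff)
  have m: "(\<lambda>z. \<phi> (h (snd z) (fst z))) \<in> borel_measurable Q"
    by (rule measurable_compose[OF h_pair_measurable \<phi>])
  have "AE z in Q. snd z \<in> {..<n}"
  proof (rule AE_pair_measure)
    have "AE k in measure_pmf (pmf_of_set {..<n}). k \<in> {..<n}"
      using ne by (simp add: AE_measure_pmf_iff)
    then show "AE x in P. AE y in measure_pmf (pmf_of_set {..<n}). snd (x, y) \<in> {..<n}" by simp
    show "{z \<in> space Q. snd z \<in> {..<n}} \<in> sets Q"
      using measurable_sets[OF snd_measurable, of "{..<n}"] by (simp add: vimage_def Int_def conj_commute)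
  qed
  then have "AE z in Q. norm (\<phi> (h (snd z) (fst z))) \<le> B"
    by eventually_elim (simp add: bdd)
  then have int: "integrable Q (\<lambda>z. \<phi> (h (snd z) (fst z)))"
    using m by (rule finite_measure.integrable_const_bound[OF prob_space.finite_measure[OF prob_space_Q]])
  then show "integrable (empirical_law P n h) \<phi>"
    unfolding empirical_law_def by (subst integrable_distr_eq[OF h_pair_measurable \<phi>])
  have "(\<integral>x. \<phi> x \<partial>empirical_law P n h) = (\<integral>z. \<phi> (h (snd z) (fst z)) \<partial>Q)"
    unfolding empirical_law_def by (rule integral_distr[OF h_pair_measurable \<phi>])
  also have "\<dots> = (\<integral>\<omega>. (\<integral>k. \<phi> (h k \<omega>) \<partial>measure_pmf (pmf_of_set {..<n})) \<partial>P)"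
    using integral_fst'[OF int] by simp
  also have "\<dots> = (\<integral>\<omega>. (\<Sum>k<n. \<phi> (h k \<omega>)) / real n \<partial>P)"
    using ne by (simp add: integral_pmf_of_set)
  finally show "(\<integral>x. \<phi> x \<partial>empirical_law P n h) = (\<integral>\<omega>. (\<Sum>k<n. \<phi> (h k \<omega>)) / real n \<partial>P)" .
qed

lemma cdf_empirical_law:
  "cdf (empirical_law P n h) x = (\<integral>\<omega>. 1 / real n * (\<Sum>k<n. of_bool (h k \<omega> \<le> x)) \<partial>P)"
proof -
  interpret L: real_distribution "empirical_law P n h" by (rule real_distribution_empirical_law)
  have "cdf (empirical_law P n h) x = (\<integral>y. indicator {..x} y \<partial>empirical_law P n h)"
    by (simp add: cdf_def)
  also have "\<dots> = (\<integral>\<omega>. (\<Sum>k<n. indicator {..x} (h k \<omega>)) / real n \<partial>P)"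
    by (rule integral_empirical_law(2)[where B = 1]) (auto simp: indicator_def)
  finally show ?thesis by (simp add: indicator_def of_bool_def mult.commute divide_inverse)
qed

end

section \<open>Truncation and conclusion\<close>

definition truncate :: "real \<Rightarrow> complex \<Rightarrow> complex" where
  "truncate r z = (if cmod z \<le> r then z else 0)"

lemma truncate_measurable: "truncate r \<in> borel_measurable borel"
  unfolding truncate_def by measurable

lemma norm_truncate_le: "0 \<le> r \<Longrightarrow> cmod (truncate r z) \<le> r"
  by (simp add: truncate_def)

lemma entry_product_cong:
  assumes "\<And>e. e \<in> fst ` set (walk_steps w v) \<Longrightarrow> x e = y e"
  shows "entry_product x w v = entry_product y w v"
  unfolding entry_product_def
proof (intro arg_cong[where f = prod_list] map_cong refl)
  fix a assume "a \<in> set (walk_steps w v)"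
  then have "x (fst a) = y (fst a)" using assms by blast
  then show "(case a of (e, s) \<Rightarrow> if s then x e else cnj (x e)) = (case a of (e, s) \<Rightarrow> if s then y e else cnj (y e))"
    by (cases a) simp
qed

lemma norm_entry_product_le:
  assumes "\<And>e. cmod (x e) \<le> B"
  shows "cmod (entry_product x w v) \<le> B ^ length w"
proof -
  have B: "B \<ge> 0" using assms norm_ge_zero order_trans by blast
  have "cmod (prod_list (map (\<lambda>(e, s). if s then x e else cnj (x e)) xs)) \<le> B ^ length xs" for xs
  proof (induction xs)
    case (Cons a xs)
    obtain e s where a: "a = (e, s)" by (cases a)
    have "cmod (if s then x e else cnj (x e)) \<le> B" using assms[of e] by (auto simp: complex_mod_cnj)
    then show ?case using Cons B by (simp add: a norm_mult mult_mono)
  qed simp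
  from this[of "walk_steps w v"] show ?thesis by (simp add: entry_product_def)
qed

lemma measurable_scaled_power:
  assumes "\<And>j k. j \<ge> 1 \<Longrightarrow> k \<ge> 1 \<Longrightarrow> X j k \<in> borel_measurable P"
  shows "measurable_entries P n (scaled_power X m n)"
proof -
  have "measurable_entries P n (entry_matrix X n)"
    using assms by (auto simp: measurable_entries_def entry_matrix_def)
  then show ?thesis unfolding scaled_power_def
    by (intro measurable_entries_smult measurable_entries_pow)
qed

lemma falling_ratio_tendsto: "(\<lambda>n. real (falling n k) / real n ^ k) \<longlonglongrightarrow> 1"
proof -
  have "(\<lambda>n. \<Prod>i<k. real (n - i) / real n) \<longlonglongrightarrow> (\<Prod>i<k. 1)"
  proof (rule tendsto_prod)
    fix i
    have "(\<lambda>n. 1 - real i / real n) \<longlonglongrightarrow> 1 - 0"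
      by (intro tendsto_intros lim_const_over_n)
    then have lim: "(\<lambda>n. 1 - real i / real n) \<longlonglongrightarrow> 1" by simp
    have "eventually (\<lambda>n. 1 - real i / real n = real (n - i) / real n) sequentially"
      using eventually_gt_at_top[of i] by eventually_elim (simp add: of_nat_diff field_simps)
    then show "(\<lambda>n. real (n - i) / real n) \<longlonglongrightarrow> 1"
      by (rule Lim_transform_eventually[OF lim])
  qed
  then show ?thesis by (simp add: falling_def prod_dividef)
qed

text \<open>A pointwise Markov inequality beyond the level \<open>r\<close>, used with k = 1, l = 3
  for the mean and k = l = 2 for the variance.\<close>

lemma power_le_power_divide:
  fixes x r :: real
  assumes "0 < r" "r \<le> x"
  shows "x ^ k \<le> x ^ (k + l) / r ^ l"
proof -
  have "x ^ k * r ^ l \<le> x ^ k * x ^ l"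
    using assms by (intro mult_left_mono power_mono) auto
  then show ?thesis using assms(1) by (simp add: pos_le_divide_eq power_add)
qed

locale iid_entries = prob_space P for P :: "'a measure" +
  fixes X :: "nat \<Rightarrow> nat \<Rightarrow> 'a \<Rightarrow> complex" and M :: real
  assumes indep: "indep_vars (\<lambda>_. borel) (\<lambda>(j, k). X j k) ({1..} \<times> {1..})"
    and ident: "\<And>j k. j \<ge> 1 \<Longrightarrow> k \<ge> 1 \<Longrightarrow> distr P borel (X j k) = distr P borel (X 1 1)"
    and mean: "\<And>j k. j \<ge> 1 \<Longrightarrow> k \<ge> 1 \<Longrightarrow> integrable P (X j k) \<and> expectation (X j k) = 0"
    and second: "\<And>j k. j \<ge> 1 \<Longrightarrow> k \<ge> 1 \<Longrightarrow>
      integrable P (\<lambda>\<omega>. cmod (X j k \<omega>) ^ 2) \<and> expectation (\<lambda>\<omega>. cmod (X j k \<omega>) ^ 2) = 1"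
    and fourth: "\<And>j k. j \<ge> 1 \<Longrightarrow> k \<ge> 1 \<Longrightarrow>
      integrable P (\<lambda>\<omega>. cmod (X j k \<omega>) ^ 4) \<and> expectation (\<lambda>\<omega>. cmod (X j k \<omega>) ^ 4) = M"
begin

lemma X_measurable:
  assumes "j \<ge> 1" "k \<ge> 1"
  shows "X j k \<in> borel_measurable P"
  using mean[OF assms] by (intro borel_measurable_integrable) simp

lemma expectation_ident:
  fixes \<phi> :: "complex \<Rightarrow> real"
  assumes "j \<ge> 1" "k \<ge> 1" "\<phi> \<in> borel_measurable borel"
  shows "expectation (\<lambda>\<omega>. \<phi> (X j k \<omega>)) = expectation (\<lambda>\<omega>. \<phi> (X 1 1 \<omega>))"
  using integral_distr[OF X_measurable[OF assms(1,2)] assms(3)] integral_distr[OF X_measurable[of 1 1] assms(3)]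
    ident[OF assms(1,2)] by simp

section \<open>The truncated entries and their moments\<close>

definition trunc_entry :: "nat \<Rightarrow> nat \<Rightarrow> nat \<Rightarrow> 'a \<Rightarrow> complex" where
  "trunc_entry n j k \<omega> = truncate (sqrt (real n)) (X j k \<omega>)"

definition trunc_variance :: "nat \<Rightarrow> real" where
  "trunc_variance n = expectation (\<lambda>\<omega>. (cmod (trunc_entry n 1 1 \<omega>))\<^sup>2)"

lemma trunc_entry_measurable:
  assumes "j \<ge> 1" "k \<ge> 1"
  shows "trunc_entry n j k \<in> borel_measurable P"
  unfolding trunc_entry_def[abs_def]
  by (rule measurable_compose[OF X_measurable[OF assms] truncate_measurable])

lemma trunc_entry_integrable:
  assumes "j \<ge> 1" "k \<ge> 1"
  shows "integrable P (trunc_entry n j k)"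
proof (rule integrable_const_bound)
  show "AE \<omega> in P. norm (trunc_entry n j k \<omega>) \<le> sqrt (real n)"
    by (simp add: trunc_entry_def norm_truncate_le)
qed (rule trunc_entry_measurable[OF assms])

lemma trunc_norm_integrable:
  assumes "j \<ge> 1" "k \<ge> 1"
  shows "integrable P (\<lambda>\<omega>. cmod (trunc_entry n j k \<omega>) ^ p)"
proof (rule integrable_const_bound)
  show "AE \<omega> in P. norm (cmod (trunc_entry n j k \<omega>) ^ p) \<le> sqrt (real n) ^ p"
    by (simp add: trunc_entry_def norm_truncate_le power_mono)
  show "(\<lambda>\<omega>. cmod (trunc_entry n j k \<omega>) ^ p) \<in> borel_measurable P"
    using trunc_entry_measurable[OF assms] by measurable
qed

text \<open>As \<open>X j k\<close> has mean 0, the mean after truncation is, up to sign, that of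
  the part cut off, where |X| is at most |X|^4 / r^3.\<close>

lemma trunc_mean_le:
  assumes jk: "j \<ge> 1" "k \<ge> 1" and n: "n \<ge> 1"
  shows "cmod (expectation (trunc_entry n j k)) \<le> M / (real n * sqrt (real n))"
proof -
  let ?r = "sqrt (real n)"
  have r: "?r > 0" "?r ^ 3 = real n * ?r" using n by (auto simp: power3_eq_cube)
  have "expectation (trunc_entry n j k) = expectation (\<lambda>\<omega>. trunc_entry n j k \<omega> - X j k \<omega>)"
    using mean[OF jk] trunc_entry_integrable[OF jk] by simp
  also have "cmod \<dots> \<le> expectation (\<lambda>\<omega>. cmod (trunc_entry n j k \<omega> - X j k \<omega>))"
    by (rule integral_norm_bound)
  also have "\<dots> \<le> expectation (\<lambda>\<omega>. cmod (X j k \<omega>) ^ 4 / ?r ^ 3)"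
  proof (rule integral_mono)
    show "integrable P (\<lambda>\<omega>. cmod (trunc_entry n j k \<omega> - X j k \<omega>))"
      using mean[OF jk] trunc_entry_integrable[OF jk] by auto
    show "integrable P (\<lambda>\<omega>. cmod (X j k \<omega>) ^ 4 / ?r ^ 3)" using fourth[OF jk] by auto
    fix \<omega>
    show "cmod (trunc_entry n j k \<omega> - X j k \<omega>) \<le> cmod (X j k \<omega>) ^ 4 / ?r ^ 3"
    proof (cases "cmod (X j k \<omega>) \<le> ?r")
      case False
      then have "cmod (X j k \<omega>) \<le> cmod (X j k \<omega>) ^ 4 / ?r ^ 3"
        using power_le_power_divide[of ?r "cmod (X j k \<omega>)" 1 3, OF r(1)] by simp
      then show ?thesis using False by (simp add: trunc_entry_def truncate_def)
    qed (simp add: trunc_entry_def truncate_def)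
  qed
  also have "\<dots> = M / ?r ^ 3" using fourth[OF jk] by simp
  finally show ?thesis unfolding r(2) .
qed

lemma trunc_second:
  assumes "j \<ge> 1" "k \<ge> 1"
  shows "expectation (\<lambda>\<omega>. (cmod (trunc_entry n j k \<omega>))\<^sup>2) = trunc_variance n"
  unfolding trunc_variance_def trunc_entry_def
  by (rule expectation_ident[OF assms]) (use truncate_measurable in measurable)

lemma trunc_variance_bounds:
  assumes n: "n \<ge> 1"
  shows "trunc_variance n \<le> 1" "trunc_variance n \<ge> 1 - M / real n"
proof -
  let ?r = "sqrt (real n)"
  have r: "?r > 0" "?r ^ 2 = real n" using n by auto
  have "trunc_variance n \<le> expectation (\<lambda>\<omega>. cmod (X 1 1 \<omega>) ^ 2)"
    unfolding trunc_variance_def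
    using second[of 1 1] trunc_norm_integrable[of 1 1 n 2]
    by (intro integral_mono) (auto simp: trunc_entry_def truncate_def)
  then show "trunc_variance n \<le> 1" using second[of 1 1] by simp
  have "1 - trunc_variance n = expectation (\<lambda>\<omega>. cmod (X 1 1 \<omega>) ^ 2 - cmod (trunc_entry n 1 1 \<omega>) ^ 2)"
    using second[of 1 1] trunc_norm_integrable[of 1 1 n 2] by (simp add: trunc_variance_def)
  also have "\<dots> \<le> expectation (\<lambda>\<omega>. cmod (X 1 1 \<omega>) ^ 4 / ?r ^ 2)"
  proof (rule integral_mono)
    show "integrable P (\<lambda>\<omega>. cmod (X 1 1 \<omega>) ^ 2 - cmod (trunc_entry n 1 1 \<omega>) ^ 2)"
      using second[of 1 1] trunc_norm_integrable[of 1 1 n 2] by auto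
    show "integrable P (\<lambda>\<omega>. cmod (X 1 1 \<omega>) ^ 4 / ?r ^ 2)" using fourth[of 1 1] by auto
    fix \<omega>
    show "cmod (X 1 1 \<omega>) ^ 2 - cmod (trunc_entry n 1 1 \<omega>) ^ 2 \<le> cmod (X 1 1 \<omega>) ^ 4 / ?r ^ 2"
    proof (cases "cmod (X 1 1 \<omega>) \<le> ?r")
      case False
      then have "cmod (X 1 1 \<omega>) ^ 2 \<le> cmod (X 1 1 \<omega>) ^ 4 / ?r ^ 2"
        using power_le_power_divide[of ?r "cmod (X 1 1 \<omega>)" 2 2, OF r(1)] by simp
      then show ?thesis using False by (simp add: trunc_entry_def truncate_def)
    qed (simp add: trunc_entry_def truncate_def)
  qed
  also have "\<dots> = M / real n" using fourth[of 1 1] r(2) by simp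
  finally show "trunc_variance n \<ge> 1 - M / real n" by simp
qed

text \<open>The maximum with 1 provides the bound \<open>K >= 1\<close> of the locale.\<close>

lemma bounded_entries_trunc:
  assumes n: "n \<ge> 1"
  shows "bounded_entries P n (\<lambda>e. trunc_entry n (Suc (fst e)) (Suc (snd e))) (max 1 M) (trunc_variance n)"
proof
  let ?r = "sqrt (real n)"
  let ?f = "\<lambda>e :: nat \<times> nat. (Suc (fst e), Suc (snd e))"
  have M: "M \<le> max 1 M" by simp
  show "n \<ge> 1" by (rule n)
  show "max 1 M \<ge> 1" by simp
  have "indep_vars (\<lambda>_. borel) (\<lambda>e. (\<lambda>(j, k). X j k) (?f e)) ({..<n} \<times> {..<n})"
    by (rule indep_vars_reindex_inj[OF indep]) (auto simp: inj_on_def)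
  then have "indep_vars (\<lambda>_. borel) (\<lambda>e. X (Suc (fst e)) (Suc (snd e))) ({..<n} \<times> {..<n})"
    by simp
  from indep_vars_compose2[OF this, of "\<lambda>_. truncate ?r" "\<lambda>_. borel"] truncate_measurable
  show "indep_vars (\<lambda>_. borel) (\<lambda>e. trunc_entry n (Suc (fst e)) (Suc (snd e))) ({..<n} \<times> {..<n})"
    unfolding trunc_entry_def by simp
  show "cmod (trunc_entry n (Suc (fst e)) (Suc (snd e)) \<omega>) \<le> ?r" for e \<omega>
    by (simp add: trunc_entry_def norm_truncate_le)
  show "cmod (expectation (trunc_entry n (Suc (fst e)) (Suc (snd e)))) \<le> max 1 M / (real n * ?r)" for e
    using trunc_mean_le[of "Suc (fst e)" "Suc (snd e)" n] n divide_right_mono[OF M, of "real n * ?r"]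
    by (simp only: le_eq_less_or_eq) (simp, linarith)
  show "expectation (\<lambda>\<omega>. (cmod (trunc_entry n (Suc (fst e)) (Suc (snd e)) \<omega>))\<^sup>2) = trunc_variance n" for e
    by (rule trunc_second) auto
  show "trunc_variance n \<le> 1" by (rule trunc_variance_bounds(1)[OF n])
  show "expectation (\<lambda>\<omega>. cmod (trunc_entry n (Suc (fst e)) (Suc (snd e)) \<omega>) ^ 4) \<le> max 1 M" for e
  proof -
    have "expectation (\<lambda>\<omega>. cmod (trunc_entry n (Suc (fst e)) (Suc (snd e)) \<omega>) ^ 4)
        \<le> expectation (\<lambda>\<omega>. cmod (X (Suc (fst e)) (Suc (snd e)) \<omega>) ^ 4)"
      using fourth[of "Suc (fst e)" "Suc (snd e)"] trunc_norm_integrable[of "Suc (fst e)" "Suc (snd e)" n 4]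
      by (intro integral_mono) (auto simp: trunc_entry_def truncate_def)
    also have "\<dots> = M" using fourth[of "Suc (fst e)" "Suc (snd e)"] by simp
    finally show ?thesis by simp
  qed
qed

text \<open>The value 0 beyond the \<open>n\<close> singular values makes the function measurable
  for every \<open>k\<close>, as \<open>empirical_family\<close> demands.\<close>

definition squared_sv :: "nat \<Rightarrow> nat \<Rightarrow> nat \<Rightarrow> 'a \<Rightarrow> real" where
  "squared_sv m n k \<omega> = (if k < n then (singular_values (scaled_power (trunc_entry n) m n \<omega>) ! k)\<^sup>2 else 0)"

lemma squared_sv_measurable: "squared_sv m n k \<in> borel_measurable P"
  unfolding squared_sv_def
  using measurable_singular_values[OF measurable_scaled_power[of "trunc_entry n" P n m]] trunc_entry_measurable
  by (cases "k < n") auto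

lemma sum_squared_sv_power:
  assumes n: "n \<ge> 1"
  shows "(\<Sum>k<n. squared_sv m n k \<omega> ^ p) = 1 / real n ^ (m * p) *
    Re (\<Sum>v\<in>closed_walks n (2 * (m * p)). entry_product (\<lambda>e. trunc_entry n (Suc (fst e)) (Suc (snd e)) \<omega>) (moment_word m p) v)"
proof -
  let ?E = "entry_matrix (trunc_entry n) n \<omega>"
  let ?c = "real n powr (- (real m / 2))"
  have E: "?E \<in> carrier_mat n n" by (simp add: entry_matrix_def)
  have A: "scaled_power (trunc_entry n) m n \<omega> \<in> carrier_mat n n"
    using E by (auto simp: scaled_power_def)
  have c: "(?c * ?c) ^ p = 1 / real n ^ (m * p)"
  proof -
    have "?c * ?c = real n powr (- real m)" by (simp flip: powr_add)
    also have "\<dots> = 1 / real n ^ m" using n by (simp add: powr_minus powr_realpow divide_inverse)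
    finally show ?thesis by (simp add: power_divide power_mult)
  qed
  have "(\<Sum>k<n. squared_sv m n k \<omega> ^ p) =
      (\<Sum>k<n. ((singular_values (scaled_power (trunc_entry n) m n \<omega>) ! k)\<^sup>2) ^ p)"
    by (simp add: squared_sv_def)
  also have "\<dots> = Re (mat_trace ((mat_adjoint (scaled_power (trunc_entry n) m n \<omega>) * scaled_power (trunc_entry n) m n \<omega>) ^\<^sub>m p))"
    by (rule singular_values_props(4)[OF A])
  also have "\<dots> = 1 / real n ^ (m * p) * Re (\<Sum>v\<in>closed_walks n (2 * (m * p)). entry_product (\<lambda>e. ?E $$ e) (moment_word m p) v)"
    unfolding scaled_power_def mat_trace_scaled_pow[OF E] c by (simp only: times_complex.sel Re_complex_of_real Im_complex_of_real mult_zero_left diff_zero)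
  also have "(\<Sum>v\<in>closed_walks n (2 * (m * p)). entry_product (\<lambda>e. ?E $$ e) (moment_word m p) v) =
     (\<Sum>v\<in>closed_walks n (2 * (m * p)). entry_product (\<lambda>e. trunc_entry n (Suc (fst e)) (Suc (snd e)) \<omega>) (moment_word m p) v)"
  proof (rule sum.cong[OF refl], rule entry_product_cong)
    fix v e assume v: "v \<in> closed_walks n (2 * (m * p))" and e: "e \<in> fst ` set (walk_steps (moment_word m p) v)"
    have "fst ` set (walk_steps (moment_word m p) v) \<subseteq> set v \<times> set v"
      using v by (intro walk_steps_subset) (simp add: closed_walks_def length_moment_word)
    then have "fst e < n" "snd e < n" using e v by (force simp: closed_walks_def)+
    then show "?E $$ e = trunc_entry n (Suc (fst e)) (Suc (snd e)) \<omega>"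
      by (cases e) (simp add: entry_matrix_def)
  qed
  finally show ?thesis .
qed

text \<open>For fixed \<open>n\<close> truncation bounds all entries and with them the trace, and
  one non-negative term is at most the whole power sum. This supplies the integrability of the
  moments.\<close>

lemma squared_sv_power_bounded: "\<exists>B. \<forall>k<n. \<forall>\<omega>. \<bar>squared_sv m n k \<omega> ^ p\<bar> \<le> B"
proof (cases "n = 0")
  case False
  then have n: "n \<ge> 1" by simp
  let ?S = "\<lambda>\<omega>. \<Sum>v\<in>closed_walks n (2 * (m * p)). entry_product (\<lambda>e. trunc_entry n (Suc (fst e)) (Suc (snd e)) \<omega>) (moment_word m p) v"
  have nonneg: "squared_sv m n k \<omega> \<ge> 0" for k \<omega> by (simp add: squared_sv_def)
  have "\<bar>squared_sv m n k \<omega> ^ p\<bar> \<le> 1 / real n ^ (m * p) * (\<Sum>v\<in>closed_walks n (2 * (m * p)). sqrt (real n) ^ length (moment_word m p))"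
    if "k < n" for k \<omega>
  proof -
    have "\<bar>squared_sv m n k \<omega> ^ p\<bar> = squared_sv m n k \<omega> ^ p" using nonneg by simp
    also have "\<dots> \<le> (\<Sum>k<n. squared_sv m n k \<omega> ^ p)"
      using that nonneg by (intro member_le_sum) auto
    also have "\<dots> = 1 / real n ^ (m * p) * Re (?S \<omega>)" by (rule sum_squared_sv_power[OF n])
    also have "\<dots> \<le> 1 / real n ^ (m * p) * cmod (?S \<omega>)"
      by (intro mult_left_mono complex_Re_le_cmod) auto
    also have "\<dots> \<le> 1 / real n ^ (m * p) * (\<Sum>v\<in>closed_walks n (2 * (m * p)). sqrt (real n) ^ length (moment_word m p))"
      by (intro mult_left_mono sum_norm_le norm_entry_product_le) (auto simp: trunc_entry_def norm_truncate_le)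
    finally show ?thesis .
  qed
  then show ?thesis by blast
qed simp

lemma empirical_family_squared_sv: "n \<ge> 1 \<Longrightarrow> empirical_family P n (squared_sv m n)"
  by unfold_locales (auto intro: squared_sv_measurable)

lemma
  fixes m n p :: nat
  assumes n: "n \<ge> 1"
  defines "\<mu> \<equiv> empirical_law P n (squared_sv m n)"
  shows integrable_empirical_moment: "integrable \<mu> (\<lambda>x. x ^ p)"
    and empirical_moment_approx: "\<bar>(\<integral>x. x ^ p \<partial>\<mu>) - real (tree_walk_shapes (moment_word m p)) *
        (real (falling n (m * p + 1)) / real n ^ (m * p + 1)) * trunc_variance n ^ (m * p)\<bar>
      \<le> real (2 * (m * p) + 1) ^ (2 * (m * p) + 2) * max 1 M ^ (2 * (m * p)) / sqrt (real n)"
proof -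
  interpret Y: bounded_entries P n "\<lambda>e. trunc_entry n (Suc (fst e)) (Suc (snd e))" "max 1 M" "trunc_variance n"
    by (rule bounded_entries_trunc[OF n])
  interpret L: empirical_family P n "squared_sv m n" by (rule empirical_family_squared_sv[OF n])
  let ?w = "moment_word m p" and ?r = "sqrt (real n)" and ?L = "2 * (m * p)"
  let ?C = "closed_walks n ?L"
  let ?D = "real (?L + 1) ^ (?L + 2) * max 1 M ^ ?L"
  obtain B where B: "\<And>k \<omega>. k < n \<Longrightarrow> \<bar>squared_sv m n k \<omega> ^ p\<bar> \<le> B"
    using squared_sv_power_bounded[of n m p] by blast
  show "integrable \<mu> (\<lambda>x. x ^ p)"
    unfolding \<mu>_def by (rule L.integral_empirical_law(1)[where \<phi> = "\<lambda>x. x ^ p", OF _ B]) auto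
  let ?W = "\<Sum>v\<in>?C. Y.walk_mean ?w v"
  have int: "integrable P (\<lambda>\<omega>. entry_product (\<lambda>e. trunc_entry n (Suc (fst e)) (Suc (snd e)) \<omega>) ?w v)" if "v \<in> ?C" for v
    using that by (intro Y.entry_product_integrable) (auto simp: closed_walks_def length_moment_word)
  have "(\<integral>x. x ^ p \<partial>\<mu>) = expectation (\<lambda>\<omega>. (\<Sum>k<n. squared_sv m n k \<omega> ^ p) / real n)"
    unfolding \<mu>_def by (rule L.integral_empirical_law(2)[where \<phi> = "\<lambda>x. x ^ p", OF _ B]) auto
  also have "\<dots> = expectation (\<lambda>\<omega>. Re (\<Sum>v\<in>?C. entry_product (\<lambda>e. trunc_entry n (Suc (fst e)) (Suc (snd e)) \<omega>) ?w v) / real n ^ (m * p + 1))"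
    unfolding sum_squared_sv_power[OF n] by (simp add: mult.commute)
  also have "\<dots> = Re (expectation (\<lambda>\<omega>. \<Sum>v\<in>?C. entry_product (\<lambda>e. trunc_entry n (Suc (fst e)) (Suc (snd e)) \<omega>) ?w v)) / real n ^ (m * p + 1)"
    using int by (simp add: integral_Re)
  also have "expectation (\<lambda>\<omega>. \<Sum>v\<in>?C. entry_product (\<lambda>e. trunc_entry n (Suc (fst e)) (Suc (snd e)) \<omega>) ?w v) = ?W"
    using int unfolding Y.walk_mean_def by (rule Bochner_Integration.integral_sum)
  finally have mom: "(\<integral>x. x ^ p \<partial>\<mu>) = Re ?W / real n ^ (m * p + 1)" .
  let ?T = "real (tree_walk_shapes ?w * falling n (m * p + 1)) * trunc_variance n ^ (m * p)"
  have "cmod (?W - of_real ?T) \<le> ?D * ?r ^ Suc ?L"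
    using Y.sum_walk_mean_approx[of ?w] by (simp only: length_moment_word nonzero_mult_div_cancel_left[OF zero_neq_numeral[symmetric]])
  then have "\<bar>Re ?W - ?T\<bar> \<le> ?D * ?r ^ Suc ?L"
    using abs_Re_le_cmod[of "?W - of_real ?T"] by simp
  then have "\<bar>Re ?W - ?T\<bar> / real n ^ (m * p + 1) \<le> ?D * ?r ^ Suc ?L / real n ^ (m * p + 1)"
    by (intro divide_right_mono) auto
  \<comment> \<open>With L = 2 m p this is r^(L + 1) over n^(m p + 1) = r^(L + 2).\<close>
  also have "\<dots> = ?D / ?r"
  proof -
    have "D * t ^ Suc ?L / N ^ (m * p + 1) = D / t" if "t > 0" "t * t = N" for t N D :: real
    proof -
      have "t ^ Suc ?L = (t * t) ^ (m * p) * t" by (simp add: power_mult power2_eq_square)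
      then show ?thesis unfolding that(2) using that by auto
    qed
    then show ?thesis using n by simp
  qed
  also have "\<bar>Re ?W - ?T\<bar> / real n ^ (m * p + 1) = \<bar>(\<integral>x. x ^ p \<partial>\<mu>) - real (tree_walk_shapes ?w) *
        (real (falling n (m * p + 1)) / real n ^ (m * p + 1)) * trunc_variance n ^ (m * p)\<bar>"
  proof -
    have abs_eq: "\<bar>A - B\<bar> / N = \<bar>A / N - B / N\<bar>" if "N > 0" for A B N :: real
      using that by (simp add: diff_divide_distrib[symmetric])
    have T: "?T / real n ^ (m * p + 1) = real (tree_walk_shapes ?w) *
        (real (falling n (m * p + 1)) / real n ^ (m * p + 1)) * trunc_variance n ^ (m * p)"
      by simp
    show ?thesis
      unfolding mom T[symmetric] by (rule abs_eq) (use n in simp)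
  qed
  finally show "\<bar>(\<integral>x. x ^ p \<partial>\<mu>) - real (tree_walk_shapes ?w) *
        (real (falling n (m * p + 1)) / real n ^ (m * p + 1)) * trunc_variance n ^ (m * p)\<bar> \<le> ?D / ?r" .
qed

lemma trunc_variance_tendsto: "trunc_variance \<longlonglongrightarrow> 1"
proof (rule tendsto_sandwich)
  show "eventually (\<lambda>n. 1 - M / real n \<le> trunc_variance n) sequentially"
    using eventually_ge_at_top[of 1] by eventually_elim (rule trunc_variance_bounds(2))
  show "eventually (\<lambda>n. trunc_variance n \<le> 1) sequentially"
    using eventually_ge_at_top[of 1] by eventually_elim (rule trunc_variance_bounds(1))
  have "(\<lambda>n. 1 - M / real n) \<longlonglongrightarrow> 1 - 0" by (intro tendsto_intros lim_const_over_n)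
  then show "(\<lambda>n. 1 - M / real n) \<longlonglongrightarrow> 1" by simp
qed simp

text \<open>The shift to \<open>Suc n\<close> avoids the empty index set, which has no uniform
  distribution: every measure of the sequence has to be a real distribution.\<close>

lemma empirical_moment_tendsto:
  assumes m: "m \<ge> 1"
  shows "(\<lambda>n. \<integral>x. x ^ p \<partial>empirical_law P (Suc n) (squared_sv m (Suc n)))
    \<longlonglongrightarrow> 1 / real (m * p + 1) * real ((m * p + p) choose p)"
proof -
  let ?mom = "\<lambda>n. \<integral>x. x ^ p \<partial>empirical_law P n (squared_sv m n)"
  let ?main = "\<lambda>n. real (tree_walk_shapes (moment_word m p)) *
        (real (falling n (m * p + 1)) / real n ^ (m * p + 1)) * trunc_variance n ^ (m * p)"
  let ?D = "real (2 * (m * p) + 1) ^ (2 * (m * p) + 2) * max 1 M ^ (2 * (m * p))"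
  have "(\<lambda>n. ?mom n - ?main n) \<longlonglongrightarrow> 0"
  proof (rule Lim_null_comparison)
    show "eventually (\<lambda>n. norm (?mom n - ?main n) \<le> ?D / sqrt (real n)) sequentially"
      using eventually_ge_at_top[of 1]
      by eventually_elim (simp only: real_norm_def empirical_moment_approx)
    show "(\<lambda>n. ?D / sqrt (real n)) \<longlonglongrightarrow> 0"
      by (intro tendsto_divide_0[OF tendsto_const] filterlim_at_top_imp_at_infinity
          filterlim_compose[OF sqrt_at_top filterlim_real_sequentially])
  qed
  moreover have "?main \<longlonglongrightarrow> real (tree_walk_shapes (moment_word m p)) * 1 * 1 ^ (m * p)"
    by (intro tendsto_intros falling_ratio_tendsto trunc_variance_tendsto)
  ultimately have "(\<lambda>n. (?mom n - ?main n) + ?main n) \<longlonglongrightarrow> 0 + real (tree_walk_shapes (moment_word m p)) * 1 * 1 ^ (m * p)"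
    by (rule tendsto_add)
  then have "?mom \<longlonglongrightarrow> real (tree_walk_shapes (moment_word m p))" by simp
  then have "?mom \<longlonglongrightarrow> 1 / real (m * p + 1) * real ((m * p + p) choose p)"
    using tree_walk_shapes_power_word[OF m, of p] by (simp only: moment_word_def)
  then show ?thesis by (rule LIMSEQ_Suc)
qed

section \<open>Undoing the truncation\<close>

definition large_entry_event :: "nat \<Rightarrow> 'a set" where
  "large_entry_event n = {\<omega>\<in>space P. \<exists>j\<in>{1..n}. \<exists>k\<in>{1..n}. cmod (X j k \<omega>) > sqrt (real n)}"

lemma large_entry_event_measurable: "large_entry_event n \<in> events"
proof -
  have eq: "large_entry_event n = (\<Union>j\<in>{1..n}. \<Union>k\<in>{1..n}. {\<omega>\<in>space P. cmod (X j k \<omega>) > sqrt (real n)})"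
    by (auto simp: large_entry_event_def)
  show ?thesis unfolding eq
  proof (intro sets.finite_UN finite_atLeastAtMost)
    fix j k assume "j \<in> {1..n}" "k \<in> {1..n}"
    then have [measurable]: "X j k \<in> borel_measurable P" by (intro X_measurable) auto
    show "{\<omega>\<in>space P. cmod (X j k \<omega>) > sqrt (real n)} \<in> events" by measurable
  qed
qed

text \<open>Bounding the probability of a large entry by the full fourth moment would give only n^2
  M / n^2 = M. Restricting the moment to the tail makes the bound vanish, by dominated
  convergence.\<close>

definition fourth_tail :: "nat \<Rightarrow> real" where
  "fourth_tail n = expectation (\<lambda>\<omega>. cmod (X 1 1 \<omega>) ^ 4 * of_bool (cmod (X 1 1 \<omega>) > sqrt (real n)))"

lemma fourth_tail_tendsto: "fourth_tail \<longlonglongrightarrow> 0"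
proof -
  have [measurable]: "X 1 1 \<in> borel_measurable P" by (intro X_measurable) auto
  have "(\<lambda>n. expectation (\<lambda>\<omega>. cmod (X 1 1 \<omega>) ^ 4 * of_bool (cmod (X 1 1 \<omega>) > sqrt (real n)))) \<longlonglongrightarrow> expectation (\<lambda>\<omega>. 0)"
  proof (rule integral_dominated_convergence[where w = "\<lambda>\<omega>. cmod (X 1 1 \<omega>) ^ 4"])
    show "integrable P (\<lambda>\<omega>. cmod (X 1 1 \<omega>) ^ 4)" using fourth[of 1 1] by simp
    show "AE \<omega> in P. (\<lambda>n. cmod (X 1 1 \<omega>) ^ 4 * of_bool (cmod (X 1 1 \<omega>) > sqrt (real n))) \<longlonglongrightarrow> 0"
    proof (rule AE_I2)
      fix \<omega>
      have "eventually (\<lambda>n. sqrt (real n) \<ge> cmod (X 1 1 \<omega>)) sequentially"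
        using filterlim_compose[OF sqrt_at_top filterlim_real_sequentially]
        by (auto simp: filterlim_at_top)
      then have "eventually (\<lambda>n. cmod (X 1 1 \<omega>) ^ 4 * of_bool (cmod (X 1 1 \<omega>) > sqrt (real n)) = 0) sequentially"
        by eventually_elim auto
      then show "(\<lambda>n. cmod (X 1 1 \<omega>) ^ 4 * of_bool (cmod (X 1 1 \<omega>) > sqrt (real n))) \<longlonglongrightarrow> 0"
        by (rule tendsto_eventually)
    qed
    show "(\<lambda>\<omega>. cmod (X 1 1 \<omega>) ^ 4 * of_bool (cmod (X 1 1 \<omega>) > sqrt (real n))) \<in> borel_measurable P" for n
      unfolding of_bool_def by measurable
    show "AE \<omega> in P. norm (cmod (X 1 1 \<omega>) ^ 4 * of_bool (cmod (X 1 1 \<omega>) > sqrt (real n))) \<le> cmod (X 1 1 \<omega>) ^ 4" for n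
      by (simp add: of_bool_def)
  qed simp
  then show ?thesis by (simp add: fourth_tail_def[abs_def])
qed

text \<open>A union bound over n^2 entries, each treated by Markov's inequality with (sqrt n)^4 =
  n^2; the two factors cancel.\<close>

lemma prob_large_entry_le:
  assumes n: "n \<ge> 1"
  shows "prob (large_entry_event n) \<le> fourth_tail n"
proof -
  let ?r = "sqrt (real n)"
  let ?A = "\<lambda>j k. {\<omega>\<in>space P. cmod (X j k \<omega>) > ?r}"
  have A: "?A j k \<in> events \<and> prob (?A j k) \<le> fourth_tail n / (real n * real n)" if "j \<in> {1..n}" "k \<in> {1..n}" for j k
  proof -
    have jk: "j \<ge> 1" "k \<ge> 1" using that by auto
    have [measurable]: "X j k \<in> borel_measurable P" "X 1 1 \<in> borel_measurable P" using jk by (auto intro: X_measurable)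
    have ev: "?A j k \<in> events" by measurable
    let ?\<phi> = "\<lambda>z. cmod z ^ 4 * of_bool (cmod z > ?r) :: real"
    have int: "integrable P (\<lambda>\<omega>. ?\<phi> (X j k \<omega>))"
    proof (rule Bochner_Integration.integrable_bound[of P "\<lambda>\<omega>. cmod (X j k \<omega>) ^ 4"])
      show "(\<lambda>\<omega>. ?\<phi> (X j k \<omega>)) \<in> borel_measurable P" unfolding of_bool_def by measurable
    qed (use fourth[OF jk] in \<open>simp_all add: of_bool_def\<close>)
    have "real n * real n * prob (?A j k) = expectation (\<lambda>\<omega>. real n * real n * indicator (?A j k) \<omega>)"
      using ev by simp
    also have "\<dots> \<le> expectation (\<lambda>\<omega>. ?\<phi> (X j k \<omega>))"
    proof (rule integral_mono)
      show "integrable P (\<lambda>\<omega>. real n * real n * indicator (?A j k) \<omega>)"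
        using ev by (intro integrable_mult_right) (simp add: less_top[symmetric])
      fix \<omega>
      show "real n * real n * indicator (?A j k) \<omega> \<le> ?\<phi> (X j k \<omega>)"
      proof (cases "cmod (X j k \<omega>) > ?r")
        case True
        have "?r ^ 4 \<le> cmod (X j k \<omega>) ^ 4" using True by (intro power_mono) auto
        moreover have "?r ^ 4 = real n * real n" by (simp add: power4_eq_xxxx)
        ultimately show ?thesis using True by (auto simp: indicator_def)
      qed (simp add: indicator_def)
    qed (rule int)
    also have "\<dots> = fourth_tail n"
      unfolding fourth_tail_def by (rule expectation_ident[OF jk]) (unfold of_bool_def, measurable)
    finally show ?thesis using ev n by (simp add: field_simps)
  qed
  have eq: "large_entry_event n = (\<Union>e\<in>{1..n} \<times> {1..n}. ?A (fst e) (snd e))"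
    unfolding large_entry_event_def by force
  have "prob (large_entry_event n) \<le> (\<Sum>e\<in>{1..n} \<times> {1..n}. prob (?A (fst e) (snd e)))"
    unfolding eq using A by (intro finite_measure_subadditive_finite) auto
  also have "\<dots> \<le> (\<Sum>e\<in>{1..n} \<times> {1..n}. fourth_tail n / (real n * real n))"
    using A by (intro sum_mono) auto
  also have "\<dots> = fourth_tail n" using n by simp
  finally show ?thesis .
qed

lemma empirical_cdf_bounds: "0 \<le> empirical_cdf V m n x \<omega>" "empirical_cdf V m n x \<omega> \<le> 1"
proof -
  have "(\<Sum>k<n. of_bool ((singular_values (scaled_power V m n \<omega>) ! k)\<^sup>2 \<le> x)) \<le> (\<Sum>k<n. 1 :: real)"
    by (intro sum_mono) auto
  then show "empirical_cdf V m n x \<omega> \<le> 1"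
    by (cases "n = 0") (auto simp: empirical_cdf_def divide_simps)
  show "0 \<le> empirical_cdf V m n x \<omega>"
    unfolding empirical_cdf_def by (intro mult_nonneg_nonneg sum_nonneg) auto
qed

lemma empirical_cdf_integrable:
  assumes "\<And>j k. j \<ge> 1 \<Longrightarrow> k \<ge> 1 \<Longrightarrow> V j k \<in> borel_measurable P"
  shows "integrable P (empirical_cdf V m n x)"
proof (rule integrable_const_bound[where B = 1])
  have sv: "(\<lambda>\<omega>. (singular_values (scaled_power V m n \<omega>) ! k)\<^sup>2) \<in> borel_measurable P" if "k < n" for k
    by (rule measurable_singular_values[OF measurable_scaled_power[OF assms] that])
  have "(\<lambda>\<omega>. of_bool ((singular_values (scaled_power V m n \<omega>) ! k)\<^sup>2 \<le> x) :: real) \<in> borel_measurable P" if "k < n" for k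
    using measurable_compose[OF sv[OF that], of "\<lambda>y. of_bool (y \<le> x) :: real" borel] by (simp add: of_bool_def)
  then show "empirical_cdf V m n x \<in> borel_measurable P"
    unfolding empirical_cdf_def[abs_def] by (intro borel_measurable_times borel_measurable_const borel_measurable_sum) auto
  show "AE \<omega> in P. norm (empirical_cdf V m n x \<omega>) \<le> 1"
    using empirical_cdf_bounds[of V m n x] by (auto simp: abs_le_iff intro: order_trans[OF _ zero_le_one])
qed

text \<open>Off the event the two matrices coincide, and on it two values in [0, 1] differ by at
  most 1.\<close>

lemma expected_cdf_trunc_diff_le:
  assumes n: "n \<ge> 1"
  shows "\<bar>expected_cdf P X m n x - expected_cdf P (trunc_entry n) m n x\<bar> \<le> prob (large_entry_event n)"
proof -
  let ?F = "empirical_cdf X m n x" and ?G = "empirical_cdf (trunc_entry n) m n x"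
  have int: "integrable P ?F" "integrable P ?G"
    using X_measurable trunc_entry_measurable by (auto intro!: empirical_cdf_integrable)
  have "\<bar>expected_cdf P X m n x - expected_cdf P (trunc_entry n) m n x\<bar> = \<bar>expectation (\<lambda>\<omega>. ?F \<omega> - ?G \<omega>)\<bar>"
    using int by (simp add: expected_cdf_def)
  also have "\<dots> \<le> expectation (\<lambda>\<omega>. \<bar>?F \<omega> - ?G \<omega>\<bar>)"
    by (rule integral_abs_bound)
  also have "\<dots> \<le> expectation (indicator (large_entry_event n))"
  proof (rule integral_mono)
    show "integrable P (\<lambda>\<omega>. \<bar>?F \<omega> - ?G \<omega>\<bar>)" using int by auto
    show "integrable P (indicator (large_entry_event n) :: 'a \<Rightarrow> real)"
      using large_entry_event_measurable by (simp add: less_top[symmetric])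
    fix \<omega> assume \<omega>: "\<omega> \<in> space P"
    show "\<bar>?F \<omega> - ?G \<omega>\<bar> \<le> indicator (large_entry_event n) \<omega>"
    proof (cases "\<omega> \<in> large_entry_event n")
      case True
      then show ?thesis using empirical_cdf_bounds[of X m n x \<omega>] empirical_cdf_bounds[of "trunc_entry n" m n x \<omega>] by auto
    next
      case False
      then have le: "cmod (X (Suc i) (Suc j) \<omega>) \<le> sqrt (real n)" if "i < n" "j < n" for i j
        using that \<omega> unfolding large_entry_event_def by (auto simp: not_less)
      have "entry_matrix X n \<omega> = entry_matrix (trunc_entry n) n \<omega>"
        unfolding entry_matrix_def by (rule cong_mat) (auto simp: trunc_entry_def truncate_def le)
      then show ?thesis by (simp add: empirical_cdf_def scaled_power_def)
    qed
  qed
  also have "\<dots> = prob (large_entry_event n)" using large_entry_event_measurable by simp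
  finally show ?thesis .
qed

lemma expected_cdf_trunc:
  assumes n: "n \<ge> 1"
  shows "expected_cdf P (trunc_entry n) m n x = cdf (empirical_law P n (squared_sv m n)) x"
proof -
  interpret L: empirical_family P n "squared_sv m n" by (rule empirical_family_squared_sv[OF n])
  show ?thesis
    unfolding L.cdf_empirical_law expected_cdf_def empirical_cdf_def squared_sv_def by simp
qed

lemma expected_cdf_tendsto:
  assumes m: "m \<ge> 1" and G: "continuous_moment_law R (\<lambda>k. 1 / real (m * k + 1) * real ((m * k + k) choose k)) G"
  shows "(\<lambda>n. expected_cdf P X m n x) \<longlonglongrightarrow> cdf G x"
proof -
  interpret G: real_distribution G using G by (simp add: continuous_moment_law_def)
  let ?\<mu> = "\<lambda>n. empirical_law P (Suc n) (squared_sv m (Suc n))"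
  have law: "real_distribution (?\<mu> n)" for n
    by (rule empirical_family.real_distribution_empirical_law[OF empirical_family_squared_sv]) simp
  have "weak_conv_m ?\<mu> G"
  proof (rule levy_continuity)
    show "(\<lambda>n. char (?\<mu> n) t) \<longlonglongrightarrow> char G t" for t
    proof (rule char_tendsto_of_moments[where R = R])
      show "integrable (?\<mu> n) (\<lambda>x. x ^ k)" for n k by (rule integrable_empirical_moment) simp
      show "AE x in G. x \<in> {0..R}" using G by (simp add: continuous_moment_law_def)
      show "(\<lambda>n. \<integral>x. x ^ k \<partial>?\<mu> n) \<longlonglongrightarrow> (\<integral>x. x ^ k \<partial>G)" for k
        using empirical_moment_tendsto[OF m, of k] G by (simp add: continuous_moment_law_def)
    qed (use law G.real_distribution_axioms in auto)
  qed (use law G.real_distribution_axioms in auto)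
  moreover have "isCont (cdf G) x"
    using G by (simp add: G.isCont_cdf continuous_moment_law_def measure_def)
  ultimately have "(\<lambda>n. cdf (?\<mu> n) x) \<longlonglongrightarrow> cdf G x"
    by (auto simp: weak_conv_m_def weak_conv_def)
  then have "(\<lambda>n. expected_cdf P (trunc_entry (Suc n)) m (Suc n) x) \<longlonglongrightarrow> cdf G x"
    by (simp add: expected_cdf_trunc)
  then have trunc: "(\<lambda>n. expected_cdf P (trunc_entry n) m n x) \<longlonglongrightarrow> cdf G x"
    by (rule LIMSEQ_imp_Suc)
  have "(\<lambda>n. expected_cdf P X m n x - expected_cdf P (trunc_entry n) m n x) \<longlonglongrightarrow> 0"
  proof (rule Lim_null_comparison[OF _ fourth_tail_tendsto])
    show "eventually (\<lambda>n. norm (expected_cdf P X m n x - expected_cdf P (trunc_entry n) m n x) \<le> fourth_tail n) sequentially"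
      using eventually_ge_at_top[of 1]
    proof eventually_elim
      case (elim n)
      then show ?case
        using order_trans[OF expected_cdf_trunc_diff_le[OF elim] prob_large_entry_le[OF elim]] by simp
    qed
  qed
  from tendsto_add[OF this trunc] show ?thesis by simp
qed

text \<open>This evaluates the definite description: \<open>G\<close> is a solution of the moment
  problem, and its bounded support forces every other solution to have the same characteristic
  function.\<close>

lemma fuss_catalan_measure_eq:
  assumes G: "continuous_moment_law R (\<lambda>k. 1 / real (m * k + 1) * real ((m * k + k) choose k)) G"
  shows "fuss_catalan_measure m = G"
  unfolding fuss_catalan_measure_def
proof (rule the_equality)
  interpret G: real_distribution G using G by (simp add: continuous_moment_law_def)
  have bdd: "AE x in G. x \<in> {0..R}" using G by (simp add: continuous_moment_law_def)
  show "real_distribution G \<and> (\<forall>k::nat. integrable G (\<lambda>x. x ^ k) \<and>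
      (\<integral>x. x ^ k \<partial>G) = 1 / real (m * k + 1) * real ((m * k + k) choose k))"
    using G G.integrable_power_of_AE_bounded[OF bdd] by (simp add: continuous_moment_law_def)
  fix \<mu> assume \<mu>: "real_distribution \<mu> \<and> (\<forall>k::nat. integrable \<mu> (\<lambda>x. x ^ k) \<and>
      (\<integral>x. x ^ k \<partial>\<mu>) = 1 / real (m * k + 1) * real ((m * k + k) choose k))"
  show "\<mu> = G"
    by (rule real_distribution_eq_of_moments[OF _ _ G.real_distribution_axioms bdd])
      (use \<mu> G in \<open>auto simp: continuous_moment_law_def\<close>)
qed

theorem kolmogorov_distance_tendsto:
  assumes m: "m \<ge> 1"
  shows "(\<lambda>n. kolmogorov_distance P X m n) \<longlonglongrightarrow> 0"
proof -
  obtain G R where G: "continuous_moment_law R (\<lambda>k. 1 / real (m * k + 1) * real ((m * k + k) choose k)) G"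
    using fuss_catalan_law_exists[OF m] by blast
  interpret G: real_distribution G using G by (simp add: continuous_moment_law_def)
  have int: "integrable P (empirical_cdf X m n x)" for n x
    using X_measurable by (rule empirical_cdf_integrable)
  have "(\<lambda>n. SUP x. \<bar>expected_cdf P X m n x - cdf G x\<bar>) \<longlonglongrightarrow> 0"
  proof (rule cdf_tendsto_uniformly)
    show "real_distribution G" by (rule G.real_distribution_axioms)
    show "isCont (cdf G) x" for x
      using G by (simp add: G.isCont_cdf continuous_moment_law_def measure_def)
    show "mono (expected_cdf P X m n)" for n
    proof (rule monoI)
      fix x y :: real assume "x \<le> y"
      then show "expected_cdf P X m n x \<le> expected_cdf P X m n y"
        unfolding expected_cdf_def
      proof (intro integral_mono int)
        fix \<omega>
        show "empirical_cdf X m n x \<omega> \<le> empirical_cdf X m n y \<omega>"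
          unfolding empirical_cdf_def using \<open>x \<le> y\<close>
          by (intro mult_left_mono sum_mono) (auto simp: of_bool_def)
      qed
    qed
    show "expected_cdf P X m n x \<in> {0..1}" for n x
    proof -
      have "expected_cdf P X m n x \<le> expectation (\<lambda>_. 1)"
        unfolding expected_cdf_def by (intro integral_mono int empirical_cdf_bounds(2)) simp
      moreover have "0 \<le> expected_cdf P X m n x"
        unfolding expected_cdf_def by (intro Bochner_Integration.integral_nonneg empirical_cdf_bounds(1))
      ultimately show ?thesis by (simp add: prob_space)
    qed
    show "(\<lambda>n. expected_cdf P X m n x) \<longlonglongrightarrow> cdf G x" for x
      by (rule expected_cdf_tendsto[OF m G])
  qed
  then show ?thesis
    by (simp add: kolmogorov_distance_def fuss_catalan_cdf_def fuss_catalan_measure_eq[OF G])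
qed

end

theorem corollary1p1:
  fixes P :: "'a measure"
    and X :: "nat \<Rightarrow> nat \<Rightarrow> 'a \<Rightarrow> complex"
    and M :: real
    and m :: nat
  assumes "prob_space P"
    and indep: "prob_space.indep_vars P (\<lambda>_. borel) (\<lambda>(j, k). X j k) ({1..} \<times> {1..})"
    and ident: "\<And>j k. j \<ge> 1 \<Longrightarrow> k \<ge> 1 \<Longrightarrow> distr P borel (X j k) = distr P borel (X 1 1)"
    and mean: "\<And>j k. j \<ge> 1 \<Longrightarrow> k \<ge> 1 \<Longrightarrow> integrable P (X j k) \<and> (\<integral>\<omega>. X j k \<omega> \<partial>P) = 0"
    and second: "\<And>j k. j \<ge> 1 \<Longrightarrow> k \<ge> 1 \<Longrightarrow>
      integrable P (\<lambda>\<omega>. cmod (X j k \<omega>) ^ 2) \<and> (\<integral>\<omega>. cmod (X j k \<omega>) ^ 2 \<partial>P) = 1"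
    and fourth: "\<And>j k. j \<ge> 1 \<Longrightarrow> k \<ge> 1 \<Longrightarrow>
      integrable P (\<lambda>\<omega>. cmod (X j k \<omega>) ^ 4) \<and> (\<integral>\<omega>. cmod (X j k \<omega>) ^ 4 \<partial>P) = M"
    and "m \<ge> 2"
  shows "(\<lambda>n. kolmogorov_distance P X m n) \<longlonglongrightarrow> 0"
proof -
  interpret prob_space P by fact
  interpret iid_entries P X M
    by unfold_locales (fact indep, fact ident, fact mean, fact second, fact fourth)
  show ?thesis using \<open>m \<ge> 2\<close> by (intro kolmogorov_distance_tendsto) simp
qed

end
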